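(* Let $d\ge1$, let $\Omega\subset\mathbb{R}^d$ be a bounded domain with sufficiently smooth boundary, let $\alpha\in C(\mathbb{R}^d)$ satisfy $0<\alpha_{\min}\le\alpha(x)\le\alpha_{\max}<2$ for all $x$, and let $b\ge0$ and $f$ be given real functions on $\Omega$. For $h>0$ consider the finite difference scheme for the unknown grid function $(u_j)_{j\in\mathbb{Z}^d}$: $$(-\Delta_h)^{\alpha_j/2}u_j+b_ju_j=f_j\quad (x_j\in\Omega_h),\qquad u_j=0\quad (x_j\in h\mathbb{Z}^d\setminus\Omega_h),$$ where $x_j=jh$, $\alpha_j=\alpha(x_j)$, $b_j=b(x_j)$, $f_j=f(x_j)$. (Stability.) For any $h>0$ the scheme is uniquely solvable, and it is stable with respect to the right-hand side: given $h_0>0$, there is a constant $c_3$, independent of $f$ and of $h\in(0,h_0]$, such that $$\|u\|_{L_h^\infty}\le c_3\|f\|_{L_h^\infty}.$$ (Convergence.) Moreover, let $u(x)$ be the solution of $$(-\Delta)^{\alpha(x)/2}u(x)+b(x)u(x)=f(x)\ \ (x\in\Omega),\qquad u(x)=0\ \ (x\in\mathbb{R}^d\setminus\Omega),$$ let $U_j=u(x_j)$, and let $u_j$ be the numerical solution of the scheme. Assume that the solution $u(x)$ belongs to $\mathcal{B}^{s+\alpha_{\max}}(\mathbb{R}^d)$ with $0<s\le2$. Then there is a constant $c$, independent of $h\in(0,h_0]$ (possibly depending on the exact solution), such that $$\|U-u\|_{L_h^\infty}\le c\,h^{s}.$$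
   Context: Grid: $h\mathbb{Z}^d=\{x_j=jh:j\in\mathbb{Z}^d\}$, $\Omega_h=\Omega\cap h\mathbb{Z}^d$, and $\|v\|_{L_h^\infty}=\max_{x_j\in\Omega_h}|v_j|$ for a grid function $v$ (the maximum over an empty set being $0$). Discrete operator: with $D_h=[-\pi/h,\pi/h]^d$, $M_h(\xi)=\sum_{p=1}^d\frac{4}{h^2}\sin^2(\xi_ph/2)$, $\mathcal{F}_h[v](\xi)=h^d\sum_{x\in h\mathbb{Z}^d}e^{-\mathbf{i}\xi\cdot x}v(x)$ and $\mathcal{F}_h^{-1}[g](x)=\frac{1}{(2\pi)^d}\int_{D_h}e^{\mathbf{i}\xi\cdot x}g(\xi)\,d\xi$, $$(-\Delta_h)^{\alpha_j/2}v_j=\mathcal{F}_h^{-1}\big[M_h(\xi)^{\alpha_j/2}\mathcal{F}_h[v](\xi)\big](x_j)=\frac{1}{h^{\alpha_j}}\sum_{k\in\mathbb{Z}^d}a_{k-j}^{(\alpha_j)}v_k,$$ $$a_n^{(\alpha)}=\frac{1}{(2\pi)^d}\int_{[-\pi,\pi]^d}e^{-\mathbf{i}\eta\cdot n}\Big(\sum_{p=1}^d4\sin^2\frac{\eta_p}{2}\Big)^{\alpha/2}d\eta .$$ Variable-order fractional Laplacian: $$(-\Delta)^{\alpha(x)/2}u(x)=c_{d,\alpha(x)}\,\mathrm{P.V.}\int_{\mathbb{R}^d}\frac{u(x)-u(y)}{|x-y|^{d+\alpha(x)}}\,dy,\quad c_{d,\alpha(x)}=\frac{2^{\alpha(x)-1}\alpha(x)\Gamma((\alpha(x)+d)/2)}{\pi^{d/2}\Gamma(1-\alpha(x)/2)}.$$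 Spectral Barron space: with $\mathcal{F}[u](\xi)=\int_{\mathbb{R}^d}e^{-\mathbf{i}\xi\cdot x}u(x)\,dx$, $\mathcal{B}^t(\mathbb{R}^d)=\{u\in L^1(\mathbb{R}^d):\int_{\mathbb{R}^d}(1+|\xi|^t)|\mathcal{F}[u](\xi)|\,d\xi<\infty\}$, elements being identified with their continuous representatives. *)

theory Defs
  imports "HOL-Analysis.Analysis"
begin

text \<open>
  The requirement ``sufficiently smooth boundary'' is read as \<open>C\<^sup>1\<close>, the weakest of the
  \<open>C\<^sup>k\<close> conditions with \<open>k \<ge> 1\<close>: locally the domain is a strict sublevel set of a
  \<open>C\<^sup>1\<close> function with nowhere vanishing gradient.
\<close>

definition C1_boundary :: "(real ^ 'd) set \<Rightarrow> bool" where
  "C1_boundary \<Omega> \<longleftrightarrow>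
     (\<forall>x \<in> frontier \<Omega>. \<exists>U (\<phi> :: real ^ 'd \<Rightarrow> real) (g :: real ^ 'd \<Rightarrow> real ^ 'd).
        open U \<and> x \<in> U \<and> continuous_on U g \<and>
        (\<forall>y \<in> U. (\<phi> has_derivative (\<lambda>v. g y \<bullet> v)) (at y) \<and> g y \<noteq> 0) \<and>
        \<Omega> \<inter> U = {y \<in> U. \<phi> y < 0})"

definition smooth_bounded_domain :: "(real ^ 'd) set \<Rightarrow> bool" where
  "smooth_bounded_domain \<Omega> \<longleftrightarrow>
     open \<Omega> \<and> connected \<Omega> \<and> \<Omega> \<noteq> {} \<and> bounded \<Omega> \<and> C1_boundary \<Omega>"

text \<open>
  A function on the grid \<open>h\<int>\<^sup>d\<close> is represented as a function of the index
  \<open>j \<in> \<int>\<^sup>d\<close>, the grid point being \<open>x\<^sub>j = jh\<close>.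
\<close>

definition grid_pt :: "real \<Rightarrow> int ^ 'd \<Rightarrow> real ^ 'd" where
  "grid_pt h j = (\<chi> p. of_int (j $ p) * h)"

definition grid_indices :: "real \<Rightarrow> (real ^ 'd) set \<Rightarrow> (int ^ 'd) set" where
  "grid_indices h \<Omega> = {j. grid_pt h j \<in> \<Omega>}"

definition grid_norm :: "real \<Rightarrow> (real ^ 'd) set \<Rightarrow> (int ^ 'd \<Rightarrow> real) \<Rightarrow> real" where
  "grid_norm h \<Omega> v =
     (if grid_indices h \<Omega> = {} then 0 else Max ((\<lambda>j. \<bar>v j\<bar>) ` grid_indices h \<Omega>))"

definition grid_freqs :: "real \<Rightarrow> (real ^ 'd) set" where
  "grid_freqs h = {\<xi>. \<forall>p. - pi / h \<le> \<xi> $ p \<and> \<xi> $ p \<le> pi / h}"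

definition lap_symbol :: "real \<Rightarrow> real ^ 'd \<Rightarrow> real" where
  "lap_symbol h \<xi> = (\<Sum>p\<in>UNIV. 4 / h\<^sup>2 * (sin (\<xi> $ p * h / 2))\<^sup>2)"

definition grid_fourier ::
    "real \<Rightarrow> (int ^ 'd \<Rightarrow> complex) \<Rightarrow> real ^ 'd \<Rightarrow> complex" where
  "grid_fourier h v \<xi> =
     of_real (h ^ CARD('d)) *
     (\<Sum>\<^sub>\<infinity>j\<in>UNIV. exp (- (\<i> * of_real (\<xi> \<bullet> grid_pt h j))) * v j)"

definition grid_inv_fourier ::
    "real \<Rightarrow> (real ^ 'd \<Rightarrow> complex) \<Rightarrow> int ^ 'd \<Rightarrow> complex" where
  "grid_inv_fourier h g j =
     of_real (1 / (2 * pi) ^ CARD('d)) *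
     (LINT \<xi>:grid_freqs h|lborel. exp (\<i> * of_real (\<xi> \<bullet> grid_pt h j)) * g \<xi>)"

text \<open>
  The order \<open>a\<close> is constant here; the variable order enters in the scheme, where the operator
  is evaluated at index \<open>j\<close> with \<open>a = \<alpha>(x\<^sub>j)\<close>.
\<close>

definition grid_frac_lap ::
    "real \<Rightarrow> real \<Rightarrow> (int ^ 'd \<Rightarrow> complex) \<Rightarrow> int ^ 'd \<Rightarrow> complex" where
  "grid_frac_lap h a v =
     grid_inv_fourier h (\<lambda>\<xi>. of_real (lap_symbol h \<xi> powr (a / 2)) * grid_fourier h v \<xi>)"

text \<open>
  The grid function is real; the equation is stated in the complex numbers because
  \<^const>\<open>grid_frac_lap\<close> is complex-valued.
\<close>

definition scheme_solution ::
    "(real ^ 'd) set \<Rightarrow> (real ^ 'd \<Rightarrow> real) \<Rightarrow> (real ^ 'd \<Rightarrow> real) \<Rightarrow> (real ^ 'd \<Rightarrow> real) \<Rightarrow>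
     real \<Rightarrow> (int ^ 'd \<Rightarrow> real) \<Rightarrow> bool" where
  "scheme_solution \<Omega> \<alpha> b f h u \<longleftrightarrow>
     (\<forall>j \<in> grid_indices h \<Omega>.
        grid_frac_lap h (\<alpha> (grid_pt h j)) (\<lambda>k. complex_of_real (u k)) j
          + complex_of_real (b (grid_pt h j) * u j)
        = complex_of_real (f (grid_pt h j))) \<and>
     (\<forall>j. j \<notin> grid_indices h \<Omega> \<longrightarrow> u j = 0)"

definition frac_lap_const :: "nat \<Rightarrow> real \<Rightarrow> real" where
  "frac_lap_const d a =
     2 powr (a - 1) * a * Gamma ((a + real d) / 2)
       / (pi powr (real d / 2) * Gamma (1 - a / 2))"

text \<open>
  \<open>has_frac_lap \<alpha> u x L\<close> says that the principal value defining
  \<open>(-\<Delta>)\<^bsup>\<alpha>(x)/2\<^esup> u(x)\<close> exists and that the operator takes the value \<open>L\<close> there.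
\<close>

definition has_frac_lap ::
    "(real ^ 'd \<Rightarrow> real) \<Rightarrow> (real ^ 'd \<Rightarrow> real) \<Rightarrow> real ^ 'd \<Rightarrow> real \<Rightarrow> bool" where
  "has_frac_lap \<alpha> u x L \<longleftrightarrow>
     (\<forall>\<epsilon>>0. set_integrable lborel {y. norm (x - y) > \<epsilon>}
        (\<lambda>y. (u x - u y) / norm (x - y) powr (real CARD('d) + \<alpha> x))) \<and>
     ((\<lambda>\<epsilon>. frac_lap_const CARD('d) (\<alpha> x) *
         (LINT y:{y. norm (x - y) > \<epsilon>}|lborel.
            (u x - u y) / norm (x - y) powr (real CARD('d) + \<alpha> x)))
       \<longlongrightarrow> L) (at_right 0)"

definition exact_solution ::
    "(real ^ 'd) set \<Rightarrow> (real ^ 'd \<Rightarrow> real) \<Rightarrow> (real ^ 'd \<Rightarrow> real) \<Rightarrow> (real ^ 'd \<Rightarrow> real) \<Rightarrow>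
     (real ^ 'd \<Rightarrow> real) \<Rightarrow> bool" where
  "exact_solution \<Omega> \<alpha> b f u \<longleftrightarrow>
     (\<forall>x \<in> \<Omega>. \<exists>L. has_frac_lap \<alpha> u x L \<and> L + b x * u x = f x) \<and>
     (\<forall>x. x \<notin> \<Omega> \<longrightarrow> u x = 0)"

definition fourier :: "(real ^ 'd \<Rightarrow> complex) \<Rightarrow> real ^ 'd \<Rightarrow> complex" where
  "fourier u \<xi> = (LINT x|lborel. exp (- (\<i> * of_real (\<xi> \<bullet> x))) * u x)"

text \<open>
  Functions rather than classes modulo null sets: each element is its continuous representative.
\<close>

definition barron_space :: "real \<Rightarrow> (real ^ 'd \<Rightarrow> complex) set" where
  "barron_space t =
     {u. continuous_on UNIV u \<and> integrable lborel u \<and>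
         (\<integral>\<^sup>+ \<xi>. ennreal ((1 + norm \<xi> powr t) * norm (fourier u \<xi>)) \<partial>lborel) < \<infinity>}"

end

theory Submission
  imports Defs "HOL-Probability.Characteristic_Functions"
begin

text \<open>
  Let \<open>P\<close> be the mean over the \<open>2d\<close> neighbours of a grid point. Minus the discrete Laplacian is
  \<open>(2d/h\<^sup>2)(1 - P)\<close>, and for \<open>0 < \<beta> < 1\<close> the binomial series gives
  \<open>(1 - P)\<^sup>\<beta> = 1 - \<Sum>\<^sub>m w\<^sub>m P\<^bsup>m+1\<^esup>\<close> with weights \<open>w\<^sub>m \<ge> 0\<close> of total mass one. With
  \<open>\<beta> = a/2\<close> this is the discrete fractional Laplacian of order \<open>a\<close>
  (\<open>grid_frac_lap_eq_walk_frac_lap\<close>). In this form it acts on all bounded grid functions; two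
  properties can be read off. It is nonpositive at a global minimum
  (\<open>walk_frac_lap_at_minimum\<close>), and the plane wave \<open>e\<^bsup>i \<xi> \<bullet> x\<^esup>\<close> is an eigenfunction for every
  \<open>\<xi> \<in> \<real>\<^sup>d\<close>, not only for \<open>\<xi>\<close> in one period cell, with eigenvalue
  \<open>lap_symbol h \<xi> powr (a/2)\<close> (\<open>walk_frac_lap_wave_synthesis\<close>, \<open>walk_frac_lap_cos\<close>).

  Stability follows from the minimum principle and a barrier. The function \<open>1 + cos (\<xi> \<bullet> x)\<close> is
  nonnegative and bounded by two, and for a fixed small frequency \<open>\<xi>\<close> the operator maps it to
  something bounded below on \<open>\<Omega>\<close> by a positive constant, independently of \<open>h \<le> h0\<close> and of the
  order (\<open>uniform_barrier\<close>). Comparing the solution with a multiple of the barrier gives the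
  maximum norm bound (\<open>walk_scheme_stability\<close>). In particular the finite linear system is
  injective and therefore uniquely solvable.

  For convergence, \<open>u\<close> is written as its Fourier integral (\<open>fourier_inversion\<close>, by Gaussian
  regularisation). The discrete operator multiplies the density by \<open>lap_symbol h \<xi> powr (a/2)\<close>,
  since plane waves of all frequencies are eigenfunctions. The principal value operator multiplies
  it by \<open>|\<xi>|\<^sup>a\<close> (\<open>has_frac_lap_imp_fourier_multiplier\<close>); this needs the integral of
  \<open>(1 - cos (\<xi> \<bullet> z))/|z|\<^bsup>d+a\<^esup>\<close>, computed by writing the kernel as a superposition of Gaussians
  (\<open>nn_integral_one_minus_cos_kernel\<close>). The two multipliers differ by at most
  \<open>h\<^sup>s |\<xi>|\<^bsup>a+s\<^esup>\<close> (\<open>lap_symbol_error\<close>), so the Barron norm bounds the consistency error by a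
  multiple of \<open>h\<^sup>s\<close>, and stability turns this into the error estimate.
\<close>

section \<open>The binomial series of a fractional power\<close>

text \<open>
  These are the coefficients \<open>(-1)\<^sup>m (\<beta> choose m+1)\<close> of the binomial series of
  \<open>1 - (1 - T)\<^sup>\<beta>\<close>, written with a Pochhammer symbol because their sign is then visible:
  for \<open>0 \<le> \<beta> \<le> 1\<close> no factor is negative.
\<close>

definition binom_weight :: "real \<Rightarrow> nat \<Rightarrow> real" where
  "binom_weight \<beta> m = \<beta> * pochhammer (1 - \<beta>) m / fact (Suc m)"

lemma binom_weight_nonneg: "0 \<le> \<beta> \<Longrightarrow> \<beta> \<le> 1 \<Longrightarrow> 0 \<le> binom_weight \<beta> m"
  by (cases "\<beta> = 1") (auto simp: binom_weight_def pochhammer_prod intro!: mult_nonneg_nonneg divide_nonneg_nonneg prod_nonneg)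

lemma binom_weight_sums_interior:
  assumes "\<bar>T\<bar> < 1"
  shows "(\<lambda>m. binom_weight \<beta> m * T ^ Suc m) sums (1 - (1 - T) powr \<beta>)"
proof -
  have "(\<lambda>n. (\<beta> gchoose n) * (- T) ^ n) sums (1 + (- T)) powr \<beta>"
    using assms by (intro gen_binomial_real) auto
  then have "(\<lambda>n. (\<beta> gchoose Suc n) * (- T) ^ Suc n) sums ((1 - T) powr \<beta> - 1)"
    by (subst sums_Suc_iff) simp
  then have "(\<lambda>n. - ((\<beta> gchoose Suc n) * (- T) ^ Suc n)) sums (- ((1 - T) powr \<beta> - 1))"
    by (rule sums_minus)
  moreover have "- ((\<beta> gchoose Suc n) * (- T) ^ Suc n) = binom_weight \<beta> n * T ^ Suc n" for n
  proof -
    have "(-1) ^ Suc n * (-1::real) ^ Suc n = 1"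
      by (metis power_mult_distrib mult_minus1 minus_minus power_one)
    then have *: "(- T) ^ Suc n * (-1) ^ Suc n = T ^ Suc n"
      by (metis mult.commute mult_minus1 power_mult_distrib minus_minus)
    have "- ((\<beta> gchoose Suc n) * (- T) ^ Suc n)
      = - (pochhammer (- \<beta>) (Suc n) / fact (Suc n)) * ((- T) ^ Suc n * (-1) ^ Suc n)"
      by (simp add: gbinomial_pochhammer del: power_Suc pochhammer_Suc fact_Suc)
    also have "\<dots> = binom_weight \<beta> n * T ^ Suc n"
      unfolding * binom_weight_def by (simp add: pochhammer_rec add.commute del: power_Suc fact_Suc)
    finally show ?thesis .
  qed
  ultimately show ?thesis by (simp only: minus_diff_eq)
qed

text \<open>
  All terms are nonnegative, so it is enough to bound the partial sums. For \<open>0 < T < 1\<close> a partial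
  sum of \<open>binom_weight \<beta> k * T^(k+1)\<close> is at most \<open>1 - (1 - T)\<^sup>\<beta> \<le> 1\<close>; let \<open>T\<close> tend to 1.
\<close>

lemma summable_binom_weight:
  assumes "0 \<le> \<beta>" "\<beta> \<le> 1"
  shows "summable (binom_weight \<beta>)"
proof (rule bounded_imp_summable)
  show "0 \<le> binom_weight \<beta> n" for n
    using binom_weight_nonneg assms by blast
  fix n
  have "(\<Sum>k\<le>n. binom_weight \<beta> k * T ^ Suc k) \<le> 1" if "0 < T" "T < 1" for T :: real
  proof -
    have s: "(\<lambda>m. binom_weight \<beta> m * T ^ Suc m) sums (1 - (1 - T) powr \<beta>)"
      using that by (intro binom_weight_sums_interior) auto
    have "(\<Sum>k\<le>n. binom_weight \<beta> k * T ^ Suc k) \<le> (\<Sum>k. binom_weight \<beta> k * T ^ Suc k)"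
      using s that binom_weight_nonneg[OF assms] by (intro sum_le_suminf) (auto simp: sums_iff)
    also have "\<dots> \<le> 1" using s by (simp add: sums_iff)
    finally show ?thesis .
  qed
  then have "\<forall>\<^sub>F T in at_left 1. (\<Sum>k\<le>n. binom_weight \<beta> k * T ^ Suc k) \<le> 1"
    by (auto simp: eventually_at_left_field intro!: exI[of _ 0])
  moreover have "((\<lambda>T. \<Sum>k\<le>n. binom_weight \<beta> k * T ^ Suc k) \<longlongrightarrow> (\<Sum>k\<le>n. binom_weight \<beta> k * 1 ^ Suc k)) (at_left 1)"
    by (intro tendsto_intros)
  ultimately show "(\<Sum>k\<le>n. binom_weight \<beta> k) \<le> 1"
    by (auto intro: tendsto_upperbound)
qed

text \<open>
  The endpoints are needed: \<open>T = 1\<close> is the mean cosine at frequency zero, and \<open>T = -1\<close> occurs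
  too. By the summability of the weights the series converges uniformly on \<open>[-1, 1]\<close>, so the
  identity passes from the open to the closed interval. At \<open>T = 1\<close> it says that the weights sum
  to one.
\<close>

lemma binom_weight_sums:
  assumes \<beta>: "0 < \<beta>" "\<beta> \<le> 1" and T: "\<bar>T\<bar> \<le> 1"
  shows "(\<lambda>m. binom_weight \<beta> m * T ^ Suc m) sums (1 - (1 - T) powr \<beta>)"
proof -
  let ?F = "\<lambda>T. \<Sum>m. binom_weight \<beta> m * T ^ Suc m"
  have b: "norm (binom_weight \<beta> m * T ^ Suc m) \<le> binom_weight \<beta> m" if "T \<in> {-1..1}" for m T
  proof -
    have "\<bar>T\<bar> ^ Suc m \<le> 1" using that by (intro power_le_one) auto
    then show ?thesis
      using binom_weight_nonneg[of \<beta> m] \<beta> mult_left_mono[of "\<bar>T\<bar> ^ Suc m" 1 "binom_weight \<beta> m"]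
      by (simp add: abs_mult power_abs del: power_Suc)
  qed
  have "uniform_limit {-1..1} (\<lambda>n T. \<Sum>m<n. binom_weight \<beta> m * T ^ Suc m) ?F sequentially"
    using b summable_binom_weight[of \<beta>] \<beta> by (intro Weierstrass_m_test[where M="binom_weight \<beta>"]) auto
  then have "continuous_on {-1..1} ?F"
    by (rule uniform_limit_theorem[rotated]) (auto intro!: always_eventually continuous_intros)
  moreover have "continuous_on {-1..1} (\<lambda>T. 1 - (1 - T) powr \<beta>)"
    using \<beta> by (intro continuous_intros continuous_on_powr') auto
  ultimately have "continuous_on {-1..1} (\<lambda>T. ?F T - (1 - (1 - T) powr \<beta>))"
    by (rule continuous_on_diff)
  moreover have "?F T - (1 - (1 - T) powr \<beta>) = 0" if "T \<in> {-1<..<1}" for T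
    using binom_weight_sums_interior[of T \<beta>] that by (simp add: sums_iff abs_less_iff)
  ultimately have "?F T - (1 - (1 - T) powr \<beta>) = 0"
    using continuous_constant_on_closure[of "{-1<..<1}" "\<lambda>T. ?F T - (1 - (1 - T) powr \<beta>)" 0 T] T
    by (auto simp: abs_le_iff)
  moreover have "summable (\<lambda>m. binom_weight \<beta> m * T ^ Suc m)"
  proof (rule summable_comparison_test'[where g = "binom_weight \<beta>" and N = 0])
    show "summable (binom_weight \<beta>)" using \<beta> by (intro summable_binom_weight) auto
    show "norm (binom_weight \<beta> m * T ^ Suc m) \<le> binom_weight \<beta> m" for m
      using T by (intro b) (auto simp: abs_le_iff)
  qed
  ultimately show ?thesis by (simp only: sums_iff right_minus_eq)
qed

section \<open>The discrete operator as a random walk series\<close>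

text \<open>
  The transition operator of the simple random walk on \<open>\<int>\<^sup>d\<close>. The value type is arbitrary
  so that real grid functions (for order arguments) and complex ones (for Fourier analysis) can share
  all lemmas.
\<close>

definition nbr_mean :: "(int ^ 'd \<Rightarrow> 'a :: real_vector) \<Rightarrow> int ^ 'd \<Rightarrow> 'a" where
  "nbr_mean v j =
     (1 / (2 * real CARD('d))) *\<^sub>R (\<Sum>p\<in>UNIV. v (j + axis p 1) + v (j - axis p 1))"

text \<open>
  The eigenvalue of the neighbour mean on the plane wave of frequency \<open>\<xi>\<close>.
\<close>

definition mean_cos :: "real \<Rightarrow> real ^ 'd \<Rightarrow> real" where
  "mean_cos h \<xi> = (\<Sum>p\<in>UNIV. cos (\<xi> $ p * h)) / real CARD('d)"

text \<open>
  The \<open>a/2\<close>-th power of minus the discrete Laplacian, \<open>(2d/h\<^sup>2)(1 - P)\<close>, with \<open>P\<close> the neighbour mean,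
  expanded by the binomial series. It makes sense for every bounded grid function, in particular for
  plane waves, which are not summable and so have no lattice Fourier transform.
\<close>

definition walk_frac_lap ::
    "real \<Rightarrow> real \<Rightarrow> (int ^ 'd \<Rightarrow> 'a :: real_normed_vector) \<Rightarrow> int ^ 'd \<Rightarrow> 'a" where
  "walk_frac_lap h a v j =
     (2 * real CARD('d) / h\<^sup>2) powr (a / 2) *\<^sub>R
       (v j - (\<Sum>m. binom_weight (a / 2) m *\<^sub>R (nbr_mean ^^ Suc m) v j))"

lemma abs_mean_cos_le_1: "\<bar>mean_cos h (\<xi> :: real ^ 'd)\<bar> \<le> 1"
proof -
  have "\<bar>\<Sum>p\<in>UNIV. cos (\<xi> $ p * h)\<bar> \<le> (\<Sum>p\<in>(UNIV::'d set). 1)"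
    by (rule order_trans[OF sum_abs]) (intro sum_mono, simp)
  then show ?thesis by (simp add: mean_cos_def)
qed

lemma lap_symbol_eq_mean_cos:
  fixes \<xi> :: "real ^ 'd"
  assumes "h \<noteq> 0"
  shows "lap_symbol h \<xi> = 2 * real CARD('d) / h\<^sup>2 * (1 - mean_cos h \<xi>)"
proof -
  have "4 / h\<^sup>2 * (sin (\<xi> $ p * h / 2))\<^sup>2 = 2 / h\<^sup>2 * (1 - cos (\<xi> $ p * h))" for p
    using cos_double_sin[of "\<xi> $ p * h / 2"] by (simp add: field_simps)
  then have "lap_symbol h \<xi> = 2 / h\<^sup>2 * (\<Sum>p\<in>UNIV. 1 - cos (\<xi> $ p * h))"
    unfolding lap_symbol_def by (simp only: sum_distrib_left)
  also have "\<dots> = 2 / h\<^sup>2 * (real CARD('d) - real CARD('d) * mean_cos h \<xi>)"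
    by (simp add: sum_subtractf mean_cos_def)
  finally show ?thesis by (simp add: algebra_simps diff_divide_distrib)
qed

lemma lap_symbol_nonneg: "0 \<le> lap_symbol h \<xi>"
  by (auto simp: lap_symbol_def intro!: sum_nonneg)

lemma lap_symbol_powr_sums:
  fixes \<xi> :: "real ^ 'd"
  assumes "0 < h" "0 < a" "a < 2"
  shows "(2 * real CARD('d) / h\<^sup>2) powr (a / 2) * (1 - (\<Sum>m. binom_weight (a / 2) m * mean_cos h \<xi> ^ Suc m))
    = lap_symbol h \<xi> powr (a / 2)"
proof -
  have "(\<Sum>m. binom_weight (a / 2) m * mean_cos h \<xi> ^ Suc m) = 1 - (1 - mean_cos h \<xi>) powr (a / 2)"
    using binom_weight_sums[of "a/2" "mean_cos h \<xi>"] abs_mean_cos_le_1[of h \<xi>] assms by (simp add: sums_iff)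
  moreover have "0 \<le> 1 - mean_cos h \<xi>" using abs_mean_cos_le_1[of h \<xi>] by linarith
  ultimately show ?thesis
    using assms by (simp add: lap_symbol_eq_mean_cos powr_mult[symmetric])
qed

lemma grid_pt_add_axis: "grid_pt h (j + axis p 1) = grid_pt h j + h *\<^sub>R axis p 1"
  and grid_pt_diff_axis: "grid_pt h (j - axis p 1) = grid_pt h j - h *\<^sub>R axis p 1"
  by (auto simp: grid_pt_def vec_eq_iff axis_def algebra_simps)

lemma nbr_mean_linear:
  "nbr_mean (\<lambda>j. c *\<^sub>R v j + w j) j = c *\<^sub>R nbr_mean v j + nbr_mean w j"
  by (simp add: nbr_mean_def sum.distrib scaleR_sum_right algebra_simps)

lemma nbr_mean_pow_linear:
  "(nbr_mean ^^ m) (\<lambda>j. c *\<^sub>R v j + w j) = (\<lambda>j. c *\<^sub>R (nbr_mean ^^ m) v j + (nbr_mean ^^ m) w j)"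
  by (induction m) (auto simp: nbr_mean_linear)

text \<open>
  A superposition of plane waves with all frequencies in \<open>\<real>\<^sup>d\<close>, restricted to the grid. The
  density may be cut off to one period cell, which gives the inverse lattice Fourier transform, or
  may live on the whole space, which gives the restriction of a function given by its Fourier
  integral.
\<close>

definition wave_synthesis :: "real \<Rightarrow> (real ^ 'd \<Rightarrow> complex) \<Rightarrow> int ^ 'd \<Rightarrow> complex" where
  "wave_synthesis h g j = (LINT \<xi>|lborel. exp (\<i> * of_real (\<xi> \<bullet> grid_pt h j)) * g \<xi>)"

lemma integrable_unimodular_mult:
  fixes g e :: "'a :: euclidean_space \<Rightarrow> complex"
  assumes "integrable lborel g" "e \<in> borel_measurable borel" "\<And>\<xi>. norm (e \<xi>) \<le> 1"
  shows "integrable lborel (\<lambda>\<xi>. e \<xi> * g \<xi>)"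
proof (rule Bochner_Integration.integrable_bound[OF assms(1)])
  show "(\<lambda>\<xi>. e \<xi> * g \<xi>) \<in> borel_measurable lborel"
    using assms by measurable
  show "AE \<xi> in lborel. norm (e \<xi> * g \<xi>) \<le> norm (g \<xi>)"
    using assms(3) by (auto simp: norm_mult mult_left_le_one_le)
qed

lemma mean_cos_measurable[measurable]: "mean_cos h \<in> borel_measurable borel"
  unfolding mean_cos_def by measurable

lemma integrable_mean_cos_pow:
  assumes "integrable lborel g"
  shows "integrable lborel (\<lambda>\<xi>. complex_of_real (mean_cos h \<xi> ^ m) * g \<xi>)"
  by (rule integrable_unimodular_mult[OF assms])
     (auto simp: norm_power power_le_one abs_mean_cos_le_1)

lemma integrable_wave:
  assumes "integrable lborel g"
  shows "integrable lborel (\<lambda>\<xi>. exp (\<i> * complex_of_real (\<xi> \<bullet> x)) * g \<xi>)"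
  by (rule integrable_unimodular_mult[OF assms]) (auto simp: norm_exp_eq_Re)

lemma nbr_mean_wave_synthesis:
  fixes g :: "real ^ 'd \<Rightarrow> complex"
  assumes g: "integrable lborel g"
  shows "nbr_mean (wave_synthesis h g) j = wave_synthesis h (\<lambda>\<xi>. complex_of_real (mean_cos h \<xi>) * g \<xi>) j"
proof -
  let ?e = "\<lambda>\<xi> j. exp (\<i> * of_real (\<xi> \<bullet> grid_pt h j)) :: complex"
  have 1: "?e \<xi> (j + axis p 1) + ?e \<xi> (j - axis p 1) = 2 * of_real (cos (\<xi> $ p * h)) * ?e \<xi> j" for \<xi> p
  proof -
    have "?e \<xi> (j + axis p 1) = ?e \<xi> j * exp (\<i> * of_real (\<xi> $ p * h))"
      by (simp add: grid_pt_add_axis inner_add_right inner_axis distrib_left exp_add mult.commute)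
    moreover have "?e \<xi> (j - axis p 1) = ?e \<xi> j * exp (- (\<i> * of_real (\<xi> $ p * h)))"
      by (simp add: grid_pt_diff_axis inner_diff_right inner_axis right_diff_distrib exp_diff exp_minus mult.commute divide_inverse)
    ultimately show ?thesis
      using cos_exp_eq[of "of_real (\<xi> $ p * h)"]
      by (simp add: cos_of_real[symmetric] field_simps del: cos_of_real)
  qed
  have "nbr_mean (wave_synthesis h g) j
     = (1 / (2 * real CARD('d))) *\<^sub>R (\<Sum>p\<in>UNIV. LINT \<xi>|lborel. ?e \<xi> (j + axis p 1) * g \<xi> + ?e \<xi> (j - axis p 1) * g \<xi>)"
    unfolding nbr_mean_def wave_synthesis_def using integrable_wave[OF g] by simp
  also have "\<dots> = (LINT \<xi>|lborel. (1 / (2 * real CARD('d))) *\<^sub>R (\<Sum>p\<in>UNIV. ?e \<xi> (j + axis p 1) * g \<xi> + ?e \<xi> (j - axis p 1) * g \<xi>))"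
    using integrable_wave[OF g] by simp
  also have "\<dots> = wave_synthesis h (\<lambda>\<xi>. complex_of_real (mean_cos h \<xi>) * g \<xi>) j"
    unfolding wave_synthesis_def
  proof (rule Bochner_Integration.integral_cong[OF refl])
    fix \<xi> :: "real ^ 'd"
    have "(\<Sum>p\<in>UNIV. ?e \<xi> (j + axis p 1) * g \<xi> + ?e \<xi> (j - axis p 1) * g \<xi>)
      = (\<Sum>p\<in>UNIV. 2 * of_real (cos (\<xi> $ p * h)) * (?e \<xi> j * g \<xi>))"
      by (simp only: distrib_right[symmetric] 1 mult.assoc)
    also have "\<dots> = of_real (2 * (\<Sum>p\<in>UNIV. cos (\<xi> $ p * h))) * (?e \<xi> j * g \<xi>)"
      by (simp add: sum_distrib_left sum_distrib_right mult.assoc)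
    finally show "(1 / (2 * real CARD('d))) *\<^sub>R (\<Sum>p\<in>UNIV. ?e \<xi> (j + axis p 1) * g \<xi> + ?e \<xi> (j - axis p 1) * g \<xi>)
      = ?e \<xi> j * (complex_of_real (mean_cos h \<xi>) * g \<xi>)"
      by (simp add: mean_cos_def scaleR_conv_of_real field_simps)
  qed
  finally show ?thesis .
qed

lemma nbr_mean_pow_wave_synthesis:
  fixes g :: "real ^ 'd \<Rightarrow> complex"
  assumes g: "integrable lborel g"
  shows "(nbr_mean ^^ m) (wave_synthesis h g) = wave_synthesis h (\<lambda>\<xi>. complex_of_real (mean_cos h \<xi> ^ m) * g \<xi>)"
proof (induction m)
  case (Suc m)
  have "(nbr_mean ^^ Suc m) (wave_synthesis h g) = nbr_mean (wave_synthesis h (\<lambda>\<xi>. complex_of_real (mean_cos h \<xi> ^ m) * g \<xi>))"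
    using Suc by simp
  also have "\<dots> = wave_synthesis h (\<lambda>\<xi>. complex_of_real (mean_cos h \<xi>) * (complex_of_real (mean_cos h \<xi> ^ m) * g \<xi>))"
    by (intro ext nbr_mean_wave_synthesis integrable_mean_cos_pow g)
  finally show ?case by (simp add: mult.assoc)
qed simp

text \<open>
  Each power of the neighbour mean acts on the density by multiplication with a power of
  \<open>mean_cos\<close>. Since \<open>|mean_cos| \<le> 1\<close> and the weights are summable, the series may be
  interchanged with the integral, and it sums to the symbol. The density is not periodised at any
  point: this is why no aliasing terms appear in the consistency estimate.
\<close>

lemma walk_frac_lap_wave_synthesis:
  fixes g :: "real ^ 'd \<Rightarrow> complex"
  assumes g: "integrable lborel g" and "0 < h" "0 < a" "a < 2"
  shows "walk_frac_lap h a (wave_synthesis h g) j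
    = wave_synthesis h (\<lambda>\<xi>. complex_of_real (lap_symbol h \<xi> powr (a / 2)) * g \<xi>) j"
proof -
  define e where "e = (\<lambda>\<xi>. exp (\<i> * of_real (\<xi> \<bullet> grid_pt h j)) * g \<xi>)"
  define w where "w = binom_weight (a / 2)"
  define f where "f = (\<lambda>m \<xi>. complex_of_real (w m * mean_cos h \<xi> ^ Suc m) * e \<xi>)"
  have e: "integrable lborel e" unfolding e_def by (rule integrable_wave[OF g])
  have w0: "0 \<le> w m" for m unfolding w_def using assms by (intro binom_weight_nonneg) auto
  have sw: "summable w" unfolding w_def using assms by (intro summable_binom_weight) auto
  have sf: "(\<lambda>m. w m * mean_cos h \<xi> ^ Suc m) sums (1 - (1 - mean_cos h \<xi>) powr (a / 2))" for \<xi> :: "real ^ 'd"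
    unfolding w_def using assms abs_mean_cos_le_1[of h \<xi>] by (intro binom_weight_sums) auto
  have fi: "integrable lborel (f m)" for m
    using integrable_mean_cos_pow[OF e, of h "Suc m"] unfolding f_def of_real_mult mult.assoc
    by (rule integrable_mult_right)
  have nf: "norm (f m \<xi>) \<le> w m * norm (e \<xi>)" for m \<xi>
  proof -
    have "\<bar>mean_cos h \<xi>\<bar> ^ Suc m \<le> 1" by (intro power_le_one) (auto simp: abs_mean_cos_le_1)
    then have "w m * \<bar>mean_cos h \<xi>\<bar> ^ Suc m \<le> w m" using w0[of m] mult_left_mono by fastforce
    then show ?thesis
      unfolding f_def norm_mult norm_of_real using w0[of m]
      by (intro mult_right_mono) (auto simp: abs_mult power_abs)
  qed
  have snf: "summable (\<lambda>m. norm (f m \<xi>))" for \<xi>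
    by (rule summable_comparison_test'[where g = "\<lambda>m. w m * norm (e \<xi>)" and N = 0])
       (use nf sw summable_mult2 in auto)
  have "summable (\<lambda>m. \<integral>\<xi>. norm (f m \<xi>) \<partial>lborel)"
  proof (rule summable_comparison_test'[where g = "\<lambda>m. w m * (\<integral>\<xi>. norm (e \<xi>) \<partial>lborel)" and N = 0])
    show "summable (\<lambda>m. w m * (\<integral>\<xi>. norm (e \<xi>) \<partial>lborel))" using sw by (rule summable_mult2)
    fix m
    have "(\<integral>\<xi>. norm (f m \<xi>) \<partial>lborel) \<le> (\<integral>\<xi>. w m * norm (e \<xi>) \<partial>lborel)"
      using fi e nf by (intro integral_mono integrable_norm integrable_mult_right) auto
    then show "norm (\<integral>\<xi>. norm (f m \<xi>) \<partial>lborel) \<le> w m * (\<integral>\<xi>. norm (e \<xi>) \<partial>lborel)" by simp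
  qed
  then have S: "(\<lambda>m. integral\<^sup>L lborel (f m)) sums (\<integral>\<xi>. (\<Sum>m. f m \<xi>) \<partial>lborel)"
    and I: "integrable lborel (\<lambda>\<xi>. \<Sum>m. f m \<xi>)"
    using fi snf by (auto intro!: sums_integral integrable_suminf)
  have int_f: "integral\<^sup>L lborel (f m) = w m *\<^sub>R (nbr_mean ^^ Suc m) (wave_synthesis h g) j" for m
  proof -
    have "integral\<^sup>L lborel (f m) = (LINT \<xi>|lborel. of_real (w m) * (exp (\<i> * of_real (\<xi> \<bullet> grid_pt h j)) *
       (complex_of_real (mean_cos h \<xi> ^ Suc m) * g \<xi>)))"
      unfolding f_def e_def by (simp add: mult_ac)
    then show ?thesis
      unfolding nbr_mean_pow_wave_synthesis[OF g] wave_synthesis_def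
      by (simp add: scaleR_conv_of_real)
  qed
  have "(\<Sum>m. w m *\<^sub>R (nbr_mean ^^ Suc m) (wave_synthesis h g) j) = (\<integral>\<xi>. (\<Sum>m. f m \<xi>) \<partial>lborel)"
    using S unfolding int_f by (simp add: sums_iff)
  then have "walk_frac_lap h a (wave_synthesis h g) j = (2 * real CARD('d) / h\<^sup>2) powr (a / 2) *\<^sub>R
     ((\<integral>\<xi>. e \<xi> \<partial>lborel) - (\<integral>\<xi>. (\<Sum>m. f m \<xi>) \<partial>lborel))"
    unfolding walk_frac_lap_def w_def[symmetric] by (simp add: wave_synthesis_def e_def)
  also have "\<dots> = (\<integral>\<xi>. (2 * real CARD('d) / h\<^sup>2) powr (a / 2) *\<^sub>R (e \<xi> - (\<Sum>m. f m \<xi>)) \<partial>lborel)"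
    using e I by simp
  also have "\<dots> = wave_synthesis h (\<lambda>\<xi>. complex_of_real (lap_symbol h \<xi> powr (a / 2)) * g \<xi>) j"
    unfolding wave_synthesis_def
  proof (rule Bochner_Integration.integral_cong[OF refl])
    fix \<xi> :: "real ^ 'd"
    have "(\<Sum>m. f m \<xi>) = complex_of_real (\<Sum>m. w m * mean_cos h \<xi> ^ Suc m) * e \<xi>"
      unfolding f_def
      by (subst suminf_mult2[symmetric], rule summable_of_real, use sf[of \<xi>] in \<open>simp add: sums_iff\<close>)
         (subst suminf_of_real, use sf[of \<xi>] in \<open>auto simp: sums_iff\<close>)
    then have "e \<xi> - (\<Sum>m. f m \<xi>) = complex_of_real (1 - (\<Sum>m. w m * mean_cos h \<xi> ^ Suc m)) * e \<xi>"
      by (simp add: algebra_simps)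
    then have "(2 * real CARD('d) / h\<^sup>2) powr (a / 2) *\<^sub>R (e \<xi> - (\<Sum>m. f m \<xi>))
      = complex_of_real ((2 * real CARD('d) / h\<^sup>2) powr (a / 2) * (1 - (\<Sum>m. w m * mean_cos h \<xi> ^ Suc m))) * e \<xi>"
      by (simp only: scaleR_conv_of_real of_real_mult mult.assoc)
    then show "(2 * real CARD('d) / h\<^sup>2) powr (a / 2) *\<^sub>R (e \<xi> - (\<Sum>m. f m \<xi>))
      = exp (\<i> * of_real (\<xi> \<bullet> grid_pt h j)) * (complex_of_real (lap_symbol h \<xi> powr (a / 2)) * g \<xi>)"
      unfolding w_def lap_symbol_powr_sums[OF assms(2-4)] e_def by simp
  qed
  finally show ?thesis .
qed

section \<open>The discrete minimum principle and stability\<close>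

lemma norm_nbr_mean_pow_le:
  fixes v :: "int ^ 'd \<Rightarrow> 'a :: real_normed_vector"
  assumes "\<And>k. norm (v k) \<le> B"
  shows "norm ((nbr_mean ^^ m) v j) \<le> B"
proof (induction m arbitrary: j)
  case (Suc m)
  have "norm (\<Sum>p\<in>(UNIV::'d set). (nbr_mean ^^ m) v (j + axis p 1) + (nbr_mean ^^ m) v (j - axis p 1))
     \<le> (\<Sum>p\<in>(UNIV::'d set). 2 * B)"
  proof (rule sum_norm_le)
    fix p :: 'd
    show "norm ((nbr_mean ^^ m) v (j + axis p 1) + (nbr_mean ^^ m) v (j - axis p 1)) \<le> 2 * B"
      using Suc[of "j + axis p 1"] Suc[of "j - axis p 1"] by (intro norm_triangle_le) simp
  qed
  then show ?case unfolding funpow.simps(2) o_def nbr_mean_def[of "(nbr_mean ^^ m) v"] by (simp add: field_simps)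
qed (use assms in simp)

lemma nbr_mean_pow_ge:
  fixes v :: "int ^ 'd \<Rightarrow> real"
  assumes "\<And>k. c \<le> v k"
  shows "c \<le> (nbr_mean ^^ m) v j"
proof (induction m arbitrary: j)
  case (Suc m)
  have "(\<Sum>p\<in>(UNIV::'d set). 2 * c) \<le> (\<Sum>p\<in>(UNIV::'d set). (nbr_mean ^^ m) v (j + axis p 1) + (nbr_mean ^^ m) v (j - axis p 1))"
  proof (rule sum_mono)
    fix p :: 'd
    show "2 * c \<le> (nbr_mean ^^ m) v (j + axis p 1) + (nbr_mean ^^ m) v (j - axis p 1)"
      using Suc[of "j + axis p 1"] Suc[of "j - axis p 1"] by simp
  qed
  then show ?case unfolding funpow.simps(2) o_def nbr_mean_def[of "(nbr_mean ^^ m) v"] by (simp add: field_simps)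
qed (use assms in simp)

lemma nbr_mean_pow_of_real:
  fixes u :: "int ^ 'd \<Rightarrow> real"
  shows "(nbr_mean ^^ m) (\<lambda>k. of_real (u k) :: 'a :: real_normed_algebra_1) = (\<lambda>k. of_real ((nbr_mean ^^ m) u k))"
proof (induction m)
  case (Suc m)
  have "nbr_mean (\<lambda>k. of_real (w k) :: 'a) = (\<lambda>k. of_real (nbr_mean w k))" for w :: "int ^ 'd \<Rightarrow> real"
    unfolding nbr_mean_def real_scaleR_def by (simp only: scaleR_conv_of_real of_real_mult of_real_sum of_real_add)
  with Suc show ?case by simp
qed simp

lemma summable_walk:
  fixes v :: "int ^ 'd \<Rightarrow> 'a :: banach"
  assumes "\<And>k. norm (v k) \<le> B" "0 < a" "a < 2"
  shows "summable (\<lambda>m. binom_weight (a / 2) m *\<^sub>R (nbr_mean ^^ Suc m) v j)"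
proof (rule summable_comparison_test'[where g = "\<lambda>m. binom_weight (a / 2) m * B" and N = 0])
  show "summable (\<lambda>m. binom_weight (a / 2) m * B)"
    using assms by (intro summable_mult2 summable_binom_weight) auto
  show "norm (binom_weight (a / 2) m *\<^sub>R (nbr_mean ^^ Suc m) v j) \<le> binom_weight (a / 2) m * B" for m
    using norm_nbr_mean_pow_le[where v = v and B = B and m = "Suc m" and j = j, OF assms(1)] binom_weight_nonneg[of "a/2" m] assms(2,3)
    by (simp add: mult_left_mono del: funpow.simps)
qed

lemma walk_frac_lap_linear:
  fixes v w :: "int ^ 'd \<Rightarrow> 'a :: banach"
  assumes "\<And>k. norm (v k) \<le> B" "\<And>k. norm (w k) \<le> B'" "0 < a" "a < 2"
  shows "walk_frac_lap h a (\<lambda>k. c *\<^sub>R v k + w k) j = c *\<^sub>R walk_frac_lap h a v j + walk_frac_lap h a w j"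
proof -
  let ?s = "\<lambda>v m. binom_weight (a / 2) m *\<^sub>R (nbr_mean ^^ Suc m) v j"
  have sv: "summable (?s v)" and sw: "summable (?s w)"
    using summable_walk[where v = v and B = B and a = a and j = j, OF assms(1,3,4)]
      summable_walk[where v = w and B = B' and a = a and j = j, OF assms(2-4)] by auto
  have "?s (\<lambda>k. c *\<^sub>R v k + w k) = (\<lambda>m. c *\<^sub>R ?s v m + ?s w m)"
    unfolding nbr_mean_pow_linear by (simp add: scaleR_add_right mult.commute del: funpow.simps)
  then have "(\<Sum>m. ?s (\<lambda>k. c *\<^sub>R v k + w k) m) = (\<Sum>m. c *\<^sub>R ?s v m + ?s w m)"
    by (rule arg_cong)
  also have "\<dots> = (\<Sum>m. c *\<^sub>R ?s v m) + (\<Sum>m. ?s w m)"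
    using sv sw by (intro suminf_add[symmetric] summable_scaleR_right)
  also have "(\<Sum>m. c *\<^sub>R ?s v m) = c *\<^sub>R (\<Sum>m. ?s v m)"
    using sv by (rule suminf_scaleR_right[symmetric])
  finally show ?thesis
    unfolding walk_frac_lap_def by (simp add: algebra_simps del: funpow.simps)
qed

lemma walk_frac_lap_of_real:
  fixes u :: "int ^ 'd \<Rightarrow> real"
  assumes "\<And>k. \<bar>u k\<bar> \<le> B" "0 < a" "a < 2"
  shows "walk_frac_lap h a (\<lambda>k. complex_of_real (u k)) j = complex_of_real (walk_frac_lap h a u j)"
proof -
  have "summable (\<lambda>m. binom_weight (a / 2) m *\<^sub>R (nbr_mean ^^ Suc m) u j)"
    using assms by (intro summable_walk) auto
  then show ?thesis
    unfolding walk_frac_lap_def nbr_mean_pow_of_real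
    by (simp add: scaleR_conv_of_real suminf_of_real del: funpow.simps)
qed

lemma nbr_mean_cos:
  fixes \<xi> :: "real ^ 'd"
  shows "nbr_mean (\<lambda>k. c * cos (\<xi> \<bullet> grid_pt h k)) j = mean_cos h \<xi> * (c * cos (\<xi> \<bullet> grid_pt h j))"
proof -
  have "c * cos (\<xi> \<bullet> grid_pt h (j + axis p 1)) + c * cos (\<xi> \<bullet> grid_pt h (j - axis p 1))
     = cos (\<xi> $ p * h) * (2 * c * cos (\<xi> \<bullet> grid_pt h j))" for p
  proof -
    have e: "\<xi> \<bullet> (h *\<^sub>R axis p 1) = \<xi> $ p * h" by (simp add: inner_axis)
    show ?thesis
      unfolding grid_pt_add_axis grid_pt_diff_axis inner_add_right inner_diff_right cos_add cos_diff e
      by (simp only: ring_distribs) simp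
  qed
  then have "(\<Sum>p\<in>UNIV. c * cos (\<xi> \<bullet> grid_pt h (j + axis p 1)) + c * cos (\<xi> \<bullet> grid_pt h (j - axis p 1)))
     = (\<Sum>p\<in>UNIV. cos (\<xi> $ p * h)) * (2 * c * cos (\<xi> \<bullet> grid_pt h j))"
    unfolding sum_distrib_right by (intro sum.cong refl)
  from this show ?thesis
    unfolding nbr_mean_def mean_cos_def by (simp only:) simp
qed

lemma walk_frac_lap_cos:
  fixes \<xi> :: "real ^ 'd"
  assumes "0 < h" "0 < a" "a < 2"
  shows "walk_frac_lap h a (\<lambda>k. cos (\<xi> \<bullet> grid_pt h k)) j = lap_symbol h \<xi> powr (a / 2) * cos (\<xi> \<bullet> grid_pt h j)"
proof -
  have p: "(nbr_mean ^^ m) (\<lambda>k. cos (\<xi> \<bullet> grid_pt h k)) = (\<lambda>k. mean_cos h \<xi> ^ m * cos (\<xi> \<bullet> grid_pt h k))" for m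
    by (induction m) (auto simp: nbr_mean_cos)
  have s: "summable (\<lambda>m. binom_weight (a / 2) m * mean_cos h \<xi> ^ Suc m)"
    using binom_weight_sums[of "a/2" "mean_cos h \<xi>"] assms abs_mean_cos_le_1[of h \<xi>] by (simp add: sums_iff)
  have "(\<Sum>m. binom_weight (a / 2) m *\<^sub>R (nbr_mean ^^ Suc m) (\<lambda>k. cos (\<xi> \<bullet> grid_pt h k)) j)
    = (\<Sum>m. binom_weight (a / 2) m * mean_cos h \<xi> ^ Suc m) * cos (\<xi> \<bullet> grid_pt h j)"
    unfolding p suminf_mult2[OF s] by (simp add: mult.assoc)
  then show ?thesis
    unfolding lap_symbol_powr_sums[OF assms, symmetric] walk_frac_lap_def
    by (simp add: algebra_simps del: funpow.simps power_Suc)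
qed

text \<open>
  The value of \<open>walk_frac_lap\<close> at \<open>j\<close> is a positive multiple of \<open>v j\<close> minus an average of values
  of \<open>v\<close>, as the weights are nonnegative with sum one and each power of the neighbour mean is itself
  an average.
\<close>

lemma walk_frac_lap_at_minimum:
  fixes v :: "int ^ 'd \<Rightarrow> real"
  assumes "\<And>k. \<bar>v k\<bar> \<le> B" "\<And>k. v j \<le> v k" "0 < a" "a < 2"
  shows "walk_frac_lap h a v j \<le> 0"
proof -
  have w: "binom_weight (a / 2) sums 1"
    using binom_weight_sums[of "a / 2" 1] assms by simp
  have "v j = (\<Sum>m. binom_weight (a / 2) m * v j)"
    using w by (subst suminf_mult2[symmetric]) (auto simp: sums_iff)
  also have "\<dots> \<le> (\<Sum>m. binom_weight (a / 2) m *\<^sub>R (nbr_mean ^^ Suc m) v j)"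
  proof (rule suminf_le)
    show "summable (\<lambda>m. binom_weight (a / 2) m * v j)" using w by (auto simp: sums_iff intro: summable_mult2)
    show "summable (\<lambda>m. binom_weight (a / 2) m *\<^sub>R (nbr_mean ^^ Suc m) v j)"
      using assms by (intro summable_walk) auto
    show "binom_weight (a / 2) m * v j \<le> binom_weight (a / 2) m *\<^sub>R (nbr_mean ^^ Suc m) v j" for m
      using nbr_mean_pow_ge[where c = "v j" and v = v and m = "Suc m" and j = j, OF assms(2)] binom_weight_nonneg[of "a/2" m] assms
      by (simp add: mult_left_mono del: funpow.simps)
  qed
  finally show ?thesis
    unfolding walk_frac_lap_def by (simp add: mult_nonneg_nonpos del: funpow.simps)
qed

lemma walk_frac_lap_zero:
  fixes j :: "int ^ 'b"
  shows "walk_frac_lap h a (\<lambda>k. 0 :: 'a :: real_normed_vector) j = 0"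
proof -
  have "(nbr_mean ^^ m) (\<lambda>k :: int ^ 'b. 0 :: 'a) = (\<lambda>k. 0)" for m
    by (induction m) (auto simp: nbr_mean_def)
  then show ?thesis by (simp add: walk_frac_lap_def del: funpow.simps)
qed

lemma walk_frac_lap_minus:
  fixes v :: "int ^ 'd \<Rightarrow> 'a :: banach"
  assumes "\<And>k. norm (v k) \<le> B" "0 < a" "a < 2"
  shows "walk_frac_lap h a (\<lambda>k. - v k) j = - walk_frac_lap h a v j"
  using walk_frac_lap_linear[where v = v and w = "\<lambda>k. 0" and B = B and B' = 0 and c = "-1"] assms by (simp add: walk_frac_lap_zero)

lemma finite_support_bounded:
  fixes u :: "'i \<Rightarrow> real"
  assumes "finite S" "\<And>j. j \<notin> S \<Longrightarrow> u j = 0"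
  shows "\<bar>u k\<bar> \<le> (\<Sum>j\<in>S. \<bar>u j\<bar>)"
proof (cases "k \<in> S")
  case True
  then show ?thesis using assms member_le_sum[of k S "\<lambda>j. \<bar>u j\<bar>"] by simp
next
  case False
  then show ?thesis using assms by (simp add: sum_nonneg)
qed

text \<open>
  Comparison with the barrier \<open>W = (F'/\<kappa>)(1 + cos (\<xi> \<bullet> x))\<close>. The constant is annihilated by
  the operator and the cosine is an eigenfunction, so the operator applied to \<open>W\<close> is at least
  \<open>F'\<close> on \<open>S\<close>; and \<open>W\<close> is nonnegative everywhere because of the constant. If \<open>W - u\<close> were
  negative somewhere, it would have a negative global minimum in \<open>S\<close>, where the minimum principle
  contradicts the inequality for \<open>u\<close>.
\<close>

lemma walk_scheme_upper_bound:
  fixes \<xi> :: "real ^ 'd" and u b A :: "int ^ 'd \<Rightarrow> real"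
  assumes S: "finite S" and "0 < h" and A: "\<And>j. j \<in> S \<Longrightarrow> 0 < A j" "\<And>j. j \<in> S \<Longrightarrow> A j < 2"
    and \<kappa>: "0 < \<kappa>" "\<And>j. j \<in> S \<Longrightarrow> \<kappa> \<le> lap_symbol h \<xi> powr (A j / 2) * cos (\<xi> \<bullet> grid_pt h j)"
    and b: "\<And>j. j \<in> S \<Longrightarrow> 0 \<le> b j" and u: "\<And>j. j \<notin> S \<Longrightarrow> u j = 0"
    and F: "0 \<le> F" "\<And>j. j \<in> S \<Longrightarrow> walk_frac_lap h (A j) u j + b j * u j \<le> F"
  shows "u j \<le> 2 * F / \<kappa>"
proof -
  define B where "B = (\<Sum>j\<in>S. \<bar>u j\<bar>)"
  have B: "\<bar>u k\<bar> \<le> B" for k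
    unfolding B_def by (rule finite_support_bounded[OF S u])
  \<comment> \<open>A strictly larger \<open>F'\<close> gives a strict contradiction at the minimum even where \<open>b = 0\<close>.\<close>
  have main: "u j \<le> F' / \<kappa> * (1 + cos (\<xi> \<bullet> grid_pt h j))" if F': "F < F'" for F' j
  proof (rule ccontr)
    define W where "W = (\<lambda>j. F' / \<kappa> * (1 + cos (\<xi> \<bullet> grid_pt h j)))"
    define v where "v = (\<lambda>j. W j - u j)"
    have W0: "0 \<le> W k" for k
      using \<kappa>(1) F' F(1) cos_ge_minus_one[of "\<xi> \<bullet> grid_pt h k"] unfolding W_def
      by (intro mult_nonneg_nonneg divide_nonneg_pos) linarith+
    assume "\<not> u j \<le> F' / \<kappa> * (1 + cos (\<xi> \<bullet> grid_pt h j))"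
    then have vj: "v j < 0" by (simp add: v_def W_def)
    have vS: "0 \<le> v k" if "k \<notin> S" for k using u[OF that] W0[of k] by (simp add: v_def)
    then have jS: "j \<in> S" using vj by fastforce
    obtain i where i: "i \<in> S" "v i = Min (v ` S)"
      using S jS Min_in[of "v ` S"] by fastforce
    have i_min: "v i \<le> v k" for k
    proof (cases "k \<in> S")
      case True then show ?thesis using i S by auto
    next
      case False
      have "v i \<le> v j" using i S jS by auto
      then show ?thesis using vj vS[OF False] by linarith
    qed
    have vi: "v i < 0" using i_min[of j] vj by linarith
    have cb: "norm (cos (x :: real)) \<le> 1" for x by simp
    have c1: "walk_frac_lap h (A i) (\<lambda>k. 1 :: real) i = 0"
      using walk_frac_lap_cos[of h "A i" "0 :: real ^ 'd" i] A[OF i(1)] \<open>0 < h\<close> by (simp add: lap_symbol_def)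
    have "walk_frac_lap h (A i) (\<lambda>k. 1 *\<^sub>R cos (\<xi> \<bullet> grid_pt h k) + 1) i
       = lap_symbol h \<xi> powr (A i / 2) * cos (\<xi> \<bullet> grid_pt h i)"
      using A[OF i(1)] \<open>0 < h\<close>
      by (subst walk_frac_lap_linear[where B=1 and B'=1]) (auto simp: c1 walk_frac_lap_cos)
    then have c2: "\<kappa> \<le> walk_frac_lap h (A i) (\<lambda>k. cos (\<xi> \<bullet> grid_pt h k) + 1) i"
      using \<kappa>(2)[OF i(1)] by simp
    have cb2: "norm (cos (\<xi> \<bullet> grid_pt h k) + 1) \<le> 2" for k
      using cos_le_one[of "\<xi> \<bullet> grid_pt h k"] cos_ge_minus_one[of "\<xi> \<bullet> grid_pt h k"] unfolding real_norm_def by linarith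
    have v_eq: "v = (\<lambda>k. (F' / \<kappa>) *\<^sub>R (cos (\<xi> \<bullet> grid_pt h k) + 1) + - u k)"
      by (simp add: v_def W_def fun_eq_iff add.commute)
    have "walk_frac_lap h (A i) v i = (F' / \<kappa>) *\<^sub>R walk_frac_lap h (A i) (\<lambda>k. cos (\<xi> \<bullet> grid_pt h k) + 1) i
        + walk_frac_lap h (A i) (\<lambda>k. - u k) i"
      unfolding v_eq using A[OF i(1)] B cb2 by (intro walk_frac_lap_linear[where B=2 and B'=B]) auto
    also have "\<dots> = (F' / \<kappa>) * walk_frac_lap h (A i) (\<lambda>k. cos (\<xi> \<bullet> grid_pt h k) + 1) i
        - walk_frac_lap h (A i) u i"
      using walk_frac_lap_minus[of u B "A i"] A[OF i(1)] B by simp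
    finally have "walk_frac_lap h (A i) v i = \<dots>" .
    moreover have "F' \<le> (F' / \<kappa>) * walk_frac_lap h (A i) (\<lambda>k. cos (\<xi> \<bullet> grid_pt h k) + 1) i"
      using mult_left_mono[OF c2, of "F' / \<kappa>"] \<kappa>(1) F' F(1) by simp
    moreover have "walk_frac_lap h (A i) v i \<le> 0"
    proof (rule walk_frac_lap_at_minimum)
      fix k
      have "norm (v k) \<le> norm ((F' / \<kappa>) *\<^sub>R (cos (\<xi> \<bullet> grid_pt h k) + 1)) + norm (- u k)"
        unfolding v_eq by (rule norm_triangle_ineq)
      also have "\<dots> \<le> F' / \<kappa> * 2 + B"
        using cb2[of k] B[of k] \<kappa>(1) F' F(1) by (intro add_mono) (auto simp: abs_mult intro!: mult_left_mono divide_right_mono)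
      finally show "\<bar>v k\<bar> \<le> F' / \<kappa> * 2 + B" by simp
    qed (use i_min A[OF i(1)] in auto)
    moreover have "b i * W i - b i * u i \<le> 0"
      using b[OF i(1)] vi by (simp add: v_def right_diff_distrib[symmetric] mult_nonneg_nonpos)
    moreover have "0 \<le> b i * W i" using b[OF i(1)] W0[of i] by simp
    moreover have "walk_frac_lap h (A i) u i + b i * u i \<le> F" using F(2) i(1) .
    ultimately show False using F' by linarith
  qed
  have "\<kappa> * u j \<le> 2 * F' " if "F < F'" for F'
  proof -
    have "u j \<le> F' / \<kappa> * (1 + cos (\<xi> \<bullet> grid_pt h j))" using main[OF that] .
    also have "\<dots> \<le> F' / \<kappa> * 2"
      using \<kappa>(1) F(1) that by (intro mult_left_mono) auto
    finally show ?thesis using \<kappa>(1) by (simp add: field_simps)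
  qed
  then have "\<kappa> * u j / 2 \<le> F' " if "F < F'" for F' using that by fastforce
  \<comment> \<open>Let \<open>F'\<close> decrease to \<open>F\<close>.\<close>
  then have "\<kappa> * u j / 2 \<le> F" by (rule dense_ge)
  then show ?thesis using \<kappa>(1) by (simp add: field_simps)
qed

lemma walk_scheme_stability:
  fixes \<xi> :: "real ^ 'd" and u b A :: "int ^ 'd \<Rightarrow> real"
  assumes S: "finite S" and "0 < h" and A: "\<And>j. j \<in> S \<Longrightarrow> 0 < A j" "\<And>j. j \<in> S \<Longrightarrow> A j < 2"
    and \<kappa>: "0 < \<kappa>" "\<And>j. j \<in> S \<Longrightarrow> \<kappa> \<le> lap_symbol h \<xi> powr (A j / 2) * cos (\<xi> \<bullet> grid_pt h j)"
    and b: "\<And>j. j \<in> S \<Longrightarrow> 0 \<le> b j" and u: "\<And>j. j \<notin> S \<Longrightarrow> u j = 0"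
    and F: "0 \<le> F" "\<And>j. j \<in> S \<Longrightarrow> \<bar>walk_frac_lap h (A j) u j + b j * u j\<bar> \<le> F"
  shows "\<bar>u j\<bar> \<le> 2 * F / \<kappa>"
proof -
  have neg: "walk_frac_lap h (A i) (\<lambda>k. - u k) i = - walk_frac_lap h (A i) u i" if "i \<in> S" for i
    using A[OF that] finite_support_bounded[OF S u] by (intro walk_frac_lap_minus) auto
  have "u j \<le> 2 * F / \<kappa>"
    using F by (intro walk_scheme_upper_bound[OF S \<open>0 < h\<close> A \<kappa> b u]) (auto simp: abs_le_iff)
  moreover have "- u j \<le> 2 * F / \<kappa>"
  proof (rule walk_scheme_upper_bound[OF S \<open>0 < h\<close> A \<kappa> b, where u = "\<lambda>j. - u j"])
    fix j assume "j \<in> S"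
    show "walk_frac_lap h (A j) (\<lambda>k. - u k) j + b j * - u j \<le> F"
      using F(2)[OF \<open>j \<in> S\<close>] neg[OF \<open>j \<in> S\<close>] by (simp add: abs_le_iff)
  qed (use u F in auto)
  ultimately show ?thesis by (simp add: abs_le_iff)
qed


section \<open>Bounds for the discrete symbol\<close>

lemma x_cos_le_sin:
  assumes "0 \<le> x" "x \<le> pi"
  shows "x * cos x \<le> sin (x :: real)"
proof -
  have "sin 0 - 0 * cos 0 \<le> sin x - x * cos x"
  proof (rule DERIV_nonneg_imp_nondecreasing[OF assms(1)])
    fix y assume y: "0 \<le> y" "y \<le> x"
    have "((\<lambda>y. sin y - y * cos y) has_real_derivative y * sin y) (at y)"
      by (auto intro!: derivative_eq_intros)
    moreover have "0 \<le> y * sin y" using y assms by (intro mult_nonneg_nonneg sin_ge_zero) auto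
    ultimately show "\<exists>D. ((\<lambda>y. sin y - y * cos y) has_real_derivative D) (at y) \<and> 0 \<le> D" by blast
  qed
  then show ?thesis by simp
qed

text \<open>
  From \<open>y cos y \<le> sin y\<close> one gets \<open>sin\<^sup>2 y \<ge> y\<^sup>2 (1 - sin\<^sup>2 y)\<close>, and \<open>sin\<^sup>2 y \<le> y\<^sup>2\<close>. It holds
  for all \<open>y\<close> because the left side is negative beyond one.
\<close>

lemma sin_squared_ge: "y\<^sup>2 * (1 - y\<^sup>2) \<le> (sin (y :: real))\<^sup>2"
proof -
  have main: "y\<^sup>2 * (1 - y\<^sup>2) \<le> (sin y)\<^sup>2" if "0 \<le> y" for y :: real
  proof (cases "y \<le> 1")
    case True
    have "0 \<le> cos y" using True that pi_gt3 by (intro cos_ge_zero) auto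
    then have "(y * cos y)\<^sup>2 \<le> (sin y)\<^sup>2"
      using x_cos_le_sin[of y] True that pi_gt3 by (intro power_mono) auto
    moreover have "(sin y)\<^sup>2 \<le> y\<^sup>2"
      using abs_sin_x_le_abs_x[of y] by (simp add: abs_le_square_iff)
    then have "y\<^sup>2 * (1 - y\<^sup>2) \<le> y\<^sup>2 * (cos y)\<^sup>2"
      by (intro mult_left_mono) (auto simp: cos_squared_eq)
    ultimately show ?thesis by (simp add: power_mult_distrib)
  next
    case False
    then have "y\<^sup>2 * (1 - y\<^sup>2) \<le> 0" by (intro mult_nonneg_nonpos) auto
    then show ?thesis using zero_le_power2[of "sin y"] by linarith
  qed
  show ?thesis using main[of y] main[of "- y"] by (cases "0 \<le> y") auto
qed

lemma norm_vec_squared: "(norm (\<xi> :: real ^ 'd))\<^sup>2 = (\<Sum>p\<in>UNIV. (\<xi> $ p)\<^sup>2)"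
  unfolding power2_norm_eq_inner inner_vec_def by (simp add: power2_eq_square)

lemma lap_symbol_le:
  fixes \<xi> :: "real ^ 'd"
  assumes "0 < h" shows "lap_symbol h \<xi> \<le> (norm \<xi>)\<^sup>2"
  unfolding lap_symbol_def norm_vec_squared
proof (rule sum_mono)
  fix p
  have "(sin (\<xi> $ p * h / 2))\<^sup>2 \<le> (\<xi> $ p * h / 2)\<^sup>2"
    using abs_sin_x_le_abs_x[of "\<xi> $ p * h / 2"] by (simp only: abs_le_square_iff)
  then have "4 / h\<^sup>2 * (sin (\<xi> $ p * h / 2))\<^sup>2 \<le> 4 / h\<^sup>2 * (\<xi> $ p * h / 2)\<^sup>2"
    using assms by (intro mult_left_mono) auto
  then show "4 / h\<^sup>2 * (sin (\<xi> $ p * h / 2))\<^sup>2 \<le> (\<xi> $ p)\<^sup>2"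
    using assms by (simp add: power_mult_distrib power_divide)
qed

lemma lap_symbol_ge:
  fixes \<xi> :: "real ^ 'd"
  assumes "0 < h" shows "(norm \<xi>)\<^sup>2 * (1 - (h * norm \<xi>)\<^sup>2) \<le> lap_symbol h \<xi>"
  unfolding lap_symbol_def norm_vec_squared sum_distrib_right
proof (rule sum_mono)
  fix p
  have "(\<xi> $ p)\<^sup>2 \<le> (norm \<xi>)\<^sup>2"
    using component_le_norm_cart[of \<xi> p] by (metis abs_ge_zero power2_abs power_mono)
  then have "h\<^sup>2 * (\<xi> $ p)\<^sup>2 \<le> h\<^sup>2 * (norm \<xi>)\<^sup>2" "0 \<le> h\<^sup>2 * (\<xi> $ p)\<^sup>2"
    by (auto intro: mult_left_mono)
  moreover have "(\<xi> $ p * h / 2)\<^sup>2 = h\<^sup>2 * (\<xi> $ p)\<^sup>2 / 4"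
    by (simp add: power_mult_distrib power_divide mult.commute)
  ultimately have "(\<xi> $ p * h / 2)\<^sup>2 \<le> (h * norm \<xi>)\<^sup>2"
    unfolding power_mult_distrib by linarith
  then have "(\<xi> $ p)\<^sup>2 * (1 - (h * norm \<xi>)\<^sup>2) \<le> (\<xi> $ p)\<^sup>2 * (1 - (\<xi> $ p * h / 2)\<^sup>2)"
    by (intro mult_left_mono) auto
  also have "\<dots> = 4 / h\<^sup>2 * ((\<xi> $ p * h / 2)\<^sup>2 * (1 - (\<xi> $ p * h / 2)\<^sup>2))"
    using assms by (simp add: power_mult_distrib power_divide)
  also have "\<dots> \<le> 4 / h\<^sup>2 * (sin (\<xi> $ p * h / 2))\<^sup>2"
    by (intro mult_left_mono sin_squared_ge) auto
  finally show "(\<xi> $ p)\<^sup>2 * (1 - (h * norm \<xi>)\<^sup>2) \<le> 4 / h\<^sup>2 * (sin (\<xi> $ p * h / 2))\<^sup>2"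
    unfolding norm_vec_squared .
qed

lemma powr_ge_min_one:
  fixes x \<beta> :: real
  assumes "0 \<le> \<beta>" "\<beta> \<le> 1" "0 \<le> x"
  shows "min 1 x \<le> x powr \<beta>"
proof (cases "x \<le> 1")
  case True
  have "x powr 1 \<le> x powr \<beta>" using assms True by (intro powr_mono') auto
  then show ?thesis using True assms by simp
next
  case False
  then have "1 \<le> x powr \<beta>" using assms by (intro ge_one_powr_ge_zero) auto
  then show ?thesis by simp
qed

text \<open>
  With \<open>r = |\<xi>|\<close>, the symbol lies between \<open>r\<^sup>2 (1 - h\<^sup>2r\<^sup>2)\<close> and \<open>r\<^sup>2\<close>. For \<open>hr \<le> 1\<close> the relative
  error after taking the power \<open>a/2 \<le> 1\<close> is therefore at most \<open>(hr)\<^sup>2 \<le> (hr)\<^sup>s\<close>; for \<open>hr > 1\<close> the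
  trivial bound 1 is already at most \<open>(hr)\<^sup>s\<close>. This is the place where \<open>s \<le> 2\<close> enters.
\<close>

lemma lap_symbol_error:
  fixes \<xi> :: "real ^ 'd"
  assumes h: "0 < h" and a: "0 < a" "a \<le> 2" and s: "0 < s" "s \<le> 2"
  shows "\<bar>norm \<xi> powr a - lap_symbol h \<xi> powr (a / 2)\<bar> \<le> h powr s * norm \<xi> powr (a + s)"
proof (cases "\<xi> = 0")
  case True then show ?thesis by (simp add: lap_symbol_def)
next
  case False
  define r where "r = norm \<xi>"
  have r: "0 < r" using False by (simp add: r_def)
  have sq: "(r\<^sup>2) powr (a / 2) = r powr a"
    using r by (simp add: powr_powr flip: powr_numeral)
  have up: "lap_symbol h \<xi> powr (a / 2) \<le> r powr a"
    unfolding sq[symmetric] using lap_symbol_le[OF h, of \<xi>] a lap_symbol_nonneg by (intro powr_mono2) (auto simp: r_def)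
  have low: "r powr a - lap_symbol h \<xi> powr (a / 2) \<le> r powr a * (h * r) powr s"
  proof (cases "h * r \<le> 1")
    case True
    have q: "(h * r)\<^sup>2 \<le> (h * r) powr s"
      using powr_mono'[of s 2 "h * r"] s True h r by simp
    have q1: "0 \<le> 1 - (h * r)\<^sup>2" using True h r by (simp add: power_le_one)
    have "r powr a * (1 - (h * r)\<^sup>2) \<le> r powr a * (1 - (h * r)\<^sup>2) powr (a / 2)"
      using powr_ge_min_one[of "a / 2" "1 - (h * r)\<^sup>2"] q1 a by (intro mult_left_mono) auto
    also have "\<dots> = (r\<^sup>2 * (1 - (h * r)\<^sup>2)) powr (a / 2)"
      using q1 r by (subst powr_mult) (auto simp: sq)
    also have "\<dots> \<le> lap_symbol h \<xi> powr (a / 2)"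
      using lap_symbol_ge[OF h, of \<xi>] a q1 r by (intro powr_mono2) (auto simp: r_def)
    finally have "r powr a - lap_symbol h \<xi> powr (a / 2) \<le> r powr a * (h * r)\<^sup>2"
      by (simp add: algebra_simps)
    also have "\<dots> \<le> r powr a * (h * r) powr s" using q by (intro mult_left_mono) auto
    finally show ?thesis .
  next
    case False
    then have "r powr a * 1 \<le> r powr a * (h * r) powr s" using s by (intro mult_left_mono ge_one_powr_ge_zero) auto
    then show ?thesis using powr_ge_zero[of "lap_symbol h \<xi>" "a / 2"] by linarith
  qed
  have "r powr a * (h * r) powr s = h powr s * r powr (a + s)"
    using h r by (simp add: powr_mult powr_add)
  then show ?thesis using up low unfolding r_def[symmetric] by (simp add: abs_le_iff)
qed

text \<open>
  A single low frequency serves all meshes \<open>h \<le> h0\<close> and all orders at once. It is so small that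
  the cosine stays above \<open>1/2\<close> on the bounded set \<open>\<Omega>\<close>, and so small compared with \<open>1/h0\<close>
  that the discrete symbol is comparable with \<open>|\<xi>|\<^sup>2\<close>.
\<close>

lemma uniform_barrier:
  fixes \<Omega> :: "(real ^ 'd) set"
  assumes "bounded \<Omega>" "0 < h0"
  shows "\<exists>\<kappa> (\<xi> :: real ^ 'd). 0 < \<kappa> \<and>
    (\<forall>h a j. 0 < h \<longrightarrow> h \<le> h0 \<longrightarrow> 0 < a \<longrightarrow> a < 2 \<longrightarrow> j \<in> grid_indices h \<Omega> \<longrightarrow>
       \<kappa> \<le> lap_symbol h \<xi> powr (a / 2) * cos (\<xi> \<bullet> grid_pt h j))"
proof -
  obtain R where R: "0 < R" "\<And>x. x \<in> \<Omega> \<Longrightarrow> norm x \<le> R" using assms(1) by (auto simp: bounded_pos)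
  \<comment> \<open>\<open>l R \<le> 1\<close> keeps the argument of the cosine in \<open>[-1, 1]\<close>, and \<open>h l \<le> 1/2\<close> makes the factor
      \<open>1 - (h l)\<^sup>2\<close> of the symbol at least \<open>3/4\<close>.\<close>
  define l where "l = min (1 / (2 * h0)) (1 / R)"
  have l: "0 < l" "l * h0 \<le> 1 / 2" "l * R \<le> 1"
    using assms R by (auto simp: l_def min_def field_simps)
  define \<xi> :: "real ^ 'd" where "\<xi> = l *\<^sub>R axis undefined 1"
  have n: "norm \<xi> = l" using l by (simp add: \<xi>_def)
  show ?thesis
  proof (intro exI[of _ "min 1 (3 / 4 * l\<^sup>2) * (1 / 2)"] exI[of _ \<xi>] conjI allI impI)
    show "0 < min 1 (3 / 4 * l\<^sup>2) * (1 / 2)" using l by simp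
    fix h a :: real and j :: "int ^ 'd" assume h: "0 < h" "h \<le> h0" and a: "0 < a" "a < 2" and j: "j \<in> grid_indices h \<Omega>"
    have "\<bar>\<xi> \<bullet> grid_pt h j\<bar> \<le> l * norm (grid_pt h j)" using Cauchy_Schwarz_ineq2[of \<xi>] n by metis
    also have "\<dots> \<le> l * R" using j l R by (intro mult_left_mono) (auto simp: grid_indices_def)
    finally have x: "\<bar>\<xi> \<bullet> grid_pt h j\<bar> \<le> 1" using l by linarith
    have c: "1 / 2 \<le> cos (\<xi> \<bullet> grid_pt h j)"
    proof -
      have "\<bar>sin (\<xi> \<bullet> grid_pt h j / 2)\<bar> \<le> 1 / 2"
        using abs_sin_x_le_abs_x[of "\<xi> \<bullet> grid_pt h j / 2"] x by linarith
      then have "(sin (\<xi> \<bullet> grid_pt h j / 2))\<^sup>2 \<le> (1 / 2)\<^sup>2" by (metis abs_ge_zero power2_abs power_mono)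
      then show ?thesis using cos_double_sin[of "\<xi> \<bullet> grid_pt h j / 2"] by (simp add: power2_eq_square)
    qed
    have "h * l \<le> h0 * l" using h l by (intro mult_right_mono) auto
    also have "\<dots> \<le> 1 / 2" using l by (simp add: mult.commute)
    finally have "h * l \<le> 1 / 2" .
    then have "(h * l)\<^sup>2 \<le> (1 / 2)\<^sup>2" using h l by (intro power_mono) auto
    then have "l\<^sup>2 * (3 / 4) \<le> l\<^sup>2 * (1 - (h * l)\<^sup>2)" by (intro mult_left_mono) (auto simp: power2_eq_square)
    also have "\<dots> \<le> lap_symbol h \<xi>" using lap_symbol_ge[OF h(1), of \<xi>] by (simp add: n)
    finally have "min 1 (3 / 4 * l\<^sup>2) \<le> min 1 (lap_symbol h \<xi>)" by auto
    \<comment> \<open>\<open>min 1 y\<close> bounds \<open>y powr (a/2)\<close> from below for all orders simultaneously.\<close>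
    also have "\<dots> \<le> lap_symbol h \<xi> powr (a / 2)" using a lap_symbol_nonneg by (intro powr_ge_min_one) auto
    finally show "min 1 (3 / 4 * l\<^sup>2) * (1 / 2) \<le> lap_symbol h \<xi> powr (a / 2) * cos (\<xi> \<bullet> grid_pt h j)"
      using c l by (intro mult_mono) auto
  qed
qed

section \<open>Unique solvability\<close>

text \<open>
  Gaussian elimination of one unknown for each equation.
\<close>

lemma homogeneous_system_nontrivial:
  fixes A :: "'i \<Rightarrow> 'k \<Rightarrow> real"
  assumes "finite S" "finite K" "card S < card K"
  shows "\<exists>u. (\<exists>k\<in>K. u k \<noteq> 0) \<and> (\<forall>i\<in>S. (\<Sum>k\<in>K. A i k * u k) = 0)"
  using assms
proof (induction S arbitrary: K A rule: finite_induct)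
  case empty
  then have "K \<noteq> {}" by auto
  then show ?case by (intro exI[of _ "\<lambda>_. 1"]) auto
next
  case (insert i S)
  show ?case
  proof (cases "\<forall>k\<in>K. A i k = 0")
    case True
    obtain u where u: "\<exists>k\<in>K. u k \<noteq> 0" "\<forall>i\<in>S. (\<Sum>k\<in>K. A i k * u k) = 0"
      using insert.IH[of K A] insert.prems insert.hyps by auto
    then show ?thesis using True by (intro exI[of _ u]) auto
  next
    case False
    then obtain p where p: "p \<in> K" "A i p \<noteq> 0" by auto
    \<comment> \<open>Eliminate the unknown \<open>p\<close> by means of equation \<open>i\<close>.\<close>
    define A' where "A' = (\<lambda>l k. A l k - A l p * A i k / A i p)"
    have "card S < card (K - {p})" using insert.prems insert.hyps p by simp
    then obtain u where u: "\<exists>k\<in>K - {p}. u k \<noteq> 0" "\<forall>l\<in>S. (\<Sum>k\<in>K - {p}. A' l k * u k) = 0"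
      using insert.IH[of "K - {p}" A'] insert.prems by auto
    define t where "t = (\<Sum>k\<in>K - {p}. A i k * u k)"
    define w where "w = u(p := - t / A i p)"
    have split: "(\<Sum>k\<in>K. A l k * w k) = (\<Sum>k\<in>K - {p}. A l k * u k) - A l p * t / A i p" for l
    proof -
      have "(\<Sum>k\<in>K. A l k * w k) = A l p * w p + (\<Sum>k\<in>K - {p}. A l k * w k)"
        using insert.prems p by (intro sum.remove) auto
      also have "(\<Sum>k\<in>K - {p}. A l k * w k) = (\<Sum>k\<in>K - {p}. A l k * u k)"
        by (intro sum.cong) (auto simp: w_def)
      finally show ?thesis by (simp add: w_def)
    qed
    have "(\<Sum>k\<in>K. A l k * w k) = 0" if "l \<in> S" for l
    proof -
      have "(\<Sum>k\<in>K - {p}. A' l k * u k) = (\<Sum>k\<in>K - {p}. A l k * u k) - A l p / A i p * t"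
        unfolding t_def sum_distrib_left sum_subtractf[symmetric]
        by (intro sum.cong) (auto simp: A'_def field_simps)
      then show ?thesis using u(2) that by (simp add: split)
    qed
    moreover have "(\<Sum>k\<in>K. A i k * w k) = 0" using p by (simp add: split t_def)
    moreover have "\<exists>k\<in>K. w k \<noteq> 0" using u(1) by (auto simp: w_def)
    ultimately show ?thesis by (intro exI[of _ w]) auto
  qed
qed

text \<open>
  The right-hand side is appended as an extra column, indexed by \<open>None\<close>. A nontrivial solution of
  the resulting underdetermined homogeneous system must involve that column, by injectivity, and can
  be normalised there.
\<close>

lemma square_system_solvable:
  fixes A :: "'i \<Rightarrow> 'i \<Rightarrow> real"
  assumes S: "finite S"
    and inj: "\<And>u. (\<And>i. i \<in> S \<Longrightarrow> (\<Sum>k\<in>S. A i k * u k) = 0) \<Longrightarrow> \<forall>k\<in>S. u k = 0"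
  shows "\<exists>u. \<forall>i\<in>S. (\<Sum>k\<in>S. A i k * u k) = f i"
proof -
  define A' where "A' = (\<lambda>i. case_option (- f i) (A i))"
  have "card S < card (insert None (Some ` S))"
    using S by (simp add: card_image)
  then obtain u where u: "\<exists>k\<in>insert None (Some ` S). u k \<noteq> 0"
      "\<forall>i\<in>S. (\<Sum>k\<in>insert None (Some ` S). A' i k * u k) = 0"
    using homogeneous_system_nontrivial[of S "insert None (Some ` S)" A'] S by auto
  have eq: "(\<Sum>k\<in>S. A i k * u (Some k)) = f i * u None" if "i \<in> S" for i
    using u(2) that S by (simp add: A'_def sum.reindex)
  have "u None \<noteq> 0"
  proof
    assume 0: "u None = 0"
    then have "\<forall>k\<in>S. u (Some k) = 0" using inj[of "\<lambda>k. u (Some k)"] eq by simp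
    then show False using u(1) 0 by auto
  qed
  then have "(\<Sum>k\<in>S. A i k * (u (Some k) / u None)) = f i" if "i \<in> S" for i
    using eq[OF that] by (simp add: sum_divide_distrib[symmetric])
  then show ?thesis by (intro exI[of _ "\<lambda>k. u (Some k) / u None"] ballI)
qed

lemma walk_frac_lap_finite_sum:
  fixes u :: "int ^ 'd \<Rightarrow> real"
  assumes "finite S" "0 < a" "a < 2"
  shows "walk_frac_lap h a (\<lambda>j. \<Sum>k\<in>S. u k * of_bool (j = k)) j
     = (\<Sum>k\<in>S. u k * walk_frac_lap h a (\<lambda>j. of_bool (j = k)) j)"
  using assms(1)
proof (induction S rule: finite_induct)
  case empty then show ?case by (simp add: walk_frac_lap_zero)
next
  case (insert i S)
  have "walk_frac_lap h a (\<lambda>j. \<Sum>k\<in>insert i S. u k * of_bool (j = k)) j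
    = walk_frac_lap h a (\<lambda>j. u i *\<^sub>R of_bool (j = i) + (\<Sum>k\<in>S. u k * of_bool (j = k))) j"
    using insert.hyps by (simp only: sum.insert[OF insert.hyps] real_scaleR_def)
  also have "\<dots> = u i *\<^sub>R walk_frac_lap h a (\<lambda>j. of_bool (j = i)) j + walk_frac_lap h a (\<lambda>j. \<Sum>k\<in>S. u k * of_bool (j = k)) j"
  proof (rule walk_frac_lap_linear[where B = 1 and B' = "\<Sum>k\<in>S. \<bar>u k\<bar>"])
    show "norm (\<Sum>k\<in>S. u k * of_bool (l = k)) \<le> (\<Sum>k\<in>S. \<bar>u k\<bar>)" for l
      by (rule sum_norm_le) simp
  qed (use assms in auto)
  finally show ?case unfolding insert.IH sum.insert[OF insert.hyps] by simp
qed

text \<open>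
  The stability bound with \<open>F = 0\<close> gives injectivity, and the system is square.
\<close>

lemma walk_scheme_unique_solution:
  fixes \<xi> :: "real ^ 'd" and b A g :: "int ^ 'd \<Rightarrow> real"
  assumes S: "finite S" and "0 < h" and A: "\<And>j. j \<in> S \<Longrightarrow> 0 < A j" "\<And>j. j \<in> S \<Longrightarrow> A j < 2"
    and \<kappa>: "0 < \<kappa>" "\<And>j. j \<in> S \<Longrightarrow> \<kappa> \<le> lap_symbol h \<xi> powr (A j / 2) * cos (\<xi> \<bullet> grid_pt h j)"
    and b: "\<And>j. j \<in> S \<Longrightarrow> 0 \<le> b j"
  shows "\<exists>!u. (\<forall>j\<in>S. walk_frac_lap h (A j) u j + b j * u j = g j) \<and> (\<forall>j. j \<notin> S \<longrightarrow> u j = 0)"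
proof -
  define M where "M = (\<lambda>i k. walk_frac_lap h (A i) (\<lambda>j. of_bool (j = k)) i + b i * of_bool (i = k))"
  have ext: "u = (\<lambda>j. \<Sum>k\<in>S. u k * of_bool (j = k))" if "\<And>j. j \<notin> S \<Longrightarrow> u j = 0" for u :: "int ^ 'd \<Rightarrow> real"
  proof
    fix j
    have "(\<Sum>k\<in>S. u k * of_bool (j = k)) = (\<Sum>k\<in>S. if j = k then u k else 0)"
      by (intro sum.cong) auto
    then show "u j = (\<Sum>k\<in>S. u k * of_bool (j = k))" using S that[of j] by simp
  qed
  have lhs: "(\<Sum>k\<in>S. M i k * u k) = walk_frac_lap h (A i) u i + b i * u i"
    if "i \<in> S" "\<And>j. j \<notin> S \<Longrightarrow> u j = 0" for i u
  proof -
    have "(\<Sum>k\<in>S. M i k * u k) = (\<Sum>k\<in>S. u k * walk_frac_lap h (A i) (\<lambda>j. of_bool (j = k)) i) + b i * (\<Sum>k\<in>S. u k * of_bool (i = k))"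
      by (simp add: M_def algebra_simps sum.distrib sum_distrib_left)
    also have "(\<Sum>k\<in>S. u k * walk_frac_lap h (A i) (\<lambda>j. of_bool (j = k)) i) = walk_frac_lap h (A i) (\<lambda>j. \<Sum>k\<in>S. u k * of_bool (j = k)) i"
      using A[OF that(1)] by (intro walk_frac_lap_finite_sum[OF S, symmetric])
    also have "(\<lambda>j. \<Sum>k\<in>S. u k * of_bool (j = k)) = u"
      using ext[of u] that(2) by simp
    finally show ?thesis .
  qed
  have zero: "u j = 0" if "\<And>j. j \<notin> S \<Longrightarrow> u j = 0" "\<And>j. j \<in> S \<Longrightarrow> walk_frac_lap h (A j) u j + b j * u j = 0" for u j
    using walk_scheme_stability[OF S \<open>0 < h\<close> A \<kappa> b, where F = 0 and u = u and j = j] that by simp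
  have "\<exists>u. \<forall>i\<in>S. (\<Sum>k\<in>S. M i k * u k) = g i"
  proof (rule square_system_solvable[OF S])
    fix u assume u: "\<And>i. i \<in> S \<Longrightarrow> (\<Sum>k\<in>S. M i k * u k) = 0"
    define u' where "u' = (\<lambda>j. if j \<in> S then u j else 0)"
    have "(\<Sum>k\<in>S. M i k * u' k) = (\<Sum>k\<in>S. M i k * u k)" for i
      by (intro sum.cong) (auto simp: u'_def)
    then have "walk_frac_lap h (A j) u' j + b j * u' j = 0" if "j \<in> S" for j
      using lhs[OF that, of u'] u[OF that] by (simp add: u'_def)
    then have "u' j = 0" for j by (rule zero[rotated]) (auto simp: u'_def)
    then show "\<forall>k\<in>S. u k = 0" by (metis u'_def)
  qed
  then obtain u0 where u0: "\<forall>i\<in>S. (\<Sum>k\<in>S. M i k * u0 k) = g i" by blast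
  define u where "u = (\<lambda>j. if j \<in> S then u0 j else 0)"
  have "(\<Sum>k\<in>S. M i k * u k) = (\<Sum>k\<in>S. M i k * u0 k)" for i
    by (intro sum.cong) (auto simp: u_def)
  then have u: "walk_frac_lap h (A j) u j + b j * u j = g j" if "j \<in> S" for j
    using lhs[OF that, of u] u0 that by (simp add: u_def)
  show ?thesis
  proof (rule ex1I[of _ u])
    show "(\<forall>j\<in>S. walk_frac_lap h (A j) u j + b j * u j = g j) \<and> (\<forall>j. j \<notin> S \<longrightarrow> u j = 0)"
      using u by (auto simp: u_def)
    fix v assume v: "(\<forall>j\<in>S. walk_frac_lap h (A j) v j + b j * v j = g j) \<and> (\<forall>j. j \<notin> S \<longrightarrow> v j = 0)"
    have "v j + - u j = 0" for j
    proof (rule zero[where u = "\<lambda>j. v j + - u j"])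
      fix j assume j: "j \<in> S"
      have "(\<Sum>k\<in>S. M j k * (v k + - u k)) = (\<Sum>k\<in>S. M j k * v k) - (\<Sum>k\<in>S. M j k * u k)"
        by (simp add: algebra_simps sum_subtractf)
      then show "walk_frac_lap h (A j) (\<lambda>j. v j + - u j) j + b j * (v j + - u j) = 0"
        using lhs[OF j, of "\<lambda>j. v j + - u j"] lhs[OF j, of v] lhs[OF j, of u] v u[OF j] j
        by (auto simp: u_def)
    qed (use v in \<open>auto simp: u_def\<close>)
    then show "v = u" by (simp add: fun_eq_iff)
  qed
qed

section \<open>The lattice Fourier transform\<close>

text \<open>
  Lebesgue measure on a Euclidean space is the image of the product measure over the basis, so
  functions that factor over the coordinates are integrated coordinatewise. This is used both for
  the orthogonality of the exponentials on the period cell and for Gaussians.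
\<close>

lemma
  fixes F :: "'a :: euclidean_space \<Rightarrow> real \<Rightarrow> complex"
  assumes F: "\<And>b. b \<in> Basis \<Longrightarrow> integrable lborel (F b)"
  shows integrable_prod_Basis: "integrable lborel (\<lambda>x. \<Prod>b\<in>Basis. F b (x \<bullet> b))"
    and integral_prod_Basis: "(LINT x|lborel. (\<Prod>b\<in>Basis. F b (x \<bullet> b))) = (\<Prod>b\<in>Basis. (LINT t|lborel. F b t))"
proof -
  interpret product_sigma_finite "\<lambda>_ :: 'a. lborel :: real measure" ..
  have [measurable]: "F b \<in> borel_measurable borel" if "b \<in> Basis" for b
    using borel_measurable_integrable[OF F[OF that]] by simp
  have m1: "(\<lambda>f. \<Sum>b\<in>Basis. f b *\<^sub>R b) \<in> measurable (\<Pi>\<^sub>M b\<in>Basis. lborel) (borel :: 'a measure)"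
    by measurable
  have m2: "(\<lambda>x. \<Prod>b\<in>Basis. F b (x \<bullet> b)) \<in> borel_measurable (borel :: 'a measure)"
    by measurable
  have e: "(\<Prod>b\<in>Basis. F b ((\<Sum>i\<in>Basis. f i *\<^sub>R i) \<bullet> b)) = (\<Prod>b\<in>Basis. F b (f b))" for f :: "'a \<Rightarrow> real"
    by (intro prod.cong) auto
  show "integrable lborel (\<lambda>x. \<Prod>b\<in>Basis. F b (x \<bullet> b))"
    by (subst lborel_eq, subst integrable_distr_eq[OF m1 m2], unfold e)
      (rule product_integrable_prod[OF finite_Basis F])
  show "(LINT x|lborel. (\<Prod>b\<in>Basis. F b (x \<bullet> b))) = (\<Prod>b\<in>Basis. (LINT t|lborel. F b t))"
    by (subst lborel_eq, subst integral_distr[OF m1 m2], unfold e)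
      (rule product_integral_prod[OF finite_Basis F])
qed

lemma prod_Basis_cart: "(\<Prod>b\<in>(Basis :: (real ^ 'd) set). G b) = (\<Prod>p\<in>UNIV. G (axis p 1))"
proof -
  have *: "(Basis :: (real ^ 'd) set) = (\<lambda>p. axis p 1) ` UNIV" by (auto simp: Basis_vec_def)
  have "inj (\<lambda>p :: 'd. axis p (1 :: real))" by (auto simp: inj_def axis_eq_axis)
  then show ?thesis unfolding * by (subst prod.reindex) auto
qed

lemma integral_exp_period:
  fixes n :: int
  assumes "0 < h"
  shows "(LINT t|lborel. indicator {- pi / h..pi / h} t *\<^sub>R exp (\<i> * complex_of_real (t * (of_int n * h))))
     = (if n = 0 then complex_of_real (2 * pi / h) else 0)"
proof (cases "n = 0")
  case True
  have "(LINT t|lborel. indicator {- pi / h..pi / h} t *\<^sub>R (1 :: complex)) = of_real (2 * pi / h)"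
    using assms by (subst Bochner_Integration.integral_scaleR_left) (auto simp: scaleR_conv_of_real)
  then show ?thesis using True by simp
next
  case False
  define c where "c = \<i> * complex_of_real (of_int n * h)"
  have c: "c \<noteq> 0" using False assms by (simp add: c_def)
  have "(LINT t|lborel. indicator {- pi / h..pi / h} t *\<^sub>R exp (c * of_real t))
     = exp (c * of_real (pi / h)) / c - exp (c * of_real (- pi / h)) / c"
  proof (rule integral_FTC_atLeastAtMost)
    show "- pi / h \<le> pi / h" using assms by (simp add: field_simps)
    show "((\<lambda>t. exp (c * of_real t) / c) has_vector_derivative exp (c * of_real x)) (at x within {- pi / h..pi / h})" for x
      using c by (auto intro!: derivative_eq_intros has_vector_derivative_real_field simp: field_simps)
    show "continuous_on {- pi / h..pi / h} (\<lambda>t. exp (c * of_real t))" by (intro continuous_intros)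
  qed
  also have "exp (c * of_real (pi / h)) = exp (c * of_real (- pi / h))"
    unfolding exp_eq using assms by (intro exI[of _ n]) (simp add: c_def field_simps)
  finally show ?thesis using False by (simp add: c_def mult_ac)
qed

lemma
  fixes n :: "int ^ 'd"
  assumes h: "0 < h"
  shows integrable_grid_freqs_exp: "integrable lborel (\<lambda>\<xi>. indicator (grid_freqs h) \<xi> *\<^sub>R exp (\<i> * complex_of_real (\<xi> \<bullet> grid_pt h n)))"
    and integral_grid_freqs_exp: "(LINT \<xi>|lborel. indicator (grid_freqs h) \<xi> *\<^sub>R exp (\<i> * complex_of_real (\<xi> \<bullet> grid_pt h n)))
      = (if n = 0 then complex_of_real ((2 * pi / h) ^ CARD('d)) else 0)"
proof -
  define F where "F = (\<lambda>(b :: real ^ 'd) t. indicator {- pi / h..pi / h} t *\<^sub>R exp (\<i> * complex_of_real (t * (grid_pt h n \<bullet> b))))"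
  have F: "integrable lborel (F b)" for b
    unfolding F_def by (intro borel_integrable_compact) (auto intro!: continuous_intros)
  have e: "indicator (grid_freqs h) \<xi> *\<^sub>R exp (\<i> * complex_of_real (\<xi> \<bullet> grid_pt h n)) = (\<Prod>b\<in>Basis. F b (\<xi> \<bullet> b))" for \<xi>
  proof -
    have "indicator (grid_freqs h) \<xi> = (\<Prod>b\<in>Basis. indicator {- pi / h..pi / h} (\<xi> \<bullet> b) :: real)"
    proof -
      have "(\<Prod>b\<in>Basis. indicator {- pi / h..pi / h} (\<xi> \<bullet> b) :: real) = (\<Prod>p\<in>UNIV. of_bool (\<xi> $ p \<in> {- pi / h..pi / h}))"
        by (simp add: prod_Basis_cart inner_axis indicator_def)
      also have "\<dots> = of_bool (\<forall>p. \<xi> $ p \<in> {- pi / h..pi / h})"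
        by (auto simp: of_bool_def)
      finally show ?thesis by (simp add: grid_freqs_def indicator_def)
    qed
    moreover have "exp (\<i> * complex_of_real (\<xi> \<bullet> grid_pt h n)) = (\<Prod>b\<in>Basis. exp (\<i> * complex_of_real ((\<xi> \<bullet> b) * (grid_pt h n \<bullet> b))))"
      by (subst euclidean_inner) (simp add: exp_sum[symmetric] sum_distrib_left)
    ultimately show ?thesis
      unfolding F_def by (simp add: scaleR_conv_of_real prod.distrib)
  qed
  show "integrable lborel (\<lambda>\<xi>. indicator (grid_freqs h) \<xi> *\<^sub>R exp (\<i> * complex_of_real (\<xi> \<bullet> grid_pt h n)))"
    unfolding e by (rule integrable_prod_Basis[OF F])
  have "(LINT \<xi>|lborel. indicator (grid_freqs h) \<xi> *\<^sub>R exp (\<i> * complex_of_real (\<xi> \<bullet> grid_pt h n)))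
      = (\<Prod>p\<in>UNIV. (LINT t|lborel. F (axis p 1) t))"
    unfolding e integral_prod_Basis[OF F] by (rule prod_Basis_cart)
  also have "\<dots> = (\<Prod>p\<in>(UNIV :: 'd set). if n $ p = 0 then complex_of_real (2 * pi / h) else 0)"
  proof (rule prod.cong[OF refl])
    fix p :: 'd
    show "(LINT t|lborel. F (axis p 1) t) = (if n $ p = 0 then complex_of_real (2 * pi / h) else 0)"
      using integral_exp_period[OF h, of "n $ p"] by (simp add: F_def inner_axis grid_pt_def)
  qed
  also have "\<dots> = (if n = 0 then complex_of_real ((2 * pi / h) ^ CARD('d)) else 0)"
    by (auto simp: vec_eq_iff)
  finally show "(LINT \<xi>|lborel. indicator (grid_freqs h) \<xi> *\<^sub>R exp (\<i> * complex_of_real (\<xi> \<bullet> grid_pt h n)))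
      = (if n = 0 then complex_of_real ((2 * pi / h) ^ CARD('d)) else 0)" .
qed

text \<open>
  On finitely supported functions the two constructions agree: by orthogonality of the
  exponentials on the period cell such a function is the wave synthesis of its own lattice Fourier
  transform, cut off to the cell, and on a wave synthesis both operators multiply the density by the
  same symbol.
\<close>

lemma grid_frac_lap_eq_walk_frac_lap:
  fixes v :: "int ^ 'd \<Rightarrow> complex"
  assumes S: "finite S" "\<And>j. j \<notin> S \<Longrightarrow> v j = 0" and h: "0 < h" and a: "0 < a" "a < 2"
  shows "grid_frac_lap h a v j = walk_frac_lap h a v j"
proof -
  define E where "E = (\<lambda>(n :: int ^ 'd) \<xi>. indicator (grid_freqs h) \<xi> *\<^sub>R exp (\<i> * complex_of_real (\<xi> \<bullet> grid_pt h n)))"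
  define g where "g = (\<lambda>\<xi>. complex_of_real (1 / (2 * pi) ^ CARD('d)) * (indicator (grid_freqs h) \<xi> *\<^sub>R grid_fourier h v \<xi>))"
  have gp: "grid_pt h (j - k) = grid_pt h j - grid_pt h k" for j k :: "int ^ 'd"
    by (simp add: grid_pt_def vec_eq_iff algebra_simps)
  have gf: "grid_fourier h v \<xi> = of_real (h ^ CARD('d)) * (\<Sum>k\<in>S. exp (- (\<i> * of_real (\<xi> \<bullet> grid_pt h k))) * v k)" for \<xi>
  proof -
    have "(\<Sum>\<^sub>\<infinity>k\<in>UNIV. exp (- (\<i> * of_real (\<xi> \<bullet> grid_pt h k))) * v k)
       = (\<Sum>\<^sub>\<infinity>k\<in>S. exp (- (\<i> * of_real (\<xi> \<bullet> grid_pt h k))) * v k)"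
      using S by (intro infsum_cong_neutral) auto
    then show ?thesis using S by (simp add: grid_fourier_def)
  qed
  have eg: "exp (\<i> * of_real (\<xi> \<bullet> grid_pt h l)) * g \<xi> = (\<Sum>k\<in>S. complex_of_real ((h / (2 * pi)) ^ CARD('d)) * v k * E (l - k) \<xi>)" for \<xi> l
  proof -
    have "exp (\<i> * of_real (\<xi> \<bullet> grid_pt h l)) * exp (- (\<i> * of_real (\<xi> \<bullet> grid_pt h k))) = exp (\<i> * of_real (\<xi> \<bullet> grid_pt h (l - k)))" for k
      by (simp add: gp exp_add[symmetric] inner_diff_right right_diff_distrib)
    then show ?thesis
      unfolding g_def gf E_def sum_distrib_left
      by (auto simp: scaleR_conv_of_real sum_distrib_left power_divide mult_ac intro!: sum.cong)
  qed
  have Ei: "integrable lborel (E n)" for n unfolding E_def by (rule integrable_grid_freqs_exp[OF h])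
  have gi: "integrable lborel g"
  proof -
    have "g = (\<lambda>\<xi>. \<Sum>k\<in>S. complex_of_real ((h / (2 * pi)) ^ CARD('d)) * v k * E (0 - k) \<xi>)"
      using eg[of _ 0] by (simp add: grid_pt_def fun_eq_iff inner_vec_def)
    then show ?thesis using Ei by simp
  qed
  have "wave_synthesis h g l = v l" for l
  proof -
    have "wave_synthesis h g l = (\<Sum>k\<in>S. complex_of_real ((h / (2 * pi)) ^ CARD('d)) * v k * (LINT \<xi>|lborel. E (l - k) \<xi>))"
      unfolding wave_synthesis_def eg using Ei by simp
    also have "\<dots> = (\<Sum>k\<in>S. if k = l then v k else 0)"
    proof (rule sum.cong[OF refl])
      fix k
      have "(h / (2 * pi)) ^ CARD('d) * (2 * pi / h) ^ CARD('d) = 1"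
        using h by (simp add: power_mult_distrib[symmetric])
      then have "complex_of_real ((h / (2 * pi)) ^ CARD('d)) * complex_of_real ((2 * pi / h) ^ CARD('d)) = 1"
        by (metis of_real_1 of_real_mult)
      then show "complex_of_real ((h / (2 * pi)) ^ CARD('d)) * v k * (LINT \<xi>|lborel. E (l - k) \<xi>) = (if k = l then v k else 0)"
        unfolding E_def integral_grid_freqs_exp[OF h] by (auto simp: mult_ac simp del: of_real_power)
    qed
    also have "\<dots> = v l" using S by simp
    finally show ?thesis .
  qed
  then have "walk_frac_lap h a v j = walk_frac_lap h a (wave_synthesis h g) j" by presburger
  also have "\<dots> = wave_synthesis h (\<lambda>\<xi>. complex_of_real (lap_symbol h \<xi> powr (a / 2)) * g \<xi>) j"
    by (rule walk_frac_lap_wave_synthesis[OF gi h a])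
  also have "\<dots> = grid_frac_lap h a v j"
    unfolding grid_frac_lap_def grid_inv_fourier_def wave_synthesis_def set_lebesgue_integral_def g_def
    by (subst Bochner_Integration.integral_mult_right_zero[symmetric], intro Bochner_Integration.integral_cong)
       (auto simp: scaleR_conv_of_real mult_ac)
  finally show ?thesis by simp
qed

section \<open>Gaussians and Fourier inversion\<close>

lemma integrable_gaussian_real:
  assumes "0 < t"
  shows "integrable lborel (\<lambda>x :: real. exp (- (t * x\<^sup>2)))"
proof -
  have "integrable lborel (\<lambda>x. sqrt (2 * pi) * std_normal_density (0 + sqrt (2 * t) * x))"
    using assms by (intro integrable_mult_right lborel_integrable_real_affine) auto
  moreover have "sqrt (2 * pi) * std_normal_density (0 + sqrt (2 * t) * x) = exp (- (t * x\<^sup>2))" for x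
    using assms by (simp add: std_normal_density_def power_mult_distrib)
  ultimately show ?thesis by (simp only:)
qed

lemma integrable_gaussian_wave_real:
  assumes "0 < t"
  shows "integrable lborel (\<lambda>x :: real. complex_of_real (exp (- (t * x\<^sup>2))) * exp (\<i> * complex_of_real (s * x)))"
  using integrable_gaussian_real[OF assms]
  by (rule Bochner_Integration.integrable_bound) (auto simp: norm_mult)

text \<open>
  The characteristic function of the standard normal distribution, rescaled by
  \<open>x = sqrt(2t) y\<close>.
\<close>

lemma integral_gaussian_wave_real:
  assumes t: "0 < t"
  shows "(LINT x|lborel. complex_of_real (exp (- (t * x\<^sup>2))) * exp (\<i> * complex_of_real (s * x)))
    = complex_of_real (sqrt (pi / t) * exp (- (s\<^sup>2 / (4 * t))))"
proof -
  define c where "c = sqrt (2 * t)"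
  have c: "0 < c" "c\<^sup>2 = 2 * t" using t by (auto simp: c_def)
  have "complex_of_real (exp (- ((s / c)\<^sup>2) / 2)) = (LINT x|std_normal_distribution. exp (\<i> * complex_of_real (s / c * x)))"
    using char_std_normal_distribution unfolding char_def fun_eq_iff by metis
  also have "\<dots> = (LINT x|lborel. std_normal_density x *\<^sub>R exp (\<i> * complex_of_real (s / c * x)))"
    by (subst integral_density) auto
  also have "\<dots> = \<bar>c\<bar> *\<^sub>R (LINT x|lborel. std_normal_density (0 + c * x) *\<^sub>R exp (\<i> * complex_of_real (s / c * (0 + c * x))))"
    using c by (intro lborel_integral_real_affine) auto
  also have "(\<lambda>x. std_normal_density (0 + c * x) *\<^sub>R exp (\<i> * complex_of_real (s / c * (0 + c * x))))
     = (\<lambda>x. complex_of_real (1 / sqrt (2 * pi)) * (complex_of_real (exp (- (t * x\<^sup>2))) * exp (\<i> * complex_of_real (s * x))))"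
    using c t by (auto simp: fun_eq_iff std_normal_density_def power_mult_distrib scaleR_conv_of_real)
  also have "\<bar>c\<bar> *\<^sub>R (LINT x|lborel. complex_of_real (1 / sqrt (2 * pi)) * (complex_of_real (exp (- (t * x\<^sup>2))) * exp (\<i> * complex_of_real (s * x))))
    = complex_of_real (c / sqrt (2 * pi)) * (LINT x|lborel. complex_of_real (exp (- (t * x\<^sup>2))) * exp (\<i> * complex_of_real (s * x)))"
    using c by (simp add: scaleR_conv_of_real)
  finally have e: "complex_of_real (c / sqrt (2 * pi)) * (LINT x|lborel. complex_of_real (exp (- (t * x\<^sup>2))) * exp (\<i> * complex_of_real (s * x)))
     = complex_of_real (exp (- ((s / c)\<^sup>2) / 2))" by simp
  have "sqrt (pi / t) * (c / sqrt (2 * pi)) = 1"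
    using t by (simp add: c_def real_sqrt_divide real_sqrt_mult)
  then have 1: "complex_of_real (sqrt (pi / t)) * complex_of_real (c / sqrt (2 * pi)) = 1"
    by (metis of_real_1 of_real_mult)
  have 2: "- ((s / c)\<^sup>2) / 2 = - (s\<^sup>2 / (4 * t))" using c by (simp add: power_divide)
  show ?thesis
    using arg_cong[OF e, of "\<lambda>z. complex_of_real (sqrt (pi / t)) * z"] 1
    unfolding 2 mult.assoc[symmetric] by simp
qed

lemma gaussian_wave_eq_prod:
  fixes \<xi> :: "'a :: euclidean_space"
  shows "complex_of_real (exp (- (t * (norm x)\<^sup>2))) * exp (\<i> * complex_of_real (\<xi> \<bullet> x))
   = (\<Prod>b\<in>Basis. complex_of_real (exp (- (t * (x \<bullet> b)\<^sup>2))) * exp (\<i> * complex_of_real ((\<xi> \<bullet> b) * (x \<bullet> b))))"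
proof -
  have n: "(norm x)\<^sup>2 = (\<Sum>b\<in>Basis. (x \<bullet> b)\<^sup>2)"
    unfolding power2_norm_eq_inner by (subst euclidean_inner) (simp add: power2_eq_square)
  have "exp (- (t * (norm x)\<^sup>2)) = (\<Prod>b\<in>Basis. exp (- (t * (x \<bullet> b)\<^sup>2)))"
    unfolding n by (simp add: exp_sum[symmetric] sum_distrib_left sum_negf)
  moreover have "exp (\<i> * complex_of_real (\<xi> \<bullet> x)) = (\<Prod>b\<in>Basis. exp (\<i> * complex_of_real ((\<xi> \<bullet> b) * (x \<bullet> b))))"
    by (subst euclidean_inner) (simp add: exp_sum[symmetric] sum_distrib_left)
  ultimately show ?thesis by (simp only: prod.distrib of_real_prod)
qed

lemma integrable_gaussian_wave:
  fixes \<xi> :: "'a :: euclidean_space"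
  assumes "0 < t"
  shows "integrable lborel (\<lambda>x. complex_of_real (exp (- (t * (norm x)\<^sup>2))) * exp (\<i> * complex_of_real (\<xi> \<bullet> x)))"
  unfolding gaussian_wave_eq_prod by (intro integrable_prod_Basis integrable_gaussian_wave_real assms)

lemma integral_gaussian_wave:
  fixes \<xi> :: "'a :: euclidean_space"
  assumes "0 < t"
  shows "(LINT x|lborel. complex_of_real (exp (- (t * (norm x)\<^sup>2))) * exp (\<i> * complex_of_real (\<xi> \<bullet> x)))
   = complex_of_real (sqrt (pi / t) ^ DIM('a) * exp (- ((norm \<xi>)\<^sup>2 / (4 * t))))"
proof -
  have n: "(norm \<xi>)\<^sup>2 = (\<Sum>b\<in>Basis. (\<xi> \<bullet> b)\<^sup>2)"
    unfolding power2_norm_eq_inner by (subst euclidean_inner) (simp add: power2_eq_square)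
  have "(LINT x|lborel. complex_of_real (exp (- (t * (norm x)\<^sup>2))) * exp (\<i> * complex_of_real (\<xi> \<bullet> x)))
    = (\<Prod>b\<in>(Basis :: 'a set). complex_of_real (sqrt (pi / t) * exp (- ((\<xi> \<bullet> b)\<^sup>2 / (4 * t)))))"
    unfolding gaussian_wave_eq_prod
    by (subst integral_prod_Basis) (auto simp only: integrable_gaussian_wave_real[OF assms] integral_gaussian_wave_real[OF assms])
  also have "\<dots> = complex_of_real (\<Prod>b\<in>(Basis :: 'a set). sqrt (pi / t) * exp (- ((\<xi> \<bullet> b)\<^sup>2 / (4 * t))))"
    by simp
  also have "(\<Prod>b\<in>(Basis :: 'a set). sqrt (pi / t) * exp (- ((\<xi> \<bullet> b)\<^sup>2 / (4 * t)))) = sqrt (pi / t) ^ DIM('a) * exp (- ((norm \<xi>)\<^sup>2 / (4 * t)))"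
    unfolding n prod.distrib by (simp add: exp_sum[symmetric] sum_divide_distrib sum_negf)
  finally show ?thesis .
qed

lemma integrable_gaussian:
  assumes "0 < t"
  shows "integrable lborel (\<lambda>x :: 'a :: euclidean_space. exp (- (t * (norm x)\<^sup>2)))"
  using integrable_norm[OF integrable_gaussian_wave[OF assms, of "0 :: 'a"]] by simp

lemma integral_affine:
  fixes f :: "'a :: euclidean_space \<Rightarrow> 'b :: {banach, second_countable_topology}"
  assumes [measurable]: "f \<in> borel_measurable borel" and "0 < c"
  shows "(LINT y|lborel. f y) = c ^ DIM('a) *\<^sub>R (LINT w|lborel. f (x + c *\<^sub>R w))"
  using assms(2) by (subst lborel_affine[of c x]) (auto simp: integral_density integral_distr)

lemma fourier_measurable:
  fixes u :: "real ^ 'd \<Rightarrow> complex"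
  assumes [measurable]: "u \<in> borel_measurable borel"
  shows "fourier u \<in> borel_measurable borel"
  unfolding fourier_def by measurable

text \<open>
  Inserting the convergence factor makes Fubini applicable; the inner integral is then again a
  Gaussian, concentrated around \<open>x\<close> at scale \<open>r\<close>, and the substitution \<open>y = x + 2r w\<close> puts all
  dependence on \<open>r\<close> into the argument of \<open>u\<close>.
\<close>

lemma gaussian_fourier_integral:
  fixes u :: "real ^ 'd \<Rightarrow> complex"
  assumes u: "integrable lborel u" and r: "0 < r"
  shows "(LINT \<xi>|lborel. complex_of_real (exp (- (r\<^sup>2 * (norm \<xi>)\<^sup>2))) * (exp (\<i> * complex_of_real (\<xi> \<bullet> x)) * fourier u \<xi>))
    = complex_of_real ((2 * sqrt pi) ^ CARD('d)) * (LINT w|lborel. complex_of_real (exp (- (norm w)\<^sup>2)) * u (x + (2 * r) *\<^sub>R w))"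
proof -
  have [measurable]: "u \<in> borel_measurable borel" using borel_measurable_integrable[OF u] by simp
  define k where "k = (\<lambda>(\<xi> :: real ^ 'd) y. complex_of_real (exp (- (r\<^sup>2 * (norm \<xi>)\<^sup>2))) * (exp (\<i> * complex_of_real ((x - y) \<bullet> \<xi>)) * u y))"
  have nk: "norm (k \<xi> y) = exp (- (r\<^sup>2 * (norm \<xi>)\<^sup>2)) * norm (u y)" for \<xi> y
    by (simp add: k_def norm_mult)
  have ki: "integrable (lborel \<Otimes>\<^sub>M lborel) (case_prod k)"
  proof (rule lborel_pair.Fubini_integrable)
    show "case_prod k \<in> borel_measurable (lborel \<Otimes>\<^sub>M lborel)" unfolding k_def by measurable
    show "integrable lborel (\<lambda>\<xi>. LINT y|lborel. norm (case (\<xi>, y) of (x, y) \<Rightarrow> k x y))"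
      using integrable_gaussian[of "r\<^sup>2", where 'a = "real ^ 'd"] r by (simp add: nk)
    show "AE \<xi> in lborel. integrable lborel (\<lambda>y. case (\<xi>, y) of (x, y) \<Rightarrow> k x y)"
      unfolding k_def prod.case
      by (intro AE_I2 integrable_mult_right integrable_unimodular_mult[OF u]) auto
  qed
  have "(LINT \<xi>|lborel. complex_of_real (exp (- (r\<^sup>2 * (norm \<xi>)\<^sup>2))) * (exp (\<i> * complex_of_real (\<xi> \<bullet> x)) * fourier u \<xi>))
    = (LINT \<xi>|lborel. (LINT y|lborel. k \<xi> y))"
  proof (rule Bochner_Integration.integral_cong[OF refl])
    fix \<xi> :: "real ^ 'd"
    have "exp (\<i> * complex_of_real (\<xi> \<bullet> x)) * exp (- (\<i> * complex_of_real (\<xi> \<bullet> y))) = exp (\<i> * complex_of_real ((x - y) \<bullet> \<xi>))" for y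
      by (simp add: exp_add[symmetric] inner_diff_right right_diff_distrib inner_commute[of "x - y" \<xi>])
    then have e: "k \<xi> y = complex_of_real (exp (- (r\<^sup>2 * (norm \<xi>)\<^sup>2))) * (exp (\<i> * complex_of_real (\<xi> \<bullet> x)) * (exp (- (\<i> * complex_of_real (\<xi> \<bullet> y))) * u y))" for y
      unfolding k_def by (simp add: mult.assoc[symmetric])
    show "complex_of_real (exp (- (r\<^sup>2 * (norm \<xi>)\<^sup>2))) * (exp (\<i> * complex_of_real (\<xi> \<bullet> x)) * fourier u \<xi>) = (LINT y|lborel. k \<xi> y)"
      unfolding e fourier_def by simp
  qed
  also have "\<dots> = (LINT y|lborel. (LINT \<xi>|lborel. k \<xi> y))"
    by (rule lborel_pair.Fubini_integral[OF ki, symmetric])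
  also have "\<dots> = (LINT y|lborel. complex_of_real (sqrt (pi / r\<^sup>2) ^ CARD('d) * exp (- ((norm (x - y))\<^sup>2 / (4 * r\<^sup>2)))) * u y)"
  proof (rule Bochner_Integration.integral_cong[OF refl])
    fix y
    have "(LINT \<xi>|lborel. k \<xi> y) = (LINT \<xi>|lborel. complex_of_real (exp (- (r\<^sup>2 * (norm \<xi>)\<^sup>2))) * exp (\<i> * complex_of_real ((x - y) \<bullet> \<xi>))) * u y"
      unfolding k_def mult.assoc[symmetric] by simp
    then show "(LINT \<xi>|lborel. k \<xi> y) = complex_of_real (sqrt (pi / r\<^sup>2) ^ CARD('d) * exp (- ((norm (x - y))\<^sup>2 / (4 * r\<^sup>2)))) * u y"
      using r by (subst (asm) integral_gaussian_wave) auto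
  qed
  also have "\<dots> = (2 * r) ^ CARD('d) *\<^sub>R (LINT w|lborel. complex_of_real (sqrt (pi / r\<^sup>2) ^ CARD('d) * exp (- ((norm (x - (x + (2 * r) *\<^sub>R w)))\<^sup>2 / (4 * r\<^sup>2)))) * u (x + (2 * r) *\<^sub>R w))"
    using r by (subst integral_affine[where c = "2 * r" and x = x]) auto
  also have "\<dots> = (2 * r) ^ CARD('d) *\<^sub>R (LINT w|lborel. complex_of_real (sqrt (pi / r\<^sup>2) ^ CARD('d)) * (complex_of_real (exp (- (norm w)\<^sup>2)) * u (x + (2 * r) *\<^sub>R w)))"
    using r by (simp add: power_mult_distrib mult.assoc)
  also have "\<dots> = complex_of_real ((2 * r) ^ CARD('d) * sqrt (pi / r\<^sup>2) ^ CARD('d)) * (LINT w|lborel. complex_of_real (exp (- (norm w)\<^sup>2)) * u (x + (2 * r) *\<^sub>R w))"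
    by (simp add: scaleR_conv_of_real mult.assoc)
  also have "(2 * r) ^ CARD('d) * sqrt (pi / r\<^sup>2) ^ CARD('d) = (2 * sqrt pi) ^ CARD('d)"
  proof -
    have "(2 * r) * sqrt (pi / r\<^sup>2) = 2 * sqrt pi" using r by (simp add: real_sqrt_divide)
    then show ?thesis by (metis power_mult_distrib)
  qed
  finally show ?thesis .
qed

text \<open>
  Let \<open>r\<close> tend to zero in the regularised identity. Both sides converge by dominated convergence: the
  left one because the Fourier transform is integrable, the right one because \<open>u\<close> is bounded and
  continuous.
\<close>

lemma fourier_inversion:
  fixes u :: "real ^ 'd \<Rightarrow> complex"
  assumes cont: "continuous_on UNIV u" and u: "integrable lborel u" and B: "\<And>x. norm (u x) \<le> B"
    and F: "integrable lborel (fourier u)"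
  shows "(LINT \<xi>|lborel. exp (\<i> * complex_of_real (\<xi> \<bullet> x)) * fourier u \<xi>) = complex_of_real ((2 * pi) ^ CARD('d)) * u x"
proof -
  have [measurable]: "u \<in> borel_measurable borel" "fourier u \<in> borel_measurable borel"
    using borel_measurable_integrable[OF u] borel_measurable_integrable[OF F] by simp_all
  define r where "r = (\<lambda>n. 1 / real (Suc n))"
  have r: "0 < r n" for n by (simp add: r_def)
  have r0: "r \<longlonglongrightarrow> 0" unfolding r_def by (rule LIMSEQ_Suc[OF lim_1_over_n])
  let ?L = "\<lambda>n. LINT \<xi>|lborel. complex_of_real (exp (- ((r n)\<^sup>2 * (norm \<xi>)\<^sup>2))) * (exp (\<i> * complex_of_real (\<xi> \<bullet> x)) * fourier u \<xi>)"
  let ?R = "\<lambda>n. LINT w|lborel. complex_of_real (exp (- (norm w)\<^sup>2)) * u (x + (2 * r n) *\<^sub>R w)"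
  have "?L \<longlonglongrightarrow> (LINT \<xi>|lborel. complex_of_real (exp (- (0\<^sup>2 * (norm \<xi>)\<^sup>2))) * (exp (\<i> * complex_of_real (\<xi> \<bullet> x)) * fourier u \<xi>))"
  proof (rule integral_dominated_convergence[where w = "\<lambda>\<xi>. norm (fourier u \<xi>)"])
    show "AE \<xi> in lborel. (\<lambda>n. complex_of_real (exp (- ((r n)\<^sup>2 * (norm \<xi>)\<^sup>2))) * (exp (\<i> * complex_of_real (\<xi> \<bullet> x)) * fourier u \<xi>))
      \<longlonglongrightarrow> complex_of_real (exp (- (0\<^sup>2 * (norm \<xi>)\<^sup>2))) * (exp (\<i> * complex_of_real (\<xi> \<bullet> x)) * fourier u \<xi>)"
      by (intro AE_I2 tendsto_intros r0)
    show "AE \<xi> in lborel. norm (complex_of_real (exp (- ((r n)\<^sup>2 * (norm \<xi>)\<^sup>2))) * (exp (\<i> * complex_of_real (\<xi> \<bullet> x)) * fourier u \<xi>)) \<le> norm (fourier u \<xi>)" for n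
      by (intro AE_I2) (auto simp: norm_mult intro!: mult_left_le_one_le)
  qed (use integrable_norm[OF F] in simp_all)
  then have L: "?L \<longlonglongrightarrow> (LINT \<xi>|lborel. exp (\<i> * complex_of_real (\<xi> \<bullet> x)) * fourier u \<xi>)" by simp
  have "?R \<longlonglongrightarrow> (LINT w|lborel. complex_of_real (exp (- (norm (w :: real ^ 'd))\<^sup>2)) * u x)"
  proof (rule integral_dominated_convergence[where w = "\<lambda>w. exp (- (1 * (norm w)\<^sup>2)) * B"])
    show "integrable lborel (\<lambda>w :: real ^ 'd. exp (- (1 * (norm w)\<^sup>2)) * B)"
      by (intro integrable_mult_left integrable_gaussian) simp
    show "AE w in lborel. (\<lambda>n. complex_of_real (exp (- (norm w)\<^sup>2)) * u (x + (2 * r n) *\<^sub>R w)) \<longlonglongrightarrow> complex_of_real (exp (- (norm w)\<^sup>2)) * u x"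
    proof (intro AE_I2 tendsto_mult tendsto_const)
      fix w :: "real ^ 'd"
      have "(\<lambda>n. x + (2 * r n) *\<^sub>R w) \<longlonglongrightarrow> x + (2 * 0) *\<^sub>R w" by (intro tendsto_intros r0)
      then have "(\<lambda>n. x + (2 * r n) *\<^sub>R w) \<longlonglongrightarrow> x" by simp
      moreover have "isCont u x" using cont by (simp add: continuous_on_eq_continuous_at)
      ultimately show "(\<lambda>n. u (x + (2 * r n) *\<^sub>R w)) \<longlonglongrightarrow> u x" by (rule isCont_tendsto_compose[rotated])
    qed
    show "AE w in lborel. norm (complex_of_real (exp (- (norm w)\<^sup>2)) * u (x + (2 * r n) *\<^sub>R w)) \<le> exp (- (1 * (norm w)\<^sup>2)) * B" for n
      using B by (intro AE_I2) (auto simp: norm_mult intro!: mult_left_mono)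
  qed simp_all
  moreover have "(LINT w|lborel. complex_of_real (exp (- (norm (w :: real ^ 'd))\<^sup>2)) * u x) = complex_of_real (sqrt pi ^ CARD('d)) * u x"
    using integral_gaussian_wave[of 1 "0 :: real ^ 'd"] by simp
  ultimately have "(\<lambda>n. complex_of_real ((2 * sqrt pi) ^ CARD('d)) * ?R n) \<longlonglongrightarrow> complex_of_real ((2 * sqrt pi) ^ CARD('d)) * (complex_of_real (sqrt pi ^ CARD('d)) * u x)"
    by (intro tendsto_mult tendsto_const) (simp only:)
  then have "?L \<longlonglongrightarrow> complex_of_real ((2 * sqrt pi) ^ CARD('d)) * (complex_of_real (sqrt pi ^ CARD('d)) * u x)"
    unfolding gaussian_fourier_integral[OF u r] .
  moreover have "(2 * sqrt pi) ^ CARD('d) * sqrt pi ^ CARD('d) = (2 * pi) ^ CARD('d)"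
  proof -
    have "(2 * sqrt pi) * sqrt pi = 2 * pi" by simp
    then show ?thesis by (metis power_mult_distrib)
  qed
  then have "complex_of_real ((2 * sqrt pi) ^ CARD('d)) * (complex_of_real (sqrt pi ^ CARD('d)) * u x) = complex_of_real ((2 * pi) ^ CARD('d)) * u x"
    by (metis mult.assoc of_real_mult)
  ultimately show ?thesis using LIMSEQ_unique[OF L] by simp
qed

section \<open>The symbol of the fractional Laplacian\<close>

lemma nn_integral_swap:
  fixes f :: "'a :: euclidean_space \<Rightarrow> 'b :: euclidean_space \<Rightarrow> ennreal"
  assumes "(\<lambda>p. f (fst p) (snd p)) \<in> borel_measurable (lborel \<Otimes>\<^sub>M lborel)"
  shows "(\<integral>\<^sup>+ x. \<integral>\<^sup>+ y. f x y \<partial>lborel \<partial>lborel) = (\<integral>\<^sup>+ y. \<integral>\<^sup>+ x. f x y \<partial>lborel \<partial>lborel)"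
  using lborel_pair.Fubini[OF assms] by simp

lemma nn_integral_Gamma:
  assumes s: "0 < s" and r: "0 < r"
  shows "(\<integral>\<^sup>+ t. ennreal (indicator {0<..} t * (t powr (s - 1) * exp (- (r * t)))) \<partial>lborel)
     = ennreal (Gamma s * r powr (- s))"
proof -
  let ?g = "\<lambda>t. ennreal (indicator {0<..} t * (t powr (s - 1) * exp (- (r * t))))"
  have "ennreal (Gamma s) = (\<integral>\<^sup>+ t. ennreal (indicator {0..} t * t powr (s - 1) / exp t) \<partial>lborel)"
    by (rule Gamma_conv_nn_integral_real[OF s])
  also have "\<dots> = \<bar>r\<bar> * (\<integral>\<^sup>+ t. ennreal (indicator {0..} (0 + r * t) * (0 + r * t) powr (s - 1) / exp (0 + r * t)) \<partial>lborel)"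
    using r by (intro nn_integral_real_affine) auto
  also have "(\<lambda>t. ennreal (indicator {0..} (0 + r * t) * (0 + r * t) powr (s - 1) / exp (0 + r * t))) = (\<lambda>t. ennreal (r powr (s - 1)) * ?g t)"
  proof
    fix t
    have "indicator {0..} (0 + r * t) * (0 + r * t) powr (s - 1) / exp (0 + r * t) = r powr (s - 1) * (indicator {0<..} t * (t powr (s - 1) * exp (- (r * t))))"
      using r by (cases "0 < t") (auto simp: indicator_def powr_mult exp_minus field_simps zero_le_mult_iff)
    then show "ennreal (indicator {0..} (0 + r * t) * (0 + r * t) powr (s - 1) / exp (0 + r * t)) = ennreal (r powr (s - 1)) * ?g t"
      by (simp add: ennreal_mult')
  qed
  also have "(\<integral>\<^sup>+ t. ennreal (r powr (s - 1)) * ?g t \<partial>lborel) = ennreal (r powr (s - 1)) * (\<integral>\<^sup>+ t. ?g t \<partial>lborel)"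
    by (intro nn_integral_cmult) measurable
  also have "ennreal \<bar>r\<bar> * (ennreal (r powr (s - 1)) * (\<integral>\<^sup>+ t. ?g t \<partial>lborel)) = ennreal (r powr s) * (\<integral>\<^sup>+ t. ?g t \<partial>lborel)"
    using r by (simp add: mult.assoc[symmetric] ennreal_mult'[symmetric] powr_mult_base)
  finally have "ennreal (r powr (- s)) * ennreal (Gamma s) = ennreal (r powr (- s)) * ennreal (r powr s) * (\<integral>\<^sup>+ t. ?g t \<partial>lborel)"
    by (simp add: mult.assoc)
  moreover have "ennreal (r powr (- s)) * ennreal (r powr s) = 1"
    using r by (simp add: ennreal_mult'[symmetric] powr_add[symmetric])
  ultimately have "(\<integral>\<^sup>+ t. ?g t \<partial>lborel) = ennreal (r powr (- s)) * ennreal (Gamma s)"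
    by (simp only: mult_1_left)
  also have "\<dots> = ennreal (r powr (- s) * Gamma s)" by (rule ennreal_mult'[symmetric]) simp
  finally show ?thesis by (simp only: mult.commute)
qed

text \<open>
  Write \<open>J(l)\<close> for the left side. Scaling gives \<open>J(l) = l\<^sup>\<beta> J(1)\<close>. To find \<open>J(1)\<close>, integrate
  against \<open>e\<^bsup>-l\<^esup>\<close>: this produces \<open>\<Gamma>(\<beta>+1) J(1)\<close> on one side and, after exchanging the integrals,
  \<open>\<integral> t\<^bsup>\<beta>-1\<^esup>/(1+t) dt = \<Gamma>(\<beta>) \<Gamma>(1-\<beta>)\<close> on the other.
\<close>

lemma nn_integral_Mellin_one_minus_exp:
  assumes \<beta>: "0 < \<beta>" "\<beta> < 1" and "0 \<le> l"
  shows "(\<integral>\<^sup>+ t. ennreal (indicator {0<..} t * (t powr (\<beta> - 1) * (1 - exp (- (l / t))))) \<partial>lborel)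
     = ennreal (Gamma (1 - \<beta>) / \<beta> * l powr \<beta>)"
proof -
  define J where "J = (\<lambda>l. \<integral>\<^sup>+ t. ennreal (indicator {0<..} t * (t powr (\<beta> - 1) * (1 - exp (- (l / t))))) \<partial>lborel)"
  have nn: "0 \<le> 1 - exp (- (l / t))" if "0 < l" "0 < t" for l t :: real using that by simp
  have scale: "J l = ennreal (l powr \<beta>) * J 1" if l: "0 < l" for l
  proof -
    have "J l = \<bar>l\<bar> * (\<integral>\<^sup>+ t. ennreal (indicator {0<..} (0 + l * t) * ((0 + l * t) powr (\<beta> - 1) * (1 - exp (- (l / (0 + l * t)))))) \<partial>lborel)"
      unfolding J_def using l by (intro nn_integral_real_affine) auto
    also have "(\<lambda>t. ennreal (indicator {0<..} (0 + l * t) * ((0 + l * t) powr (\<beta> - 1) * (1 - exp (- (l / (0 + l * t)))))))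
       = (\<lambda>t. ennreal (l powr (\<beta> - 1)) * ennreal (indicator {0<..} t * (t powr (\<beta> - 1) * (1 - exp (- (1 / t))))))"
      using l by (auto simp: fun_eq_iff ennreal_mult'[symmetric] indicator_def powr_mult zero_less_mult_iff intro!: arg_cong[where f = ennreal])
    also have "\<bar>l\<bar> * (\<integral>\<^sup>+ t. ennreal (l powr (\<beta> - 1)) * ennreal (indicator {0<..} t * (t powr (\<beta> - 1) * (1 - exp (- (1 / t))))) \<partial>lborel)
       = \<bar>l\<bar> * (ennreal (l powr (\<beta> - 1)) * J 1)"
      unfolding J_def by (subst nn_integral_cmult) auto
    also have "\<dots> = ennreal (l powr \<beta>) * J 1"
      using l by (simp add: mult.assoc[symmetric] ennreal_mult'[symmetric] powr_mult_base)
    finally show ?thesis .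
  qed
  let ?E = "\<lambda>l t. ennreal (indicator {0<..} l * exp (- l)) * ennreal (indicator {0<..} t * (t powr (\<beta> - 1) * (1 - exp (- (l / t)))))"
  have "ennreal (Gamma (\<beta> + 1)) * J 1 = (\<integral>\<^sup>+ l. ennreal (indicator {0<..} l * (l powr (\<beta> + 1 - 1) * exp (- (1 * l)))) \<partial>lborel) * J 1"
    using \<beta> by (subst nn_integral_Gamma) auto
  also have "\<dots> = (\<integral>\<^sup>+ l. ennreal (indicator {0<..} l * exp (- l)) * J l \<partial>lborel)"
  proof (subst nn_integral_multc[symmetric])
    show "(\<integral>\<^sup>+ l. ennreal (indicator {0<..} l * (l powr (\<beta> + 1 - 1) * exp (- (1 * l)))) * J 1 \<partial>lborel)
       = (\<integral>\<^sup>+ l. ennreal (indicator {0<..} l * exp (- l)) * J l \<partial>lborel)"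
    proof (rule nn_integral_cong)
      fix l :: real
      show "ennreal (indicator {0<..} l * (l powr (\<beta> + 1 - 1) * exp (- (1 * l)))) * J 1 = ennreal (indicator {0<..} l * exp (- l)) * J l"
      proof (cases "0 < l")
        case True
        have "ennreal (l powr \<beta> * exp (- l)) = ennreal (exp (- l)) * ennreal (l powr \<beta>)"
          by (subst ennreal_mult'[symmetric]) (auto simp: mult.commute)
        then show ?thesis using True by (simp add: scale[OF True] mult.assoc)
      qed simp
    qed
  qed measurable
  also have "\<dots> = (\<integral>\<^sup>+ l. \<integral>\<^sup>+ t. ?E l t \<partial>lborel \<partial>lborel)"
    unfolding J_def by (intro nn_integral_cong nn_integral_cmult[symmetric]) auto
  also have "\<dots> = (\<integral>\<^sup>+ t. \<integral>\<^sup>+ l. ?E l t \<partial>lborel \<partial>lborel)"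
    by (rule nn_integral_swap) measurable
  also have "\<dots> = (\<integral>\<^sup>+ t. ennreal (indicator {0<..} t * (t powr (\<beta> - 1) * (1 / (1 + t)))) \<partial>lborel)"
  proof (rule nn_integral_cong)
    fix t :: real
    show "(\<integral>\<^sup>+ l. ?E l t \<partial>lborel) = ennreal (indicator {0<..} t * (t powr (\<beta> - 1) * (1 / (1 + t))))"
    proof (cases "0 < t")
      case t: True
      have "(\<integral>\<^sup>+ l. ?E l t \<partial>lborel) = (\<integral>\<^sup>+ l. ennreal (t powr (\<beta> - 1)) *
          (ennreal (indicator {0<..} l * (l powr (1 - 1) * exp (- (1 * l)))) - ennreal (indicator {0<..} l * (l powr (1 - 1) * exp (- ((1 + 1 / t) * l))))) \<partial>lborel)"
      proof (rule nn_integral_cong)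
        fix l :: real
        show "?E l t = ennreal (t powr (\<beta> - 1)) *
          (ennreal (indicator {0<..} l * (l powr (1 - 1) * exp (- (1 * l)))) - ennreal (indicator {0<..} l * (l powr (1 - 1) * exp (- ((1 + 1 / t) * l)))))"
        proof (cases "0 < l")
          case l: True
          have "exp (- ((1 + 1 / t) * l)) = exp (- l) * exp (- (l / t))" by (simp add: exp_add[symmetric] algebra_simps)
          then show ?thesis using t l nn[OF l t]
            by (simp add: ennreal_mult'[symmetric] ennreal_minus) (simp add: algebra_simps)
        qed simp
      qed
      also have "\<dots> = ennreal (t powr (\<beta> - 1)) * (\<integral>\<^sup>+ l.
          (ennreal (indicator {0<..} l * (l powr (1 - 1) * exp (- (1 * l)))) - ennreal (indicator {0<..} l * (l powr (1 - 1) * exp (- ((1 + 1 / t) * l))))) \<partial>lborel)"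
        by (intro nn_integral_cmult) measurable
      also have "(\<integral>\<^sup>+ l.
          (ennreal (indicator {0<..} l * (l powr (1 - 1) * exp (- (1 * l)))) - ennreal (indicator {0<..} l * (l powr (1 - 1) * exp (- ((1 + 1 / t) * l))))) \<partial>lborel)
         = (\<integral>\<^sup>+ l. ennreal (indicator {0<..} l * (l powr (1 - 1) * exp (- (1 * l)))) \<partial>lborel) - (\<integral>\<^sup>+ l. ennreal (indicator {0<..} l * (l powr (1 - 1) * exp (- ((1 + 1 / t) * l)))) \<partial>lborel)"
      proof (rule nn_integral_diff)
        show "(\<integral>\<^sup>+ l. ennreal (indicator {0<..} l * (l powr (1 - 1) * exp (- ((1 + 1 / t) * l)))) \<partial>lborel) \<noteq> \<infinity>"
          using t by (subst nn_integral_Gamma) (auto intro: add_pos_pos)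
        show "AE l in lborel. ennreal (indicator {0<..} l * (l powr (1 - 1) * exp (- ((1 + 1 / t) * l)))) \<le> ennreal (indicator {0<..} l * (l powr (1 - 1) * exp (- (1 * l))))"
          using t by (intro AE_I2 ennreal_leI) (auto simp: indicator_def algebra_simps)
      qed measurable
      also have "\<dots> = ennreal (1 - (1 + 1 / t) powr (- 1))"
        using t by (subst (1 2) nn_integral_Gamma) (auto intro: add_pos_pos simp: ennreal_minus Gamma_1 simp flip: ennreal_1)
      also have "1 - (1 + 1 / t) powr (- 1) = 1 / (1 + t)"
        using t by (simp add: powr_minus field_simps)
      finally show ?thesis using t by (simp add: ennreal_mult'[symmetric])
    qed simp
  qed
  also have "\<dots> = (\<integral>\<^sup>+ t. \<integral>\<^sup>+ s. ennreal (indicator {0<..} t * t powr (\<beta> - 1)) * ennreal (indicator {0<..} s * (s powr (1 - 1) * exp (- ((1 + t) * s)))) \<partial>lborel \<partial>lborel)"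
  proof (rule nn_integral_cong)
    fix t :: real
    show "ennreal (indicator {0<..} t * (t powr (\<beta> - 1) * (1 / (1 + t))))
       = (\<integral>\<^sup>+ s. ennreal (indicator {0<..} t * t powr (\<beta> - 1)) * ennreal (indicator {0<..} s * (s powr (1 - 1) * exp (- ((1 + t) * s)))) \<partial>lborel)"
    proof (cases "0 < t")
      case True
      then show ?thesis
        by (subst nn_integral_cmult, measurable, subst nn_integral_Gamma)
           (auto simp: ennreal_mult'[symmetric] powr_minus divide_inverse)
    qed simp
  qed
  also have "\<dots> = (\<integral>\<^sup>+ s. \<integral>\<^sup>+ t. ennreal (indicator {0<..} t * t powr (\<beta> - 1)) * ennreal (indicator {0<..} s * (s powr (1 - 1) * exp (- ((1 + t) * s)))) \<partial>lborel \<partial>lborel)"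
    by (rule nn_integral_swap) measurable
  also have "\<dots> = (\<integral>\<^sup>+ s. ennreal (Gamma \<beta>) * ennreal (indicator {0<..} s * (s powr ((1 - \<beta>) - 1) * exp (- (1 * s)))) \<partial>lborel)"
  proof (rule nn_integral_cong)
    fix s :: real
    show "(\<integral>\<^sup>+ t. ennreal (indicator {0<..} t * t powr (\<beta> - 1)) * ennreal (indicator {0<..} s * (s powr (1 - 1) * exp (- ((1 + t) * s)))) \<partial>lborel)
       = ennreal (Gamma \<beta>) * ennreal (indicator {0<..} s * (s powr ((1 - \<beta>) - 1) * exp (- (1 * s))))"
    proof (cases "0 < s")
      case s: True
      have e: "ennreal (indicator {0<..} t * t powr (\<beta> - 1)) * ennreal (indicator {0<..} s * (s powr (1 - 1) * exp (- ((1 + t) * s))))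
         = ennreal (exp (- s)) * ennreal (indicator {0<..} t * (t powr (\<beta> - 1) * exp (- (s * t))))" for t
      proof -
        have "exp (- ((1 + t) * s)) = exp (- s) * exp (- (s * t))" by (simp add: exp_add[symmetric] algebra_simps)
        then show ?thesis using s by (simp add: ennreal_mult'[symmetric] mult_ac)
      qed
      have "(\<integral>\<^sup>+ t. ennreal (exp (- s)) * ennreal (indicator {0<..} t * (t powr (\<beta> - 1) * exp (- (s * t)))) \<partial>lborel)
         = ennreal (exp (- s)) * ennreal (Gamma \<beta> * s powr (- \<beta>))"
        using s \<beta> by (subst nn_integral_cmult, measurable, subst nn_integral_Gamma) auto
      also have "\<dots> = ennreal (exp (- s) * (Gamma \<beta> * s powr (- \<beta>)))"
        by (rule ennreal_mult'[symmetric]) simp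
      also have "\<dots> = ennreal (Gamma \<beta>) * ennreal (s powr (- \<beta>) * exp (- s))"
        using \<beta> by (subst ennreal_mult'[symmetric]) (auto simp: mult_ac Gamma_real_pos less_imp_le)
      finally show ?thesis unfolding e using s by simp
    qed simp
  qed
  also have "\<dots> = ennreal (Gamma \<beta>) * ennreal (Gamma (1 - \<beta>) * 1 powr (- (1 - \<beta>)))"
    using \<beta> by (subst nn_integral_cmult, measurable, subst nn_integral_Gamma) auto
  finally have e: "ennreal (Gamma (\<beta> + 1)) * J 1 = ennreal (Gamma \<beta> * Gamma (1 - \<beta>))"
    using \<beta> by (simp add: ennreal_mult' Gamma_real_pos less_imp_le)
  have "\<beta> \<notin> \<int>\<^sub>\<le>\<^sub>0" using \<beta> nonpos_Ints_nonpos[of \<beta>] by auto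
  then have G: "Gamma (\<beta> + 1) = \<beta> * Gamma \<beta>" "0 < Gamma \<beta>" "0 < Gamma (1 - \<beta>)"
    using \<beta> by (auto intro: Gamma_plus1 Gamma_real_pos)
  have "ennreal (inverse (\<beta> * Gamma \<beta>)) * (ennreal (Gamma (\<beta> + 1)) * J 1) = J 1"
  proof -
    have "inverse (\<beta> * Gamma \<beta>) * (\<beta> * Gamma \<beta>) = 1"
      using \<beta> G(2) by (intro left_inverse) (metis less_irrefl mult_eq_0_iff)
    moreover have "ennreal (inverse (\<beta> * Gamma \<beta>) * (\<beta> * Gamma \<beta>)) = ennreal (inverse (\<beta> * Gamma \<beta>)) * ennreal (Gamma (\<beta> + 1))"
      unfolding G(1) using \<beta> G by (intro ennreal_mult') auto
    ultimately show ?thesis by (simp add: mult.assoc[symmetric])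
  qed
  then have J1: "J 1 = ennreal (Gamma (1 - \<beta>) / \<beta>)"
    unfolding e using \<beta> G by (simp add: ennreal_mult'[symmetric] field_simps)
  show ?thesis
  proof (cases "l = 0")
    case False
    then have "J l = ennreal (l powr \<beta>) * ennreal (Gamma (1 - \<beta>) / \<beta>)"
      using scale[of l] assms unfolding J1 by simp
    also have "\<dots> = ennreal (l powr \<beta> * (Gamma (1 - \<beta>) / \<beta>))" by (rule ennreal_mult'[symmetric]) simp
    finally show ?thesis unfolding J_def by (simp only: mult.commute)
  qed simp
qed

lemma nn_integral_gaussian_one_minus_cos:
  fixes \<xi> :: "'a :: euclidean_space"
  assumes t: "0 < t"
  shows "(\<integral>\<^sup>+ z. ennreal ((1 - cos (\<xi> \<bullet> z)) * exp (- (t * (norm z)\<^sup>2))) \<partial>lborel)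
    = ennreal (sqrt (pi / t) ^ DIM('a) * (1 - exp (- ((norm \<xi>)\<^sup>2 / (4 * t)))))"
proof -
  let ?w = "\<lambda>\<xi> z :: 'a. complex_of_real (exp (- (t * (norm z)\<^sup>2))) * exp (\<i> * complex_of_real (\<xi> \<bullet> z))"
  have i: "integrable lborel (\<lambda>z. ?w 0 z - ?w \<xi> z)"
    by (intro Bochner_Integration.integrable_diff integrable_gaussian_wave t)
  have e: "Re (?w 0 z - ?w \<xi> z) = (1 - cos (\<xi> \<bullet> z)) * exp (- (t * (norm z)\<^sup>2))" for z
    by (simp add: Re_exp algebra_simps)
  have "(LINT z|lborel. ?w 0 z - ?w \<xi> z) = complex_of_real (sqrt (pi / t) ^ DIM('a) * (1 - exp (- ((norm \<xi>)\<^sup>2 / (4 * t)))))"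
    by (subst Bochner_Integration.integral_diff, (intro integrable_gaussian_wave t)+, (subst integral_gaussian_wave[OF t])+)
       (simp add: algebra_simps)
  then have "(LINT z|lborel. (1 - cos (\<xi> \<bullet> z)) * exp (- (t * (norm z)\<^sup>2))) = sqrt (pi / t) ^ DIM('a) * (1 - exp (- ((norm \<xi>)\<^sup>2 / (4 * t))))"
    using integral_Re[OF i] unfolding e by simp
  moreover have "integrable lborel (\<lambda>z. (1 - cos (\<xi> \<bullet> z)) * exp (- (t * (norm z)\<^sup>2)))"
    using integrable_Re[OF i] unfolding e .
  ultimately show ?thesis
    by (subst nn_integral_eq_integral) auto
qed

text \<open>
  This identifies the normalising constant of the fractional Laplacian. The power \<open>|z|\<^bsup>-(d+a)\<^esup>\<close> is
  written as a superposition of Gaussians by the Gamma integral; after exchanging the integrals, the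
  \<open>z\<close>-integral is Gaussian and the remaining one is the Mellin transform above with
  \<open>\<beta> = a/2\<close> and \<open>l = |\<xi>|\<^sup>2/4\<close>.
\<close>

lemma nn_integral_one_minus_cos_kernel:
  fixes \<xi> :: "'a :: euclidean_space"
  assumes a: "0 < a" "a < 2"
  shows "(\<integral>\<^sup>+ z. ennreal ((1 - cos (\<xi> \<bullet> z)) / norm z powr (real DIM('a) + a)) \<partial>lborel)
    = ennreal (norm \<xi> powr a / frac_lap_const DIM('a) a)"
proof -
  define p where "p = (real DIM('a) + a) / 2"
  have p: "0 < p" using a by (simp add: p_def add_nonneg_pos)
  let ?d = "DIM('a)"
  let ?h = "\<lambda>t z. ennreal (indicator {0<..} t * (t powr (p - 1))) * ennreal ((1 - cos (\<xi> \<bullet> z)) * exp (- (t * (norm z)\<^sup>2)))"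
  have "ennreal (Gamma p) * (\<integral>\<^sup>+ z. ennreal ((1 - cos (\<xi> \<bullet> z)) / norm z powr (real ?d + a)) \<partial>lborel)
     = (\<integral>\<^sup>+ z. ennreal (Gamma p) * ennreal ((1 - cos (\<xi> \<bullet> z)) / norm z powr (real ?d + a)) \<partial>lborel)"
    by (intro nn_integral_cmult[symmetric]) measurable
  also have "\<dots> = (\<integral>\<^sup>+ z. \<integral>\<^sup>+ t. ?h t z \<partial>lborel \<partial>lborel)"
  proof (rule nn_integral_cong)
    fix z :: 'a
    show "ennreal (Gamma p) * ennreal ((1 - cos (\<xi> \<bullet> z)) / norm z powr (real ?d + a)) = (\<integral>\<^sup>+ t. ?h t z \<partial>lborel)"
    proof (cases "z = 0")
      case False
      have e: "?h t z = ennreal (1 - cos (\<xi> \<bullet> z)) * ennreal (indicator {0<..} t * (t powr (p - 1) * exp (- ((norm z)\<^sup>2 * t))))" for t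
        by (simp add: ennreal_mult'[symmetric] ennreal_mult''[symmetric] mult_ac)
      have "(\<integral>\<^sup>+ t. ?h t z \<partial>lborel) = ennreal (1 - cos (\<xi> \<bullet> z)) * ennreal (Gamma p * ((norm z)\<^sup>2) powr (- p))"
        unfolding e using False p by (subst nn_integral_cmult, measurable, subst nn_integral_Gamma) auto
      also have "((norm z)\<^sup>2) powr (- p) = 1 / norm z powr (real ?d + a)"
      proof -
        have "(norm z)\<^sup>2 = norm z powr 2" using False by simp
        then have "((norm z)\<^sup>2) powr (- p) = norm z powr (2 * - p)" by (simp only: powr_powr)
        also have "2 * - p = - (real ?d + a)" unfolding p_def by (simp add: field_simps)
        finally show ?thesis by (simp only: powr_minus_divide)
      qed
      finally show ?thesis
        using p by (simp add: ennreal_mult'[symmetric] ennreal_mult''[symmetric] mult.commute Gamma_real_pos less_imp_le)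
    qed simp
  qed
  also have "\<dots> = (\<integral>\<^sup>+ t. \<integral>\<^sup>+ z. ?h t z \<partial>lborel \<partial>lborel)"
    by (rule nn_integral_swap) measurable
  also have "\<dots> = (\<integral>\<^sup>+ t. ennreal (pi powr (real ?d / 2)) * ennreal (indicator {0<..} t * (t powr (a / 2 - 1) * (1 - exp (- ((norm \<xi>)\<^sup>2 / 4 / t))))) \<partial>lborel)"
  proof (rule nn_integral_cong)
    fix t :: real
    show "(\<integral>\<^sup>+ z. ?h t z \<partial>lborel) = ennreal (pi powr (real ?d / 2)) * ennreal (indicator {0<..} t * (t powr (a / 2 - 1) * (1 - exp (- ((norm \<xi>)\<^sup>2 / 4 / t)))))"
    proof (cases "0 < t")
      case t: True
      have 1: "t powr (p - 1) * sqrt (pi / t) ^ ?d = pi powr (real ?d / 2) * t powr (a / 2 - 1)"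
      proof -
        have "sqrt (pi / t) ^ ?d = ((pi / t) powr (1 / 2)) powr real ?d"
          using t by (subst powr_realpow) (auto simp: powr_half_sqrt)
        also have "\<dots> = (pi / t) powr (real ?d / 2)"
          by (simp add: powr_powr)
        also have "\<dots> = pi powr (real ?d / 2) * t powr (- (real ?d / 2))"
          using t by (subst powr_divide) (auto simp: powr_minus_divide)
        finally have "t powr (p - 1) * sqrt (pi / t) ^ ?d = pi powr (real ?d / 2) * (t powr (p - 1) * t powr (- (real ?d / 2)))"
          by simp
        also have "t powr (p - 1) * t powr (- (real ?d / 2)) = t powr (a / 2 - 1)"
        proof -
          have "p - 1 + - (real ?d / 2) = a / 2 - 1" unfolding p_def by (simp add: field_simps)
          then show ?thesis by (simp only: powr_add[symmetric])
        qed
        finally show ?thesis .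
      qed
      have "(\<integral>\<^sup>+ z. ?h t z \<partial>lborel) = ennreal (t powr (p - 1)) * ennreal (sqrt (pi / t) ^ ?d * (1 - exp (- ((norm \<xi>)\<^sup>2 / (4 * t)))))"
        using t by (subst nn_integral_cmult, measurable, subst nn_integral_gaussian_one_minus_cos) auto
      also have "\<dots> = ennreal ((t powr (p - 1) * sqrt (pi / t) ^ ?d) * (1 - exp (- ((norm \<xi>)\<^sup>2 / (4 * t)))))"
        by (simp add: ennreal_mult'[symmetric] mult.assoc)
      finally show ?thesis unfolding 1 using t by (simp add: ennreal_mult'[symmetric] mult.assoc)
    qed simp
  qed
  also have "\<dots> = ennreal (pi powr (real ?d / 2)) * ennreal (Gamma (1 - a / 2) / (a / 2) * ((norm \<xi>)\<^sup>2 / 4) powr (a / 2))"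
    using a by (subst nn_integral_cmult, measurable, subst nn_integral_Mellin_one_minus_exp) auto
  also have "((norm \<xi>)\<^sup>2 / 4) powr (a / 2) = norm \<xi> powr a / 2 powr a"
  proof -
    have "(norm \<xi>)\<^sup>2 / 4 = (norm \<xi> / 2)\<^sup>2" by (simp add: power_divide)
    also have "\<dots> powr (a / 2) = (norm \<xi> / 2) powr a"
      by (cases "\<xi> = 0") (simp_all add: powr_powr flip: powr_numeral)
    finally show ?thesis by (simp add: powr_divide)
  qed
  finally have e: "ennreal (Gamma p) * (\<integral>\<^sup>+ z. ennreal ((1 - cos (\<xi> \<bullet> z)) / norm z powr (real ?d + a)) \<partial>lborel)
     = ennreal (pi powr (real ?d / 2)) * ennreal (Gamma (1 - a / 2) / (a / 2) * (norm \<xi> powr a / 2 powr a))" .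
  have G: "0 < Gamma p" "0 < Gamma (1 - a / 2)" using p a by (auto intro: Gamma_real_pos)
  have "(\<integral>\<^sup>+ z. ennreal ((1 - cos (\<xi> \<bullet> z)) / norm z powr (real ?d + a)) \<partial>lborel)
     = ennreal (inverse (Gamma p)) * (ennreal (Gamma p) * (\<integral>\<^sup>+ z. ennreal ((1 - cos (\<xi> \<bullet> z)) / norm z powr (real ?d + a)) \<partial>lborel))"
    using G by (simp add: mult.assoc[symmetric] ennreal_mult'[symmetric])
  also have "\<dots> = ennreal (inverse (Gamma p) * (pi powr (real ?d / 2) * (Gamma (1 - a / 2) / (a / 2) * (norm \<xi> powr a / 2 powr a))))"
    unfolding e using G a by (simp add: ennreal_mult'[symmetric])
  also have "inverse (Gamma p) * (pi powr (real ?d / 2) * (Gamma (1 - a / 2) / (a / 2) * (norm \<xi> powr a / 2 powr a)))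
     = norm \<xi> powr a / frac_lap_const ?d a"
  proof -
    have 1: "(a + real ?d) / 2 = p" by (simp add: p_def add.commute)
    have 2: "2 powr (a - 1) = 2 powr a / 2" by (simp add: powr_diff)
    have 3: "inverse (Gamma p) * (P * (G / (a / 2) * (x / T))) = x / (T / 2 * a * Gamma p / (P * G))"
      if "Gamma p \<noteq> 0" "T \<noteq> 0" "P \<noteq> 0" "G \<noteq> 0" for P G x T :: real
      using that a by (simp add: field_simps)
    have "Gamma (1 - a / 2) \<noteq> 0" "Gamma p \<noteq> 0" using G by linarith+
    then show ?thesis unfolding frac_lap_const_def 1 2 by (intro 3) auto
  qed
  finally show ?thesis .
qed

lemma lborel_distr_plus_minus:
  fixes x :: "'a :: euclidean_space"
  shows "distr lborel borel (\<lambda>z. x + z) = lborel" "distr lborel borel (\<lambda>z. x - z) = lborel"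
  using lborel_affine[of 1 x] lborel_affine[of "-1" x] by (simp_all add: density_1)

text \<open>
  Averaging over the reflection in \<open>x\<close> is what turns a principal value into an absolutely
  convergent integral of second differences.
\<close>

lemma integral_even_part:
  fixes g :: "'a :: euclidean_space \<Rightarrow> 'b :: {banach, second_countable_topology}"
  assumes g: "integrable lborel g"
  shows "(LINT z|lborel. (1 / 2) *\<^sub>R (g (x + z) + g (x - z))) = (LINT y|lborel. g y)"
proof -
  have [measurable]: "g \<in> borel_measurable borel" using borel_measurable_integrable[OF g] by simp
  have i1: "integrable lborel (\<lambda>z. g (x + z))"
    using integrable_distr_eq[of "\<lambda>z. x + z" lborel borel g] g by (simp add: lborel_distr_plus_minus)
  have i2: "integrable lborel (\<lambda>z. g (x - z))"
    using integrable_distr_eq[of "\<lambda>z. x - z" lborel borel g] g by (simp add: lborel_distr_plus_minus)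
  have e1: "(LINT z|lborel. g (x + z)) = (LINT y|lborel. g y)"
    using integral_distr[of "\<lambda>z. x + z" lborel borel g] by (simp add: lborel_distr_plus_minus)
  have e2: "(LINT z|lborel. g (x - z)) = (LINT y|lborel. g y)"
    using integral_distr[of "\<lambda>z. x - z" lborel borel g] by (simp add: lborel_distr_plus_minus)
  have "(LINT z|lborel. (1 / 2) *\<^sub>R (g (x + z) + g (x - z))) = (1 / 2) *\<^sub>R ((LINT z|lborel. g (x + z)) + (LINT z|lborel. g (x - z)))"
    using i1 i2 by simp
  then show ?thesis
    unfolding e1 e2 by (simp add: scaleR_add_left[symmetric] flip: scaleR_2)
qed

lemma frac_lap_const_pos:
  assumes "0 < a" "a < 2"
  shows "0 < frac_lap_const d a"
  using assms unfolding frac_lap_const_def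
  by (intro divide_pos_pos mult_pos_pos Gamma_real_pos) auto

text \<open>
  The truncated integrals are unchanged if the first difference of \<open>u\<close> is replaced by its even
  part \<open>D\<close>, a weighted second difference. On the Fourier side \<open>D\<close> has the density
  \<open>(1 - cos (\<xi> \<bullet> z))/|z|\<^sup>n\<close>, which is nonnegative and has the \<open>z\<close>-integral \<open>|\<xi>|\<^sup>a/c\<close>; hence
  everything is absolutely integrable on the product space. Fubini evaluates the integral of \<open>D\<close>,
  and dominated convergence shows that the principal value equals it. The existence of the limit is
  a hypothesis, so it can be computed along one sequence of truncations.
\<close>

lemma has_frac_lap_imp_fourier_multiplier:
  fixes u :: "real ^ 'd \<Rightarrow> real" and U :: "real ^ 'd \<Rightarrow> complex"
  assumes L: "has_frac_lap \<alpha> u x L" and a: "0 < \<alpha> x" "\<alpha> x < 2"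
    and U: "integrable lborel U" "integrable lborel (\<lambda>\<xi>. norm \<xi> powr \<alpha> x * norm (U \<xi>))"
    and inv: "\<And>y. complex_of_real (u y) = (LINT \<xi>|lborel. exp (\<i> * complex_of_real (\<xi> \<bullet> y)) * U \<xi>)"
  shows "complex_of_real L = (LINT \<xi>|lborel. exp (\<i> * complex_of_real (\<xi> \<bullet> x)) * (complex_of_real (norm \<xi> powr \<alpha> x) * U \<xi>))"
proof -
  define a where "a = \<alpha> x"
  define n where "n = real CARD('d) + a"
  define c where "c = frac_lap_const CARD('d) a"
  define V where "V = (\<lambda>\<xi>. exp (\<i> * complex_of_real (\<xi> \<bullet> x)) * U \<xi>)"
  define w where "w = (\<lambda>\<xi> z :: real ^ 'd. (1 - cos (\<xi> \<bullet> z)) / norm z powr n)"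
  define k where "k = (\<lambda>\<xi> z. complex_of_real (w \<xi> z) * V \<xi>)"
  define D where "D = (\<lambda>z. (u x - u (x + z) / 2 - u (x - z) / 2) / norm z powr n)"
  have a': "0 < a" "a < 2" using a by (auto simp: a_def)
  have c: "0 < c" unfolding c_def by (rule frac_lap_const_pos[OF a'])
  have [measurable]: "U \<in> borel_measurable borel" using borel_measurable_integrable[OF U(1)] by simp
  have Vm[measurable]: "V \<in> borel_measurable borel" unfolding V_def by measurable
  have nV: "norm (V \<xi>) = norm (U \<xi>)" for \<xi> by (simp add: V_def norm_mult)
  have w0: "0 \<le> w \<xi> z" for \<xi> z by (simp add: w_def)
  have wn: "(\<integral>\<^sup>+ z. ennreal (w \<xi> z) \<partial>lborel) = ennreal (norm \<xi> powr a / c)" for \<xi>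
    using nn_integral_one_minus_cos_kernel[OF a', of \<xi>] by (simp add: w_def n_def c_def)
  have wi: "integrable lborel (w \<xi>)" for \<xi>
  proof (rule integrableI_nonneg)
    show "w \<xi> \<in> borel_measurable lborel" unfolding w_def by measurable
  qed (use w0 wn in auto)
  have wI: "(LINT z|lborel. w \<xi> z) = norm \<xi> powr a / c" for \<xi>
    using nn_integral_eq_integral[OF wi, of \<xi>] w0 c unfolding wn by (simp add: integral_nonneg_AE)
  have ki: "integrable (lborel \<Otimes>\<^sub>M lborel) (case_prod k)"
  proof (rule lborel_pair.Fubini_integrable)
    show "case_prod k \<in> borel_measurable (lborel \<Otimes>\<^sub>M lborel)" unfolding k_def w_def by measurable
    have "(LINT z|lborel. norm (k \<xi> z)) = (1 / c) * (norm \<xi> powr a * norm (U \<xi>))" for \<xi>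
    proof -
      have "norm (k \<xi> z) = w \<xi> z * norm (U \<xi>)" for z using w0 by (simp add: k_def norm_mult nV)
      then show ?thesis using wI[of \<xi>] by simp
    qed
    then show "integrable lborel (\<lambda>\<xi>. LINT z|lborel. norm (case (\<xi>, z) of (x, y) \<Rightarrow> k x y))"
      using U(2) by (simp add: a_def)
    show "AE \<xi> in lborel. integrable lborel (\<lambda>z. case (\<xi>, z) of (x, y) \<Rightarrow> k x y)"
      using wi by (auto simp: k_def intro!: integrable_mult_left integrable_of_real)
  qed
  have kD: "(LINT \<xi>|lborel. k \<xi> z) = complex_of_real (D z)" for z
  proof -
    let ?e = "\<lambda>y \<xi>. exp (\<i> * complex_of_real (\<xi> \<bullet> y)) * U \<xi>"
    have ei: "integrable lborel (?e y)" for y by (rule integrable_wave[OF U(1)])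
    have "k \<xi> z = complex_of_real (1 / norm z powr n) * (?e x \<xi> - ?e (x + z) \<xi> / 2 - ?e (x - z) \<xi> / 2)" for \<xi>
    proof -
      have e1: "exp (\<i> * complex_of_real (\<xi> \<bullet> (x + z))) = exp (\<i> * complex_of_real (\<xi> \<bullet> x)) * exp (\<i> * complex_of_real (\<xi> \<bullet> z))"
        by (simp add: inner_add_right distrib_left exp_add)
      have e2: "exp (\<i> * complex_of_real (\<xi> \<bullet> (x - z))) = exp (\<i> * complex_of_real (\<xi> \<bullet> x)) * exp (- (\<i> * complex_of_real (\<xi> \<bullet> z)))"
        by (simp add: inner_diff_right right_diff_distrib exp_diff exp_minus divide_inverse)
      have e3: "complex_of_real (cos (\<xi> \<bullet> z)) = (exp (\<i> * complex_of_real (\<xi> \<bullet> z)) + exp (- (\<i> * complex_of_real (\<xi> \<bullet> z)))) / 2"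
        by (simp only: cos_of_real[symmetric] cos_exp_eq)
      have "?e x \<xi> - ?e (x + z) \<xi> / 2 - ?e (x - z) \<xi> / 2 = complex_of_real (1 - cos (\<xi> \<bullet> z)) * V \<xi>"
        unfolding V_def of_real_diff of_real_1 e1 e2 e3 by (simp add: field_simps)
      then show ?thesis by (simp add: k_def w_def)
    qed
    then have "(LINT \<xi>|lborel. k \<xi> z) = (LINT \<xi>|lborel. complex_of_real (1 / norm z powr n) * (?e x \<xi> - ?e (x + z) \<xi> / 2 - ?e (x - z) \<xi> / 2))"
      by (intro Bochner_Integration.integral_cong) auto
    also have "\<dots> = complex_of_real (1 / norm z powr n) * ((LINT \<xi>|lborel. ?e x \<xi>) - (LINT \<xi>|lborel. ?e (x + z) \<xi>) / 2 - (LINT \<xi>|lborel. ?e (x - z) \<xi>) / 2)"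
      using ei by simp
    also have "\<dots> = complex_of_real (D z)"
      unfolding inv[symmetric] D_def by simp
    finally show ?thesis .
  qed
  have cDi: "integrable lborel (\<lambda>z. complex_of_real (D z))"
    using lborel_pair.integrable_snd[OF ki] unfolding kD .
  have Di: "integrable lborel D" using integrable_Re[OF cDi] by simp
  have "complex_of_real (LINT z|lborel. D z) = (LINT z|lborel. complex_of_real (D z))"
    by (rule integral_complex_of_real[symmetric])
  also have "\<dots> = (LINT z|lborel. (LINT \<xi>|lborel. k \<xi> z))" unfolding kD ..
  also have "\<dots> = (LINT \<xi>|lborel. (LINT z|lborel. k \<xi> z))"
    by (rule lborel_pair.Fubini_integral[OF ki])
  also have "\<dots> = (LINT \<xi>|lborel. complex_of_real (1 / c) * (exp (\<i> * complex_of_real (\<xi> \<bullet> x)) * (complex_of_real (norm \<xi> powr a) * U \<xi>)))"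
  proof (rule Bochner_Integration.integral_cong[OF refl])
    fix \<xi> :: "real ^ 'd"
    have "(LINT z|lborel. k \<xi> z) = complex_of_real (LINT z|lborel. w \<xi> z) * V \<xi>"
      unfolding k_def integral_complex_of_real[symmetric] by simp
    then show "(LINT z|lborel. k \<xi> z) = complex_of_real (1 / c) * (exp (\<i> * complex_of_real (\<xi> \<bullet> x)) * (complex_of_real (norm \<xi> powr a) * U \<xi>))"
      unfolding wI V_def by (simp add: mult_ac)
  qed
  also have "\<dots> = complex_of_real (1 / c) * (LINT \<xi>|lborel. exp (\<i> * complex_of_real (\<xi> \<bullet> x)) * (complex_of_real (norm \<xi> powr a) * U \<xi>))"
    by simp
  finally have target: "complex_of_real (c * (LINT z|lborel. D z)) = (LINT \<xi>|lborel. exp (\<i> * complex_of_real (\<xi> \<bullet> x)) * (complex_of_real (norm \<xi> powr a) * U \<xi>))"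
    using c by simp

  let ?f = "\<lambda>y. (u x - u y) / norm (x - y) powr n"
  define I where "I = (\<lambda>\<epsilon>. LINT y:{y. norm (x - y) > \<epsilon>}|lborel. ?f y)"
  have f_int: "set_integrable lborel {y. norm (x - y) > \<epsilon>} ?f" if "0 < \<epsilon>" for \<epsilon>
    using L that unfolding has_frac_lap_def n_def a_def by blast
  have lim: "((\<lambda>\<epsilon>. c * I \<epsilon>) \<longlongrightarrow> L) (at_right 0)"
    using L unfolding has_frac_lap_def n_def a_def c_def I_def by blast
  have I_eq: "I \<epsilon> = (LINT z|lborel. indicator {z. norm z > \<epsilon>} z * D z)" if "0 < \<epsilon>" for \<epsilon>
  proof -
    let ?g = "\<lambda>y. indicator {y. norm (x - y) > \<epsilon>} y *\<^sub>R ?f y"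
    have "integrable lborel ?g" using f_int[OF that] by (simp add: set_integrable_def)
    then have "I \<epsilon> = (LINT z|lborel. (1 / 2) *\<^sub>R (?g (x + z) + ?g (x - z)))"
      unfolding I_def set_lebesgue_integral_def by (rule integral_even_part[symmetric])
    also have "\<dots> = (LINT z|lborel. indicator {z. norm z > \<epsilon>} z * D z)"
    proof (rule Bochner_Integration.integral_cong[OF refl])
      fix z
      have "(1 / 2) * ((A - B) / N + (A - C) / N) = (A - B / 2 - C / 2) / N" for A B C N :: real
        by (cases "N = 0") (simp_all add: field_simps)
      then show "(1 / 2) *\<^sub>R (?g (x + z) + ?g (x - z)) = indicator {z. norm z > \<epsilon>} z * D z"
        by (simp add: indicator_def D_def)
    qed
    finally show ?thesis .
  qed
  define \<epsilon> where "\<epsilon> = (\<lambda>m. 1 / real (Suc m))"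
  have \<epsilon>0: "\<epsilon> \<longlonglongrightarrow> 0" unfolding \<epsilon>_def by (rule LIMSEQ_Suc[OF lim_1_over_n])
  have \<epsilon>_pos: "0 < \<epsilon> m" and \<epsilon>_nz: "\<epsilon> m \<noteq> 0" for m by (simp_all add: \<epsilon>_def)
  have "filterlim \<epsilon> (at_right 0) sequentially"
    using \<epsilon>0 \<epsilon>_pos \<epsilon>_nz by (simp add: filterlim_at)
  then have lim1: "(\<lambda>m. c * I (\<epsilon> m)) \<longlonglongrightarrow> L" by (rule filterlim_compose[OF lim])
  have "(\<lambda>m. LINT z|lborel. indicator {z. norm z > \<epsilon> m} z * D z) \<longlonglongrightarrow> (LINT z|lborel. D z)"
  proof (rule integral_dominated_convergence[where w = "\<lambda>z. norm (D z)"])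
    have [measurable]: "D \<in> borel_measurable borel" using borel_measurable_integrable[OF Di] by simp
    show "D \<in> borel_measurable lborel" by measurable
    show "(\<lambda>z. indicator {z. norm z > \<epsilon> m} z * D z) \<in> borel_measurable lborel" for m by measurable
    show "integrable lborel (\<lambda>z. norm (D z))" using Di by (rule integrable_norm)
    show "AE z in lborel. (\<lambda>m. indicator {z. norm z > \<epsilon> m} z * D z) \<longlonglongrightarrow> D z"
    proof (rule AE_I2)
      fix z :: "real ^ 'd"
      show "(\<lambda>m. indicator {z. norm z > \<epsilon> m} z * D z) \<longlonglongrightarrow> D z"
      proof (cases "z = 0")
        \<comment> \<open>\<open>D 0 = 0\<close>, so the point left out by every truncation does no harm.\<close>
        case True then show ?thesis by (simp add: D_def)
      next
        case False
        then have "eventually (\<lambda>m. \<epsilon> m < norm z) sequentially"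
          using order_tendstoD(2)[OF \<epsilon>0, of "norm z"] by simp
        then have "eventually (\<lambda>m. indicator {z. norm z > \<epsilon> m} z * D z = D z) sequentially"
          by eventually_elim simp
        then show ?thesis by (rule tendsto_eventually)
      qed
    qed
    show "AE z in lborel. norm (indicator {z. norm z > \<epsilon> m} z * D z) \<le> norm (D z)" for m
      by (intro AE_I2) (auto simp: indicator_def)
  qed
  then have "(\<lambda>m. c * I (\<epsilon> m)) \<longlonglongrightarrow> c * (LINT z|lborel. D z)"
    unfolding I_eq[OF \<epsilon>_pos] by (intro tendsto_mult tendsto_const)
  with lim1 have "L = c * (LINT z|lborel. D z)" by (rule LIMSEQ_unique)
  then show ?thesis using target by (simp add: a_def)
qed

section \<open>Consistency and convergence\<close>

lemma finite_grid_indices: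
  fixes \<Omega> :: "(real ^ 'd) set"
  assumes "bounded \<Omega>" "0 < h"
  shows "finite (grid_indices h \<Omega>)"
proof -
  obtain R where R: "\<And>x. x \<in> \<Omega> \<Longrightarrow> norm x \<le> R" using assms(1) by (auto simp: bounded_iff)
  define N where "N = \<lceil>R / h\<rceil>"
  have "vec_nth ` grid_indices h \<Omega> \<subseteq> (\<Pi>\<^sub>E p\<in>UNIV. {-N..N})"
  proof (rule image_subsetI, rule PiE_I)
    fix j :: "int ^ 'd" and p :: 'd assume "j \<in> grid_indices h \<Omega>"
    then have "\<bar>grid_pt h j $ p\<bar> \<le> R"
      using R[of "grid_pt h j"] component_le_norm_cart[of "grid_pt h j" p] by (simp add: grid_indices_def)
    then have "\<bar>of_int (j $ p)\<bar> \<le> R / h" using assms(2) by (simp add: grid_pt_def abs_mult pos_le_divide_eq)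
    then have "- N \<le> j $ p \<and> j $ p \<le> N"
      unfolding N_def by linarith
    then show "j $ p \<in> {- N..N}" by simp
  qed simp
  then have "finite (vec_nth ` grid_indices h \<Omega>)"
    by (rule finite_subset) (auto intro!: finite_PiE)
  then show ?thesis
    by (rule finite_imageD) (auto simp: inj_on_def vec_nth_inject)
qed

text \<open>
  Grid functions admitted by the scheme vanish outside a finite set, so the operator may be
  replaced by the random walk form, which is real on real functions.
\<close>

lemma scheme_solution_iff_walk:
  fixes \<Omega> :: "(real ^ 'd) set"
  assumes "bounded \<Omega>" "0 < h" "\<And>x. 0 < \<alpha> x" "\<And>x. \<alpha> x < 2"
  shows "scheme_solution \<Omega> \<alpha> b f h u \<longleftrightarrow>
    (\<forall>j\<in>grid_indices h \<Omega>. walk_frac_lap h (\<alpha> (grid_pt h j)) u j + b (grid_pt h j) * u j = f (grid_pt h j)) \<and>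
    (\<forall>j. j \<notin> grid_indices h \<Omega> \<longrightarrow> u j = 0)"
proof -
  have fin: "finite (grid_indices h \<Omega>)" by (rule finite_grid_indices[OF assms(1,2)])
  have "grid_frac_lap h a (\<lambda>k. complex_of_real (u k)) j = complex_of_real (walk_frac_lap h a u j)"
    if u: "\<And>j. j \<notin> grid_indices h \<Omega> \<Longrightarrow> u j = 0" and a: "0 < a" "a < 2" for a j
    using grid_frac_lap_eq_walk_frac_lap[OF fin _ assms(2) a, of "\<lambda>k. complex_of_real (u k)" j] u
      walk_frac_lap_of_real[OF finite_support_bounded[OF fin u] a, where h = h and j = j] by simp
  then show ?thesis
    unfolding scheme_solution_def using assms
    by (auto simp flip: of_real_mult of_real_add)
qed

lemma grid_norm_upper:
  assumes "finite (grid_indices h \<Omega>)" "j \<in> grid_indices h \<Omega>"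
  shows "\<bar>v j\<bar> \<le> grid_norm h \<Omega> v"
  using assms by (auto simp: grid_norm_def intro!: Max_ge)

lemma grid_norm_le:
  assumes "finite (grid_indices h \<Omega>)" "0 \<le> B" "\<And>j. j \<in> grid_indices h \<Omega> \<Longrightarrow> \<bar>v j\<bar> \<le> B"
  shows "grid_norm h \<Omega> v \<le> B"
  using assms by (auto simp: grid_norm_def)

lemma grid_norm_nonneg:
  assumes "finite (grid_indices h \<Omega>)"
  shows "0 \<le> grid_norm h \<Omega> v"
proof (cases "grid_indices h \<Omega> = {}")
  case False
  then obtain j where "j \<in> grid_indices h \<Omega>" by blast
  then show ?thesis using grid_norm_upper[OF assms, of j v] by linarith
qed (simp add: grid_norm_def)

lemma barron_space_integrable:
  fixes u :: "real ^ 'd \<Rightarrow> complex"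
  assumes "u \<in> barron_space t"
  shows "integrable lborel (\<lambda>\<xi>. (1 + norm \<xi> powr t) * norm (fourier u \<xi>))"
    and "integrable lborel (fourier u)"
proof -
  have u: "integrable lborel u"
    and fin: "(\<integral>\<^sup>+ \<xi>. ennreal ((1 + norm \<xi> powr t) * norm (fourier u \<xi>)) \<partial>lborel) < \<infinity>"
    using assms by (auto simp: barron_space_def)
  have [measurable]: "fourier u \<in> borel_measurable borel"
    using borel_measurable_integrable[OF u] by (intro fourier_measurable) simp
  show W: "integrable lborel (\<lambda>\<xi>. (1 + norm \<xi> powr t) * norm (fourier u \<xi>))"
    using fin by (intro integrableI_nonneg) (auto simp: add_nonneg_nonneg)
  show "integrable lborel (fourier u)"
  proof (rule Bochner_Integration.integrable_bound[OF W])
    show "AE \<xi> in lborel. norm (fourier u \<xi>) \<le> norm ((1 + norm \<xi> powr t) * norm (fourier u \<xi>))"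
      by (intro AE_I2) (simp add: abs_mult mult_le_cancel_right1 add_nonneg_nonneg)
  qed simp
qed

lemma powr_le_one_plus_powr:
  fixes r :: real
  assumes "0 \<le> r" "0 \<le> a" "a \<le> t"
  shows "r powr a \<le> 1 + r powr t"
proof (cases "r \<le> 1")
  case True
  then have "r powr a \<le> 1" using assms by (intro powr_le1) auto
  then show ?thesis using powr_ge_zero[of r t] by linarith
next
  case False
  then have "r powr a \<le> r powr t" using assms by (intro powr_mono) auto
  then show ?thesis by linarith
qed

text \<open>
  Both operators act on the same Fourier integral of \<open>u\<close>, by the multipliers \<open>lap_symbol powr (a/2)\<close> and
  \<open>|\<xi>|\<^sup>a\<close>. Their difference is at most \<open>h\<^sup>s |\<xi>|\<^bsup>a+s\<^esup>\<close>, and the remaining weight is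
  controlled by the Barron norm, uniformly in the order \<open>a\<close>.
\<close>

lemma consistency_error:
  fixes u :: "real ^ 'd \<Rightarrow> real" and U :: "real ^ 'd \<Rightarrow> complex"
  assumes L: "has_frac_lap \<alpha> u (grid_pt h j) L" and a: "\<alpha> (grid_pt h j) = a" "0 < a" "a < 2" and h: "0 < h"
    and s: "0 < s" "s \<le> 2" "s + a \<le> t"
    and U: "integrable lborel U" "integrable lborel (\<lambda>\<xi>. (1 + norm \<xi> powr t) * norm (U \<xi>))"
    and inv: "\<And>y. complex_of_real (u y) = (LINT \<xi>|lborel. exp (\<i> * complex_of_real (\<xi> \<bullet> y)) * U \<xi>)"
    and B: "\<And>y. \<bar>u y\<bar> \<le> B"
  shows "\<bar>walk_frac_lap h a (\<lambda>k. u (grid_pt h k)) j - L\<bar> \<le> h powr s * (LINT \<xi>|lborel. (1 + norm \<xi> powr t) * norm (U \<xi>))"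
proof -
  let ?e = "\<lambda>\<xi>. exp (\<i> * complex_of_real (\<xi> \<bullet> grid_pt h j))"
  let ?m = "\<lambda>\<xi> :: real ^ 'd. lap_symbol h \<xi> powr (a / 2)"
  have [measurable]: "U \<in> borel_measurable borel" using borel_measurable_integrable[OF U(1)] by simp
  have [measurable]: "?m \<in> borel_measurable borel" unfolding lap_symbol_def by measurable
  have i1: "integrable lborel (\<lambda>\<xi>. norm \<xi> powr a * norm (U \<xi>))"
  proof (rule Bochner_Integration.integrable_bound[OF U(2)])
    show "AE \<xi> in lborel. norm (norm \<xi> powr a * norm (U \<xi>)) \<le> norm ((1 + norm \<xi> powr t) * norm (U \<xi>))"
      using powr_le_one_plus_powr[of _ a t] a s by (intro AE_I2) (auto simp: abs_mult intro!: mult_right_mono)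
  qed simp
  have i2: "integrable lborel (\<lambda>\<xi>. ?e \<xi> * (complex_of_real (norm \<xi> powr a) * U \<xi>))"
  proof (rule Bochner_Integration.integrable_bound[OF i1])
    show "AE \<xi> in lborel. norm (?e \<xi> * (complex_of_real (norm \<xi> powr a) * U \<xi>)) \<le> norm (norm \<xi> powr a * norm (U \<xi>))"
      by (intro AE_I2) (auto simp: norm_mult)
  qed measurable
  have i3: "integrable lborel (\<lambda>\<xi>. ?e \<xi> * (complex_of_real (?m \<xi>) * U \<xi>))"
  proof (rule Bochner_Integration.integrable_bound[OF i1])
    have "?m \<xi> \<le> norm \<xi> powr a" for \<xi>
    proof -
      have "?m \<xi> \<le> ((norm \<xi>)\<^sup>2) powr (a / 2)"
        using lap_symbol_le[OF h, of \<xi>] lap_symbol_nonneg[of h \<xi>] a by (intro powr_mono2) auto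
      also have "(norm \<xi>)\<^sup>2 = norm \<xi> powr 2" by simp
      finally show ?thesis by (simp only: powr_powr) simp
    qed
    then show "AE \<xi> in lborel. norm (?e \<xi> * (complex_of_real (?m \<xi>) * U \<xi>)) \<le> norm (norm \<xi> powr a * norm (U \<xi>))"
      by (intro AE_I2) (auto simp: norm_mult intro!: mult_right_mono)
  qed measurable
  have "complex_of_real (walk_frac_lap h a (\<lambda>k. u (grid_pt h k)) j) = walk_frac_lap h a (\<lambda>k. complex_of_real (u (grid_pt h k))) j"
    using a B by (intro walk_frac_lap_of_real[symmetric]) auto
  also have "(\<lambda>k. complex_of_real (u (grid_pt h k))) = wave_synthesis h U"
    by (simp add: wave_synthesis_def inv fun_eq_iff)
  also have "walk_frac_lap h a (wave_synthesis h U) j = (LINT \<xi>|lborel. ?e \<xi> * (complex_of_real (?m \<xi>) * U \<xi>))"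
    unfolding walk_frac_lap_wave_synthesis[OF U(1) h a(2,3)] by (simp add: wave_synthesis_def)
  finally have 1: "complex_of_real (walk_frac_lap h a (\<lambda>k. u (grid_pt h k)) j) = \<dots>" .
  have 2: "complex_of_real L = (LINT \<xi>|lborel. ?e \<xi> * (complex_of_real (norm \<xi> powr a) * U \<xi>))"
    using has_frac_lap_imp_fourier_multiplier[OF L _ _ U(1) _ inv] a i1 by simp
  have "\<bar>walk_frac_lap h a (\<lambda>k. u (grid_pt h k)) j - L\<bar> = norm (complex_of_real (walk_frac_lap h a (\<lambda>k. u (grid_pt h k)) j) - complex_of_real L)"
    by (simp flip: of_real_diff)
  also have "\<dots> = norm (LINT \<xi>|lborel. ?e \<xi> * (complex_of_real (?m \<xi>) * U \<xi>) - ?e \<xi> * (complex_of_real (norm \<xi> powr a) * U \<xi>))"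
    unfolding 1 2 using i2 i3 by simp
  also have "\<dots> \<le> (LINT \<xi>|lborel. norm (?e \<xi> * (complex_of_real (?m \<xi>) * U \<xi>) - ?e \<xi> * (complex_of_real (norm \<xi> powr a) * U \<xi>)))"
    by (rule integral_norm_bound)
  also have "\<dots> \<le> (LINT \<xi>|lborel. h powr s * ((1 + norm \<xi> powr t) * norm (U \<xi>)))"
  proof (rule integral_mono)
    show "integrable lborel (\<lambda>\<xi>. norm (?e \<xi> * (complex_of_real (?m \<xi>) * U \<xi>) - ?e \<xi> * (complex_of_real (norm \<xi> powr a) * U \<xi>)))"
      using i3 i2 by (intro integrable_norm Bochner_Integration.integrable_diff)
    show "integrable lborel (\<lambda>\<xi>. h powr s * ((1 + norm \<xi> powr t) * norm (U \<xi>)))"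
      using U(2) by (rule integrable_mult_right)
    fix \<xi> :: "real ^ 'd"
    have "?e \<xi> * (complex_of_real (?m \<xi>) * U \<xi>) - ?e \<xi> * (complex_of_real (norm \<xi> powr a) * U \<xi>) = ?e \<xi> * (complex_of_real (?m \<xi> - norm \<xi> powr a) * U \<xi>)"
      by (simp add: algebra_simps)
    then have "norm (?e \<xi> * (complex_of_real (?m \<xi>) * U \<xi>) - ?e \<xi> * (complex_of_real (norm \<xi> powr a) * U \<xi>)) = \<bar>norm \<xi> powr a - ?m \<xi>\<bar> * norm (U \<xi>)"
      by (simp only: norm_mult norm_of_real norm_exp_i_times mult_1_left abs_minus_commute)
    also have "\<dots> \<le> (h powr s * norm \<xi> powr (a + s)) * norm (U \<xi>)"
      using lap_symbol_error[OF h, of a s \<xi>] a s by (intro mult_right_mono) auto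
    also have "\<dots> \<le> (h powr s * (1 + norm \<xi> powr t)) * norm (U \<xi>)"
      using powr_le_one_plus_powr[of "norm \<xi>" "a + s" t] a s by (intro mult_right_mono mult_left_mono) auto
    finally show "norm (?e \<xi> * (complex_of_real (?m \<xi>) * U \<xi>) - ?e \<xi> * (complex_of_real (norm \<xi> powr a) * U \<xi>)) \<le> h powr s * ((1 + norm \<xi> powr t) * norm (U \<xi>))"
      by (simp add: mult.assoc)
  qed
  finally show ?thesis by simp
qed

theorem theorem3p2:
  fixes \<Omega> :: "(real ^ 'd) set"
    and \<alpha> b :: "real ^ 'd \<Rightarrow> real"
    and \<alpha>min \<alpha>max :: real
  assumes dom: "smooth_bounded_domain \<Omega>"
    and \<alpha>_cont: "continuous_on UNIV \<alpha>"
    and \<alpha>_bounds: "0 < \<alpha>min" "\<And>x. \<alpha>min \<le> \<alpha> x" "\<And>x. \<alpha> x \<le> \<alpha>max" "\<alpha>max < 2"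
    and b_nonneg: "\<And>x. x \<in> \<Omega> \<Longrightarrow> 0 \<le> b x"
  shows
    "(\<forall>(f :: real ^ 'd \<Rightarrow> real) h. 0 < h \<longrightarrow> (\<exists>!u. scheme_solution \<Omega> \<alpha> b f h u)) \<and>
     (\<forall>h0 > 0. \<exists>c3 :: real. \<forall>(f :: real ^ 'd \<Rightarrow> real) h u.
        0 < h \<longrightarrow> h \<le> h0 \<longrightarrow> scheme_solution \<Omega> \<alpha> b f h u \<longrightarrow>
        grid_norm h \<Omega> u \<le> c3 * grid_norm h \<Omega> (\<lambda>j. f (grid_pt h j))) \<and>
     (\<forall>(f :: real ^ 'd \<Rightarrow> real) (u :: real ^ 'd \<Rightarrow> real) s h0.
        0 < h0 \<longrightarrow> 0 < s \<longrightarrow> s \<le> 2 \<longrightarrow>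
        exact_solution \<Omega> \<alpha> b f u \<longrightarrow>
        (\<lambda>x. complex_of_real (u x)) \<in> barron_space (s + \<alpha>max) \<longrightarrow>
        (\<exists>c :: real. \<forall>h uh.
           0 < h \<longrightarrow> h \<le> h0 \<longrightarrow> scheme_solution \<Omega> \<alpha> b f h uh \<longrightarrow>
           grid_norm h \<Omega> (\<lambda>j. u (grid_pt h j) - uh j) \<le> c * h powr s))"
proof (intro conjI allI impI)
  have \<alpha>0: "0 < \<alpha> x" and \<alpha>2: "\<alpha> x < 2" for x
    using \<alpha>_bounds(1,4) \<alpha>_bounds(2,3)[of x] by linarith+
  have bdd: "bounded \<Omega>" using dom by (simp add: smooth_bounded_domain_def)
  note fin = finite_grid_indices[OF bdd]
  note scheme_iff = scheme_solution_iff_walk[OF bdd _ \<alpha>0 \<alpha>2]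
  have b0: "0 \<le> b (grid_pt h j)" if "j \<in> grid_indices h \<Omega>" for h j
    using b_nonneg that by (simp add: grid_indices_def)
  note barrier = uniform_barrier[OF bdd]
  {
    fix f :: "real ^ 'd \<Rightarrow> real" and h :: real assume h: "0 < h"
    obtain \<kappa> :: real and \<xi> :: "real ^ 'd" where \<kappa>: "0 < \<kappa>" "\<And>h' a j. 0 < h' \<Longrightarrow> h' \<le> h \<Longrightarrow> 0 < a \<Longrightarrow> a < 2 \<Longrightarrow> j \<in> grid_indices h' \<Omega> \<Longrightarrow>
       \<kappa> \<le> lap_symbol h' \<xi> powr (a / 2) * cos (\<xi> \<bullet> grid_pt h' j)"
      using barrier[OF h] by blast
    show "\<exists>!u. scheme_solution \<Omega> \<alpha> b f h u"
      unfolding scheme_iff[OF h]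
      by (rule walk_scheme_unique_solution[OF fin[OF h] h \<alpha>0 \<alpha>2 \<kappa>(1) \<kappa>(2)[OF h order_refl \<alpha>0 \<alpha>2] b0])
  next
    fix h0 :: real assume h0: "0 < h0"
    obtain \<kappa> :: real and \<xi> :: "real ^ 'd" where \<kappa>: "0 < \<kappa>" "\<And>h a j. 0 < h \<Longrightarrow> h \<le> h0 \<Longrightarrow> 0 < a \<Longrightarrow> a < 2 \<Longrightarrow> j \<in> grid_indices h \<Omega> \<Longrightarrow>
       \<kappa> \<le> lap_symbol h \<xi> powr (a / 2) * cos (\<xi> \<bullet> grid_pt h j)"
      using barrier[OF h0] by blast
    have stability: "\<bar>v j\<bar> \<le> 2 * F / \<kappa>"
      if "0 < h" "h \<le> h0" "0 \<le> F" "\<And>j. j \<notin> grid_indices h \<Omega> \<Longrightarrow> v j = 0"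
        "\<And>j. j \<in> grid_indices h \<Omega> \<Longrightarrow> \<bar>walk_frac_lap h (\<alpha> (grid_pt h j)) v j + b (grid_pt h j) * v j\<bar> \<le> F"
      for h F v j
      by (rule walk_scheme_stability[OF fin[OF that(1)] that(1) \<alpha>0 \<alpha>2 \<kappa>(1) \<kappa>(2)[OF that(1,2) \<alpha>0 \<alpha>2] b0 that(4,3,5)])
    show "\<exists>c3 :: real. \<forall>(f :: real ^ 'd \<Rightarrow> real) h u.
        0 < h \<longrightarrow> h \<le> h0 \<longrightarrow> scheme_solution \<Omega> \<alpha> b f h u \<longrightarrow>
        grid_norm h \<Omega> u \<le> c3 * grid_norm h \<Omega> (\<lambda>j. f (grid_pt h j))"
    proof (intro exI[of _ "2 / \<kappa>"] allI impI)
      fix f :: "real ^ 'd \<Rightarrow> real" and h u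
      assume h: "0 < h" "h \<le> h0" and sol: "scheme_solution \<Omega> \<alpha> b f h u"
      let ?F = "grid_norm h \<Omega> (\<lambda>j. f (grid_pt h j))"
      have F0: "0 \<le> ?F" by (rule grid_norm_nonneg[OF fin[OF h(1)]])
      show "grid_norm h \<Omega> u \<le> 2 / \<kappa> * ?F"
      proof (rule grid_norm_le[OF fin[OF h(1)]])
        show "0 \<le> 2 / \<kappa> * ?F" using F0 \<kappa>(1) by simp
        have "\<bar>u j\<bar> \<le> 2 * ?F / \<kappa>" for j
          using sol grid_norm_upper[OF fin[OF h(1)], of _ "\<lambda>j. f (grid_pt h j)"] unfolding scheme_iff[OF h(1)]
          by (intro stability[OF h F0]) auto
        then show "\<bar>u j\<bar> \<le> 2 / \<kappa> * ?F" for j by simp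
      qed
    qed

    fix f u :: "real ^ 'd \<Rightarrow> real" and s :: real
    assume s: "0 < s" "s \<le> 2" and sol: "exact_solution \<Omega> \<alpha> b f u"
      and barron: "(\<lambda>x. complex_of_real (u x)) \<in> barron_space (s + \<alpha>max)"
    let ?u = "\<lambda>x. complex_of_real (u x)"
    define U where "U = (\<lambda>\<xi>. complex_of_real (1 / (2 * pi) ^ CARD('d)) * fourier ?u \<xi>)"
    define M where "M = (LINT \<xi>|lborel. (1 + norm \<xi> powr (s + \<alpha>max)) * norm (U \<xi>))"
    have cont: "continuous_on UNIV ?u" and ui: "integrable lborel ?u" using barron by (auto simp: barron_space_def)
    have "compact (closure \<Omega>)" using bdd by simp
    then have "bounded (?u ` closure \<Omega>)"
      by (intro compact_imp_bounded compact_continuous_image continuous_on_subset[OF cont]) auto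
    then obtain B where B: "0 < B" "\<And>x. x \<in> closure \<Omega> \<Longrightarrow> \<bar>u x\<bar> \<le> B" by (auto simp: bounded_pos)
    have u0: "u x = 0" if "x \<notin> \<Omega>" for x using sol that by (simp add: exact_solution_def)
    \<comment> \<open>A continuous function vanishing outside a bounded set is bounded.\<close>
    have uB: "\<bar>u x\<bar> \<le> B" for x using B u0[of x] closure_subset[of \<Omega>] by (cases "x \<in> \<Omega>") auto
    have Ui: "integrable lborel U" unfolding U_def using barron_space_integrable(2)[OF barron] by simp
    have UW: "integrable lborel (\<lambda>\<xi>. (1 + norm \<xi> powr (s + \<alpha>max)) * norm (U \<xi>))"
    proof -
      have "(1 + norm \<xi> powr (s + \<alpha>max)) * norm (U \<xi>) = (1 / (2 * pi) ^ CARD('d)) * ((1 + norm \<xi> powr (s + \<alpha>max)) * norm (fourier ?u \<xi>))" for \<xi>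
        by (simp add: U_def norm_mult norm_divide norm_power)
      then show ?thesis using barron_space_integrable(1)[OF barron] by simp
    qed
    have inv: "complex_of_real (u y) = (LINT \<xi>|lborel. exp (\<i> * complex_of_real (\<xi> \<bullet> y)) * U \<xi>)" for y
    proof -
      have "(LINT \<xi>|lborel. exp (\<i> * complex_of_real (\<xi> \<bullet> y)) * U \<xi>) = (LINT \<xi>|lborel. complex_of_real (1 / (2 * pi) ^ CARD('d)) * (exp (\<i> * complex_of_real (\<xi> \<bullet> y)) * fourier ?u \<xi>))"
        unfolding U_def by (simp only: mult.left_commute)
      also have "\<dots> = complex_of_real (1 / (2 * pi) ^ CARD('d)) * (complex_of_real ((2 * pi) ^ CARD('d)) * ?u y)"
        using fourier_inversion[OF cont ui _ barron_space_integrable(2)[OF barron], of B y] uB by simp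
      finally show ?thesis by simp
    qed
    have M0: "0 \<le> M" unfolding M_def by (intro integral_nonneg_AE) auto
    show "\<exists>c :: real. \<forall>h uh.
           0 < h \<longrightarrow> h \<le> h0 \<longrightarrow> scheme_solution \<Omega> \<alpha> b f h uh \<longrightarrow>
           grid_norm h \<Omega> (\<lambda>j. u (grid_pt h j) - uh j) \<le> c * h powr s"
    proof (intro exI[of _ "2 * M / \<kappa>"] allI impI)
      fix h uh assume h: "0 < h" "h \<le> h0" and uh: "scheme_solution \<Omega> \<alpha> b f h uh"
      define F where "F = h powr s * M"
      have F0: "0 \<le> F" using M0 by (simp add: F_def)
      have uh0: "\<And>j. j \<notin> grid_indices h \<Omega> \<Longrightarrow> uh j = 0"
        and uh_eq: "\<And>j. j \<in> grid_indices h \<Omega> \<Longrightarrow> walk_frac_lap h (\<alpha> (grid_pt h j)) uh j + b (grid_pt h j) * uh j = f (grid_pt h j)"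
        using uh unfolding scheme_iff[OF h(1)] by auto
      \<comment> \<open>The error solves the scheme with the consistency error as right-hand side.\<close>
      have "\<bar>u (grid_pt h j) - uh j\<bar> \<le> 2 * F / \<kappa>" for j
      proof (rule stability[OF h F0])
        show "u (grid_pt h j) - uh j = 0" if "j \<notin> grid_indices h \<Omega>" for j
          using u0 uh0 that by (simp add: grid_indices_def)
        fix j assume j: "j \<in> grid_indices h \<Omega>"
        define x where "x = grid_pt h j"
        have x: "x \<in> \<Omega>" using j by (simp add: x_def grid_indices_def)
        obtain L where L: "has_frac_lap \<alpha> u x L" "L + b x * u x = f x"
          using sol x by (auto simp: exact_solution_def)
        have lin: "walk_frac_lap h (\<alpha> x) (\<lambda>k. u (grid_pt h k) - uh k) j = walk_frac_lap h (\<alpha> x) (\<lambda>k. u (grid_pt h k)) j - walk_frac_lap h (\<alpha> x) uh j"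
        proof -
          have uhB: "norm (uh k) \<le> (\<Sum>j\<in>grid_indices h \<Omega>. \<bar>uh j\<bar>)" for k
            using finite_support_bounded[OF fin[OF h(1)] uh0] by simp
          have "walk_frac_lap h (\<alpha> x) (\<lambda>k. 1 *\<^sub>R u (grid_pt h k) + - uh k) j = 1 *\<^sub>R walk_frac_lap h (\<alpha> x) (\<lambda>k. u (grid_pt h k)) j + walk_frac_lap h (\<alpha> x) (\<lambda>k. - uh k) j"
            using uB uhB \<alpha>0 \<alpha>2 by (intro walk_frac_lap_linear[where B = B and B' = "\<Sum>j\<in>grid_indices h \<Omega>. \<bar>uh j\<bar>"]) auto
          then show ?thesis using walk_frac_lap_minus[OF uhB \<alpha>0 \<alpha>2] by simp
        qed
        have "\<bar>walk_frac_lap h (\<alpha> x) (\<lambda>k. u (grid_pt h k)) j - L\<bar> \<le> F"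
          unfolding F_def M_def
          using \<alpha>_bounds(3) by (intro consistency_error[OF L(1)[unfolded x_def] _ \<alpha>0 \<alpha>2 h(1) s _ Ui UW inv uB]) (auto simp: x_def)
        moreover have "walk_frac_lap h (\<alpha> x) (\<lambda>k. u (grid_pt h k) - uh k) j + b x * (u x - uh j) = walk_frac_lap h (\<alpha> x) (\<lambda>k. u (grid_pt h k)) j - L"
          using lin uh_eq[OF j] L(2) by (simp add: x_def[symmetric] algebra_simps)
        ultimately show "\<bar>walk_frac_lap h (\<alpha> (grid_pt h j)) (\<lambda>k. u (grid_pt h k) - uh k) j + b (grid_pt h j) * (u (grid_pt h j) - uh j)\<bar> \<le> F"
          by (simp add: x_def)
      qed
      then have "\<bar>u (grid_pt h j) - uh j\<bar> \<le> 2 * M / \<kappa> * h powr s" for j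
        by (simp add: F_def mult_ac)
      moreover have "0 \<le> 2 * M / \<kappa> * h powr s" using M0 \<kappa>(1) by simp
      ultimately show "grid_norm h \<Omega> (\<lambda>j. u (grid_pt h j) - uh j) \<le> 2 * M / \<kappa> * h powr s"
        by (intro grid_norm_le[OF fin[OF h(1)]]) auto
    qed
  }
qed

end
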